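(* Let $0<p<1$ and $\omega\in\widehat{\mathcal{D}}$. Then the following statements are equivalent: (i) $T(D^p_\omega,H^\infty)$ consists of constant functions only; (ii) $\displaystyle\sup_{0\le r<1}\frac{(1-r)^{2-\frac1p}}{\widehat{\omega}(r)^{\frac1p}}=\infty$; (iii) $\displaystyle\sup_{0\le r<1}\left((1-r)\sum_{k=1}^{\infty}\frac{r^{2(k-1)}}{\widehat{\omega}(1-\frac1k)^{\frac1p}k^{2-\frac1p}}\right)=\infty$; (iv) the identity map $I:D^p_\omega\to D^1_0$ is not bounded (i.e. $D^p_\omega$ is not continuously embedded in $D^1_0$).
   Context: $\mathbb{D}$ is the open unit disc, $\mathcal{H}(\mathbb{D})$ the analytic functions on it, $dA(z)=\frac{dx\,dy}{\pi}$. A radial weight is a non-negative $\omega\in L^1([0,1))$ extended by $\omega(z)=\omega(|z|)$; always assume $\widehat\omega(r)=\int_r^1\omega(s)\,ds>0$ for all $0\le r<1$ (and $\widehat\omega(z)=\widehat\omega(|z|)$). $\omega\in\widehat{\mathcal{D}}$ means there is $C\ge1$ with $\widehat\omega(r)\le C\widehat\omega(\frac{1+r}{2})$ for all $0\le r<1$. For $0<p<\infty$, $A^p_\omega$ is the space of $f\in\mathcal H(\mathbb D)$ with $\|f\|_{A^p_\omega}^p=\int_{\mathbb D}|f|^p\omega\,dA<\infty$, and the weighted Dirichlet space $D^p_\omega$ consists of $f\in\mathcal H(\mathbb D)$ with $\|f\|_{D^p_\omega}^p=\|f'\|^p_{A^p_\omega}+|f(0)|^p<\infty$. For $-1<\alpha<\infty$,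 $D^p_\alpha$ denotes $D^p_\omega$ with $\omega(z)=(\alpha+1)(1-|z|^2)^\alpha$; in particular $\|f\|_{D^1_0}=\int_{\mathbb D}|f'|\,dA+|f(0)|$. For $g\in\mathcal H(\mathbb D)$, $T_g(f)(z)=\int_0^z f(\zeta)g'(\zeta)\,d\zeta$. For a (quasi-)Banach space $X\subset\mathcal H(\mathbb D)$, $T(X,H^\infty)$ (resp. $T_c(X,H^\infty)$) is the set of $g\in\mathcal H(\mathbb D)$ such that $T_g:X\to H^\infty$ is bounded (resp. compact). *)

theory Defs
  imports "HOL-Complex_Analysis.Complex_Analysis"
begin

definition disc :: "complex set" where
  "disc = ball 0 1"

text \<open>Radial weights are represented by their profile omega on [0,1);
  omega(z) = omega(|z|).  hat omega r = integral of omega over [r,1).\<close>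
definition omega_hat :: "(real \<Rightarrow> real) \<Rightarrow> real \<Rightarrow> real" where
  "omega_hat \<omega> r = (LINT s:{r..<1}|lborel. \<omega> s)"

definition radial_weight :: "(real \<Rightarrow> real) \<Rightarrow> bool" where
  "radial_weight \<omega> \<longleftrightarrow>
     (\<forall>s\<in>{0..<1}. 0 \<le> \<omega> s) \<and> set_integrable lborel {0..<1} \<omega> \<and>
     (\<forall>r\<in>{0..<1}. omega_hat \<omega> r > 0)"

definition D_hat :: "(real \<Rightarrow> real) \<Rightarrow> bool" where
  "D_hat \<omega> \<longleftrightarrow> (\<exists>C\<ge>1. \<forall>r\<in>{0..<1}. omega_hat \<omega> r \<le> C * omega_hat \<omega> ((1 + r) / 2))"

text \<open>Integral over the disc with respect to dA = dx dy / pi (non-negative integrands).\<close>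
definition area_int :: "(complex \<Rightarrow> real) \<Rightarrow> ennreal" where
  "area_int F = (\<integral>\<^sup>+ z \<in> disc. ennreal (F z) \<partial>lborel) / ennreal pi"

definition D_int :: "real \<Rightarrow> (real \<Rightarrow> real) \<Rightarrow> (complex \<Rightarrow> complex) \<Rightarrow> ennreal" where
  "D_int p \<omega> f = area_int (\<lambda>z. norm (deriv f z) powr p * \<omega> (cmod z))"

definition D_space :: "real \<Rightarrow> (real \<Rightarrow> real) \<Rightarrow> (complex \<Rightarrow> complex) set" where
  "D_space p \<omega> = {f. f holomorphic_on disc \<and> D_int p \<omega> f < \<infinity>}"

definition D_norm :: "real \<Rightarrow> (real \<Rightarrow> real) \<Rightarrow> (complex \<Rightarrow> complex) \<Rightarrow> real" where
  "D_norm p \<omega> f = (enn2real (D_int p \<omega> f) + norm (f 0) powr p) powr (1 / p)"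

text \<open>Standard weight (alpha+1)(1-|z|^2)^alpha; D^p_alpha = D^p_omega with this weight.\<close>
definition std_weight :: "real \<Rightarrow> real \<Rightarrow> real" where
  "std_weight \<alpha> r = (\<alpha> + 1) * (1 - r\<^sup>2) powr \<alpha>"

definition T_op :: "(complex \<Rightarrow> complex) \<Rightarrow> (complex \<Rightarrow> complex) \<Rightarrow> complex \<Rightarrow> complex" where
  "T_op g f z = contour_integral (linepath 0 z) (\<lambda>\<zeta>. f \<zeta> * deriv g \<zeta>)"

definition T_Hinf :: "real \<Rightarrow> (real \<Rightarrow> real) \<Rightarrow> (complex \<Rightarrow> complex) set" where
  "T_Hinf p \<omega> = {g. g holomorphic_on disc \<and>
     (\<exists>C. \<forall>f\<in>D_space p \<omega>. \<forall>z\<in>disc. norm (T_op g f z) \<le> C * D_norm p \<omega> f)}"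

definition id_bounded_into_D10 :: "real \<Rightarrow> (real \<Rightarrow> real) \<Rightarrow> bool" where
  "id_bounded_into_D10 p \<omega> \<longleftrightarrow>
     (\<exists>C. \<forall>f\<in>D_space p \<omega>. f \<in> D_space 1 (std_weight 0) \<and>
            D_norm 1 (std_weight 0) f \<le> C * D_norm p \<omega> f)"

end

theory Submission
  imports Defs
begin

text \<open>
  Write \<open>\<omega>\<^sub>h(r)\<close> for the tail integral of \<open>\<omega>\<close>. All four conditions are compared with boundedness of the ratio \<open>(1-r)\<^bsup>2-1/p\<^esup> / \<omega>\<^sub>h(r)\<^bsup>1/p\<^esup>\<close>; for the
  series this is an averaging argument.

  If the ratio is bounded, then \<open>\<omega>\<^sub>h(r) \<ge> c (1-r)\<^bsup>2p-1\<^esup>\<close> and \<open>p > 1/2\<close>. Subharmonicity of \<open>\<bar>f'\<bar>\<^sup>p\<close> gives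
  \<open>\<bar>f'(z)\<bar> \<le> C \<parallel>f\<parallel> (1-\<bar>z\<bar>)\<^sup>-\<^sup>2\<close>, whence \<open>\<bar>f'\<bar> \<le> C \<parallel>f\<parallel>\<^bsup>1-p\<^esup> (1-\<bar>z\<bar>)\<^bsup>2p-2\<^esup> \<bar>f'\<bar>\<^sup>p\<close>; since the circle means of
  \<open>\<bar>f'\<bar>\<^sup>p\<close> increase, the weight \<open>(1-r)\<^bsup>2p-2\<^esup>\<close> may be replaced by \<open>\<omega>\<close>, whose tails dominate its tails. So the
  identity is bounded into \<open>D\<^sup>1\<^sub>0\<close>.

  If the identity is bounded, the symbol \<open>g(z) = z\<close> is admissible: a primitive \<open>h\<close> of \<open>f\<close> differs from its mean
  \<open>h(0)\<close> on a circle by at most the integral of \<open>\<bar>f\<bar>\<close> over that circle, which \<open>\<parallel>f\<parallel>\<close> in \<open>D\<^sup>1\<^sub>0\<close> controls.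

  Finally let \<open>g\<close> be admissible with a Taylor coefficient \<open>g\<^sub>j\<^sub>+\<^sub>1 \<noteq> 0\<close>, and put \<open>f\<^sub>a(z) = (1 - cnj a z)\<^bsup>-M\<^esup>\<close>.
  Along the ray through \<open>a = \<rho>e\<^bsup>ix\<^esup>\<close> the function \<open>f\<^sub>a\<close> does not depend on \<open>x\<close>, so integrating
  \<open>e\<^bsup>-i(j+1)x\<^esup> T\<^sub>g f\<^sub>a(a)\<close> over \<open>x\<close> isolates \<open>g\<^sub>j\<^sub>+\<^sub>1\<close>; comparison with \<open>\<parallel>f\<^sub>a\<parallel>\<close>, estimated by means of the doubling
  condition, bounds the ratio.
\<close>

section \<open>Polar coordinates\<close>

text \<open>Where the exponents come from. Raising the bounded ratio to the power p turns 2 - 1/p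
  into 2p - 1. Since circle means increase, the mean of |f'|^p at a radius s near 1 is at most a
  constant times ||f||^p / \<omega>_h(s), hence times ||f||^p (1-s)^(1-2p). Passing from the mean to
  a point costs one more factor 1/(1-|z|), so |f'|^p is bounded by (1-|z|)^(-2p) ||f||^p: this is
  the exponent -2 of the overview. The weight (1-r)^(2p-2) has the tails (1-r)^(2p-1)/(2p-1), which
  is exactly what the lower bound of \<omega>_h dominates. The power |f'|^p is not smooth at the
  zeros of f'. Its circle means are therefore reached as limits of those of (|F|^2 + e)^(p/2), whose
  Laplacian can be computed. The kernel exponent M must be large compared with the doubling
  constant, yet it leaves no trace in the result: with t = 1-|a| the averaged value of T_g f_a(a) is
  at least of order t^(1-M), while ||f_a|| is at most of order t^(1/p-M-1) \<omega>_h(|a|)^(1/p),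
  and the quotient of the two powers of t is t^(2-1/p).\<close>

lemma lborel_complex_eq_distr:
  "(lborel :: complex measure) = distr (lborel :: (real \<times> real) measure) borel (\<lambda>(x, y). Complex x y)"
proof (rule lborel_eqI)
  fix l u :: complex
  assume lu: "\<And>b. b \<in> Basis \<Longrightarrow> l \<bullet> b \<le> u \<bullet> b"
  have le: "Re l \<le> Re u" "Im l \<le> Im u"
    using lu[of 1] lu[of \<i>] by (auto simp: Basis_complex_def)
  have cont: "continuous_on UNIV (\<lambda>(x, y). Complex x y)"
    by (auto simp: split_beta intro!: continuous_intros)
  have vim: "(\<lambda>(x, y). Complex x y) -` box l u = box (Re l, Im l) (Re u, Im u)"
    by (auto simp: box_def Basis_complex_def Basis_prod_def)
  show "emeasure (distr lborel borel (\<lambda>(x, y). Complex x y)) (box l u) = (\<Prod>b\<in>Basis. (u - l) \<bullet> b)"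
    using le by (subst emeasure_distr)
      (auto simp: vim emeasure_lborel_box_eq Basis_complex_def Basis_prod_def prod.union_disjoint
         prod.reindex inj_on_def
       intro!: borel_measurable_continuous_onI cont simp flip: space_borel)
qed simp

text \<open>Both orders of integration are recorded because a horizontal shear is undone in an inner
  x-integral and a vertical one in an inner y-integral.\<close>

lemma nn_integral_lborel_complex:
  assumes [measurable]: "H \<in> borel_measurable borel"
  shows "(\<integral>\<^sup>+z. H z \<partial>lborel) = (\<integral>\<^sup>+x. \<integral>\<^sup>+y. H (Complex x y) \<partial>lborel \<partial>lborel)"
    and "(\<integral>\<^sup>+z. H z \<partial>lborel) = (\<integral>\<^sup>+y. \<integral>\<^sup>+x. H (Complex x y) \<partial>lborel \<partial>lborel)"
proof -
  have [measurable]: "(\<lambda>(x, y). Complex x y) \<in> borel_measurable borel"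
    by (intro borel_measurable_continuous_onI) (auto simp: split_beta intro!: continuous_intros)
  have [measurable]: "(\<lambda>(x, y). H (Complex x y)) \<in> borel_measurable borel"
    using measurable_compose[of "\<lambda>(x, y). Complex x y" borel borel H borel] by (simp add: split_beta)
  have *: "(\<integral>\<^sup>+z. H z \<partial>lborel) = (\<integral>\<^sup>+q. H (Complex (fst q) (snd q)) \<partial>(lborel \<Otimes>\<^sub>M lborel))"
    by (subst lborel_complex_eq_distr) (simp add: nn_integral_distr lborel_prod split_beta)
  have m: "(\<lambda>(x, y). H (Complex x y)) \<in> borel_measurable (lborel \<Otimes>\<^sub>M lborel)"
    by (simp add: lborel_prod)
  show "(\<integral>\<^sup>+z. H z \<partial>lborel) = (\<integral>\<^sup>+x. \<integral>\<^sup>+y. H (Complex x y) \<partial>lborel \<partial>lborel)"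
    using lborel.nn_integral_fst[OF m] by (simp add: * case_prod_unfold)
  show "(\<integral>\<^sup>+z. H z \<partial>lborel) = (\<integral>\<^sup>+y. \<integral>\<^sup>+x. H (Complex x y) \<partial>lborel \<partial>lborel)"
    using lborel_pair.nn_integral_snd[OF m] by (simp add: * case_prod_unfold)
qed

section \<open>Rotation invariance of planar Lebesgue measure\<close>

text \<open>On each horizontal line the shear is a translation, by \<open>a * y\<close>.\<close>

lemma nn_integral_lborel_shear_Re:
  assumes [measurable]: "H \<in> borel_measurable borel"
  shows "(\<integral>\<^sup>+z. H (Complex (Re z + a * Im z) (Im z)) \<partial>lborel) = (\<integral>\<^sup>+z. H z \<partial>lborel)"
proof -
  have [measurable]: "(\<lambda>z. H (Complex (Re z + a * Im z) (Im z))) \<in> borel_measurable borel"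
    by (rule measurable_compose[of _ borel borel]) (auto intro!: borel_measurable_continuous_onI continuous_intros)
  have [measurable]: "(\<lambda>x. H (Complex x y)) \<in> borel_measurable borel" for y
    by (rule measurable_compose[of _ borel borel]) (auto intro!: borel_measurable_continuous_onI continuous_intros)
  have "(\<integral>\<^sup>+x. H (Complex (x + a * y) y) \<partial>lborel) = (\<integral>\<^sup>+x. H (Complex x y) \<partial>lborel)" for y
    using nn_integral_real_affine[of "\<lambda>x. H (Complex x y)" 1 "a * y"] by (simp add: add.commute)
  then show ?thesis
    by (simp add: nn_integral_lborel_complex(2))
qed

lemma nn_integral_lborel_shear_Im:
  assumes [measurable]: "H \<in> borel_measurable borel"
  shows "(\<integral>\<^sup>+z. H (Complex (Re z) (Im z + a * Re z)) \<partial>lborel) = (\<integral>\<^sup>+z. H z \<partial>lborel)"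
proof -
  have [measurable]: "(\<lambda>z. H (Complex (Re z) (Im z + a * Re z))) \<in> borel_measurable borel"
    by (rule measurable_compose[of _ borel borel]) (auto intro!: borel_measurable_continuous_onI continuous_intros)
  have [measurable]: "(\<lambda>y. H (Complex x y)) \<in> borel_measurable borel" for x
    by (rule measurable_compose[of _ borel borel]) (auto intro!: borel_measurable_continuous_onI continuous_intros)
  have "(\<integral>\<^sup>+y. H (Complex x (y + a * x)) \<partial>lborel) = (\<integral>\<^sup>+y. H (Complex x y) \<partial>lborel)" for x
    using nn_integral_real_affine[of "\<lambda>y. H (Complex x y)" 1 "a * x"] by (simp add: add.commute)
  then show ?thesis
    by (simp add: nn_integral_lborel_complex(1))
qed

text \<open>If \<open>sin t \<noteq> 0\<close>, rotation by \<open>t\<close> is the product of three shears, with slopes \<open>-tan (t/2)\<close>,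
  \<open>sin t\<close> and \<open>-tan (t/2)\<close>.\<close>
lemma nn_integral_lborel_rotate_aux:
  assumes [measurable]: "H \<in> borel_measurable borel" and "sin t \<noteq> 0"
  shows "(\<integral>\<^sup>+z. H (z * cis t) \<partial>lborel) = (\<integral>\<^sup>+z. H z \<partial>lborel)"
proof -
  define a where "a = (cos t - 1) / sin t"
  define S where "S = (\<lambda>z. Complex (Re z + a * Im z) (Im z))"
  define T where "T = (\<lambda>z. Complex (Re z) (Im z + sin t * Re z))"
  have [measurable]: "S \<in> borel_measurable borel" "T \<in> borel_measurable borel"
    unfolding S_def T_def by (auto intro!: borel_measurable_continuous_onI continuous_intros)
  have a1: "a * sin t = cos t - 1"
    using assms(2) by (simp add: a_def)
  have "(cos t - 1) * (cos t + 1) = - (sin t * sin t)"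
    using sin_cos_squared_add[of t] by (simp add: power2_eq_square algebra_simps)
  then have a2: "a * (cos t + 1) = - sin t"
    using assms(2) by (simp add: a_def)
  have eq: "S (T (S z)) = z * cis t" for z
  proof (rule complex_eqI)
    have "Re (S (T (S z))) = Re z * (1 + a * sin t) + Im z * (2 * a + a * (a * sin t))"
      by (simp add: S_def T_def algebra_simps)
    also have "\<dots> = Re z * cos t + Im z * (a * (cos t + 1))"
      unfolding a1 by (simp add: algebra_simps)
    finally show "Re (S (T (S z))) = Re (z * cis t)"
      by (simp add: a2)
    have "Im (S (T (S z))) = Re z * sin t + Im z * (1 + a * sin t)"
      by (simp add: S_def T_def algebra_simps)
    then show "Im (S (T (S z))) = Im (z * cis t)"
      by (simp add: a1)
  qed
  have shS: "(\<integral>\<^sup>+z. K (S z) \<partial>lborel) = (\<integral>\<^sup>+z. K z \<partial>lborel)"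
    and shT: "(\<integral>\<^sup>+z. K (T z) \<partial>lborel) = (\<integral>\<^sup>+z. K z \<partial>lborel)"
    if "K \<in> borel_measurable borel" for K :: "complex \<Rightarrow> ennreal"
    using nn_integral_lborel_shear_Re[OF that, of a] nn_integral_lborel_shear_Im[OF that, of "sin t"]
    by (simp_all add: S_def T_def)
  have "(\<integral>\<^sup>+z. H (S (T (S z))) \<partial>lborel) = (\<integral>\<^sup>+z. H (S (T z)) \<partial>lborel)"
    by (rule shS) measurable
  also have "\<dots> = (\<integral>\<^sup>+z. H (S z) \<partial>lborel)"
    by (rule shT) measurable
  also have "\<dots> = (\<integral>\<^sup>+z. H z \<partial>lborel)"
    by (rule shS) measurable
  finally show ?thesis by (simp add: eq)
qed

lemma nn_integral_lborel_rotate: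
  assumes [measurable]: "H \<in> borel_measurable borel"
  shows "(\<integral>\<^sup>+z. H (z * cis t) \<partial>lborel) = (\<integral>\<^sup>+z. H z \<partial>lborel)"
proof (cases "sin t = 0")
  case False
  then show ?thesis by (rule nn_integral_lborel_rotate_aux[OF assms])
next
  case True
  \<comment> \<open>The shear slopes have \<open>sin t\<close> in the denominator. Splitting off a
    quarter turn leaves two rotations whose angles have nonzero sine.\<close>
  have nz: "sin (t - pi/2) \<noteq> 0"
    using True sin_cos_squared_add[of t] by (auto simp: sin_diff)
  have [measurable]: "(\<lambda>z. H (z * cis (pi/2))) \<in> borel_measurable borel"
    by (rule measurable_compose[of _ borel borel]) (auto intro!: borel_measurable_continuous_onI continuous_intros)
  have "(\<integral>\<^sup>+z. H (z * cis t) \<partial>lborel) = (\<integral>\<^sup>+z. H (z * cis (t - pi/2) * cis (pi/2)) \<partial>lborel)"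
    by (simp only: mult.assoc cis_mult) simp
  also have "\<dots> = (\<integral>\<^sup>+z. H (z * cis (pi/2)) \<partial>lborel)"
    using nn_integral_lborel_rotate_aux[of "\<lambda>z. H (z * cis (pi/2))", OF _ nz] by simp
  also have "\<dots> = (\<integral>\<^sup>+z. H z \<partial>lborel)"
    by (rule nn_integral_lborel_rotate_aux) auto
  finally show ?thesis .
qed

text \<open>A disc of radius r has area pi r^2, so the push-forward of Lebesgue measure under the
  modulus and the measure with density 2 pi r agree on the half-lines \<open>{..<r}\<close>, an
  intersection-stable generator of the Borel sets.\<close>

lemma nn_integral_lborel_norm_complex:
  assumes [measurable]: "G \<in> borel_measurable borel"
  shows "(\<integral>\<^sup>+z. G (cmod z) \<partial>lborel) = (\<integral>\<^sup>+r\<in>{0..}. G r * ennreal (2 * pi * r) \<partial>lborel)"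
proof -
  have em: "emeasure (distr lborel borel cmod) {..<r} = ennreal (pi * r\<^sup>2)" if "r \<ge> 0" for r
  proof -
    have "cmod -` {..<r} = ball 0 r" by auto
    then show ?thesis using that
      by (subst emeasure_distr) (auto simp: emeasure_ball unit_ball_vol_2)
  qed
  have em': "emeasure (density lborel (\<lambda>r. ennreal (2 * pi * r) * indicator {0..} r)) {..<r} = ennreal (pi * r\<^sup>2)"
    if "r \<ge> 0" for r
  proof -
    have "emeasure (density lborel (\<lambda>r. ennreal (2 * pi * r) * indicator {0..} r)) {..<r}
        = (\<integral>\<^sup>+x. ennreal (2 * pi * x) * indicator {0..} x * indicator {..<r} x \<partial>lborel)"
      by (subst emeasure_density) auto
    also have "\<dots> = (\<integral>\<^sup>+x. ennreal (2 * pi * x) * indicator {0..r} x \<partial>lborel)"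
      using AE_lborel_singleton[of r]
      by (intro nn_integral_cong_AE, eventually_elim) (auto split: split_indicator)
    also have "\<dots> = ennreal (pi * r\<^sup>2 - pi * 0\<^sup>2)"
      using that by (intro nn_integral_FTC_Icc) (auto intro!: derivative_eq_intros)
    finally show ?thesis by simp
  qed
  have "distr lborel borel cmod = density lborel (\<lambda>r. ennreal (2 * pi * r) * indicator {0..} r)"
  proof (rule measure_eqI_generator_eq[where E = "range (\<lambda>r::real. {..<r})" and \<Omega> = UNIV
        and A = "\<lambda>n. {..<real n}"])
    show "Int_stable (range (\<lambda>r::real. {..<r}))"
      unfolding Int_stable_def
    proof safe
      fix a b :: real
      show "{..<a} \<inter> {..<b} \<in> range (\<lambda>r. {..<r})"
        by (rule range_eqI[where x = "min a b"]) auto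
    qed
    fix X assume "X \<in> range (\<lambda>r::real. {..<r})"
    then obtain r where X: "X = {..<r}" by auto
    show "emeasure (distr lborel borel cmod) X = emeasure (density lborel (\<lambda>r. ennreal (2 * pi * r) * indicator {0..} r)) X"
    proof (cases "r \<ge> 0")
      case True then show ?thesis by (simp add: X em em')
    next
      case False
      \<comment> \<open>For negative r both sides vanish: \<open>X\<close> lies in
        \<open>{..<0}\<close>, which has measure 0 by the formulas at radius 0.\<close>
      have "emeasure (distr lborel borel cmod) X \<le> emeasure (distr lborel borel cmod) {..<0}"
        using False by (intro emeasure_mono) (auto simp: X)
      moreover have "emeasure (density lborel (\<lambda>r. ennreal (2 * pi * r) * indicator {0..} r)) X
          \<le> emeasure (density lborel (\<lambda>r. ennreal (2 * pi * r) * indicator {0..} r)) {..<0}"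
        using False by (intro emeasure_mono) (auto simp: X)
      ultimately show ?thesis using em[of 0] em'[of 0] by simp
    qed
  next
    show "sets (distr lborel borel cmod) = sigma_sets UNIV (range (\<lambda>r::real. {..<r}))"
      by (simp add: borel_Iio)
    show "sets (density lborel (\<lambda>r. ennreal (2 * pi * r) * indicator {0..} r)) = sigma_sets UNIV (range (\<lambda>r::real. {..<r}))"
      by (simp add: borel_Iio)
    show "(\<Union>i. {..<real i}) = UNIV" by (auto simp: reals_Archimedean2)
    show "emeasure (distr lborel borel cmod) {..<real i} \<noteq> \<infinity>" for i
      by (simp add: em)
  qed auto
  then have "(\<integral>\<^sup>+x. G x \<partial>distr lborel borel cmod) = (\<integral>\<^sup>+x. G x \<partial>density lborel (\<lambda>r. ennreal (2 * pi * r) * indicator {0..} r))"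
    by simp
  then show ?thesis
    by (simp add: nn_integral_distr nn_integral_density mult_ac)
qed

text \<open>The piece of the shifted period beyond 2 pi is moved back to the start. The range of
  \<open>a\<close> covers the values of \<open>Arg2pi\<close>.\<close>

lemma nn_integral_periodic_shift:
  fixes h :: "real \<Rightarrow> ennreal"
  assumes [measurable]: "h \<in> borel_measurable borel" and per: "\<And>x. h (x + 2 * pi) = h x"
    and a: "0 \<le> a" "a \<le> 2 * pi"
  shows "(\<integral>\<^sup>+x\<in>{0..<2*pi}. h (x + a) \<partial>lborel) = (\<integral>\<^sup>+x\<in>{0..<2*pi}. h x \<partial>lborel)"
proof -
  have "(\<integral>\<^sup>+x\<in>{0..<2*pi}. h (x + a) \<partial>lborel)
      = (\<integral>\<^sup>+x. h x * indicator {a..<a + 2*pi} x \<partial>lborel)"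
    using nn_integral_real_affine[of "\<lambda>x. h x * indicator {a..<a + 2*pi} x" 1 a]
    by (simp add: add.commute indicator_def)
  also have "\<dots> = (\<integral>\<^sup>+x. h x * indicator {a..<2*pi} x + h x * indicator {2*pi..<a + 2*pi} x \<partial>lborel)"
    using a by (intro nn_integral_cong) (auto split: split_indicator)
  also have "\<dots> = (\<integral>\<^sup>+x. h x * indicator {a..<2*pi} x \<partial>lborel)
      + (\<integral>\<^sup>+x. h x * indicator {2*pi..<a + 2*pi} x \<partial>lborel)"
    by (rule nn_integral_add) auto
  also have "(\<integral>\<^sup>+x. h x * indicator {2*pi..<a + 2*pi} x \<partial>lborel) = (\<integral>\<^sup>+x. h x * indicator {0..<a} x \<partial>lborel)"
    using nn_integral_real_affine[of "\<lambda>x. h x * indicator {2*pi..<a + 2*pi} x" 1 "2*pi"]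
    by (simp add: add.commute indicator_def per)
  also have "(\<integral>\<^sup>+x. h x * indicator {a..<2*pi} x \<partial>lborel) + (\<integral>\<^sup>+x. h x * indicator {0..<a} x \<partial>lborel)
     = (\<integral>\<^sup>+x. h x * indicator {a..<2*pi} x + h x * indicator {0..<a} x \<partial>lborel)"
    by (rule nn_integral_add[symmetric]) auto
  also have "\<dots> = (\<integral>\<^sup>+x\<in>{0..<2*pi}. h x \<partial>lborel)"
    using a by (intro nn_integral_cong) (auto split: split_indicator)
  finally show ?thesis .
qed

text \<open>No Jacobian is computed. By rotation invariance the integral of \<open>H\<close> is the
  average over t of the integrals of \<open>H (z * cis t)\<close>; after Fubini the inner average
  depends on \<open>cmod z\<close> only, and the formula for radial functions applies.\<close>

theorem nn_integral_lborel_polar: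
  assumes [measurable]: "H \<in> borel_measurable borel"
  shows "(\<integral>\<^sup>+z. H z \<partial>lborel)
    = (\<integral>\<^sup>+r\<in>{0..}. (\<integral>\<^sup>+t\<in>{0..<2*pi}. H (of_real r * cis t) \<partial>lborel) * ennreal r \<partial>lborel)"
proof -
  have [measurable]: "(\<lambda>q. H (fst q * cis (snd q))) \<in> borel_measurable (borel \<Otimes>\<^sub>M borel)"
    unfolding borel_prod
    by (rule measurable_compose[of _ borel borel]) (auto intro!: borel_measurable_continuous_onI continuous_intros)
  have [measurable]: "(\<lambda>q. H (of_real (fst q) * cis (snd q))) \<in> borel_measurable (borel \<Otimes>\<^sub>M borel)"
    unfolding borel_prod
    by (rule measurable_compose[of _ borel borel]) (auto intro!: borel_measurable_continuous_onI continuous_intros)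
  have [measurable]: "(\<lambda>t. H (w * cis t)) \<in> borel_measurable borel" for w
    by (rule measurable_compose[of _ borel borel]) (auto intro!: borel_measurable_continuous_onI continuous_intros)
  have [measurable]: "(\<lambda>z. H (z * cis t)) \<in> borel_measurable borel" for t
    by (rule measurable_compose[of _ borel borel]) (auto intro!: borel_measurable_continuous_onI continuous_intros)
  have "(\<lambda>q. H (fst q * cis (snd q)) * indicator {0..<2*pi} (snd q)) \<in> borel_measurable (borel \<Otimes>\<^sub>M borel)"
    by measurable
  then have meas: "(\<lambda>q. H (fst q * cis (snd q)) * indicator {0..<2*pi} (snd q)) \<in> borel_measurable (lborel \<Otimes>\<^sub>M lborel)"
    by (simp add: lborel_prod borel_prod)
  define \<Phi> where "\<Phi> = (\<lambda>r. \<integral>\<^sup>+t\<in>{0..<2*pi}. H (of_real r * cis t) \<partial>lborel)"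
  have [measurable]: "\<Phi> \<in> borel_measurable borel"
    unfolding \<Phi>_def by measurable
  have mean: "(\<integral>\<^sup>+t\<in>{0..<2*pi}. H (z * cis t) \<partial>lborel) = \<Phi> (cmod z)" for z
  proof -
    define a where "a = Arg2pi z"
    have z: "z = of_real (cmod z) * cis a"
      using Arg2pi_eq[of z] by (simp add: a_def cis_conv_exp)
    have "(\<integral>\<^sup>+t\<in>{0..<2*pi}. H (z * cis t) \<partial>lborel)
        = (\<integral>\<^sup>+t\<in>{0..<2*pi}. H (of_real (cmod z) * cis (t + a)) \<partial>lborel)"
      by (subst z) (simp add: mult.assoc cis_mult add.commute)
    also have "\<dots> = \<Phi> (cmod z)"
      unfolding \<Phi>_def
      using Arg2pi_ge_0[of z] Arg2pi_lt_2pi[of z]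
      by (intro nn_integral_periodic_shift[where h = "\<lambda>t. H (of_real (cmod z) * cis t)"])
         (auto simp: a_def simp flip: cis_mult)
    finally show ?thesis .
  qed
  have "(\<integral>\<^sup>+z. H z \<partial>lborel) * ennreal (2*pi) = (\<integral>\<^sup>+t\<in>{0..<2*pi}. (\<integral>\<^sup>+z. H z \<partial>lborel) \<partial>(lborel :: real measure))"
    by (simp add: nn_integral_cmult_indicator)
  also have "\<dots> = (\<integral>\<^sup>+t. \<integral>\<^sup>+z. H (z * cis t) * indicator {0..<2*pi} t \<partial>lborel \<partial>lborel)"
    by (simp add: nn_integral_multc nn_integral_lborel_rotate)
  also have "\<dots> = (\<integral>\<^sup>+z. \<integral>\<^sup>+t. H (z * cis t) * indicator {0..<2*pi} t \<partial>lborel \<partial>lborel)"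
    by (rule lborel_pair.Fubini') (use meas in \<open>simp add: case_prod_unfold\<close>)
  also have "\<dots> = (\<integral>\<^sup>+z. \<Phi> (cmod z) \<partial>lborel)"
    by (simp add: mean)
  also have "\<dots> = (\<integral>\<^sup>+r. (\<Phi> r * ennreal r * indicator {0..} r) * ennreal (2 * pi) \<partial>lborel)"
    by (subst nn_integral_lborel_norm_complex)
       (auto intro!: nn_integral_cong simp: ennreal_mult' mult_ac split: split_indicator)
  also have "\<dots> = (\<integral>\<^sup>+r\<in>{0..}. \<Phi> r * ennreal r \<partial>lborel) * ennreal (2*pi)"
    by (rule nn_integral_multc) measurable
  finally have "(\<integral>\<^sup>+z. H z \<partial>lborel) * ennreal (2*pi) / ennreal (2*pi)
      = (\<integral>\<^sup>+r\<in>{0..}. \<Phi> r * ennreal r \<partial>lborel) * ennreal (2*pi) / ennreal (2*pi)"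
    by simp
  then show ?thesis
    by (simp add: ennreal_mult_divide_eq \<Phi>_def)
qed

section \<open>Monotonicity of circle means\<close>

text \<open>Because q - 1 is not positive, \<open>x powr (q - 1)\<close> is at least
  \<open>(a + b) powr (q - 1)\<close> for 0 < x <= a + b. Multiplying by x and adding the cases x =
  a and x = b gives the claim.\<close>

lemma powr_add_le_add_powr:
  fixes a b q :: real
  assumes "0 \<le> a" "0 \<le> b" "0 < q" "q \<le> 1"
  shows "(a + b) powr q \<le> a powr q + b powr q"
proof (cases "a + b = 0")
  case True
  with assms show ?thesis by simp
next
  case False
  then have s: "a + b > 0" using assms by simp
  have part: "x * (a + b) powr (q - 1) \<le> x powr q" if "0 \<le> x" "x \<le> a + b" for x
  proof (cases "x = 0")
    case False
    then have "x powr (q - 1) \<ge> (a + b) powr (q - 1)"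
      using that assms by (intro powr_mono2') auto
    then have "x * (a + b) powr (q - 1) \<le> x * x powr (q - 1)"
      using that by (intro mult_left_mono) auto
    also have "\<dots> = x powr q"
      using that False by (simp add: powr_diff)
    finally show ?thesis .
  qed simp
  have "(a + b) powr q = a * (a + b) powr (q - 1) + b * (a + b) powr (q - 1)"
    using s by (simp only: distrib_right[symmetric]) (simp add: powr_diff)
  also have "\<dots> \<le> a powr q + b powr q"
    using assms by (intro add_mono part) auto
  finally show ?thesis .
qed

text \<open>By convexity a negative slope at one point would make \<phi> grow without bound towards
  the left, against \<open>B\<close>. In logarithmic coordinates the left end is the centre of the
  disc.\<close>

lemma convex_bounded_above_imp_mono:
  fixes \<phi> \<phi>' \<phi>'' :: "real \<Rightarrow> real"
  assumes d1: "\<And>s. s < c \<Longrightarrow> (\<phi> has_real_derivative \<phi>' s) (at s)"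
    and d2: "\<And>s. s < c \<Longrightarrow> (\<phi>' has_real_derivative \<phi>'' s) (at s)"
    and nn: "\<And>s. s < c \<Longrightarrow> 0 \<le> \<phi>'' s"
    and bd: "\<And>s. s \<le> a \<Longrightarrow> \<phi> s \<le> B" and st: "s \<le> t" "t < c"
  shows "\<phi> s \<le> \<phi> t"
proof -
  have mono': "\<phi>' x \<le> \<phi>' y" if "x \<le> y" "y < c" for x y
    using that(1)
  proof (rule DERIV_nonneg_imp_nondecreasing)
    fix z assume "x \<le> z" "z \<le> y"
    then show "\<exists>l. (\<phi>' has_real_derivative l) (at z) \<and> 0 \<le> l"
      using d2[of z] nn[of z] that by force
  qed
  have pos: "0 \<le> \<phi>' x" if x: "x < c" for x
  proof (rule ccontr)
    assume neg: "\<not> 0 \<le> \<phi>' x"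
    \<comment> \<open>Left of x, left of \<open>a\<close> so that \<open>B\<close> applies, and so
      far away that the slope at x alone lifts \<phi> to \<open>B + 1\<close>.\<close>
    define y where "y = min (x - 1) (min a (x - (B - \<phi> x + 1) / (- \<phi>' x)))"
    have "y < x" by (simp add: y_def min_def)
    then obtain z where z: "y < z" "z < x" "\<phi> x - \<phi> y = (x - y) * \<phi>' z"
      using MVT2[of y x \<phi> \<phi>'] d1 x by force
    have "(x - y) * \<phi>' z \<le> (x - y) * \<phi>' x"
      using z x \<open>y < x\<close> by (intro mult_left_mono mono') auto
    moreover have "(x - y) * (- \<phi>' x) \<ge> (B - \<phi> x + 1) / (- \<phi>' x) * (- \<phi>' x)"
      using neg by (intro mult_right_mono) (auto simp: y_def min_def)
    then have "(x - y) * (- \<phi>' x) \<ge> B - \<phi> x + 1"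
      using neg by simp
    moreover have "\<phi> y \<le> B" by (rule bd) (simp add: y_def)
    ultimately show False using z(3) by simp
  qed
  show ?thesis
    using st(1)
  proof (rule DERIV_nonneg_imp_nondecreasing)
    fix z assume "s \<le> z" "z \<le> t"
    then show "\<exists>l. (\<phi> has_real_derivative l) (at z) \<and> 0 \<le> l"
      using d1[of z] pos[of z] st by force
  qed
qed

text \<open>In logarithmic coordinates \<open>z = exp (s + \<i>t)\<close> the function \<open>(\<bar>F\<bar>\<^sup>2 + \<epsilon>)\<^sup>q\<close> is smooth
  with non-negative Laplacian, and the \<open>t\<close>-part of the Laplacian integrates to zero by
  periodicity; so its circle mean is a convex function of \<open>s\<close>.\<close>
lemma circle_mean_regularised_mono:
  fixes F :: "complex \<Rightarrow> complex"
  assumes hol: "F holomorphic_on ball 0 R" and q: "0 < q" and e: "0 < e"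
    and st: "s \<le> t" "exp t < R"
  shows "integral {0..2*pi} (\<lambda>x. ((cmod (F (exp (Complex s x))))\<^sup>2 + e) powr q)
       \<le> integral {0..2*pi} (\<lambda>x. ((cmod (F (exp (Complex t x))))\<^sup>2 + e) powr q)"
proof -
  have R: "0 < R" using st exp_gt_zero less_trans by blast
  define c where "c = ln R"
  define S where "S = {z::complex. Re z < c}"
  have oS: "open S" unfolding S_def by (rule open_halfspace_Re_lt)
  have expS: "exp z \<in> ball 0 R" if "z \<in> S" for z
    using that R by (simp add: S_def c_def ln_less_cancel_iff[symmetric] del: ln_less_cancel_iff)
  define G where "G = F \<circ> exp"
  have holG: "G holomorphic_on S"
    unfolding G_def
    by (rule holomorphic_on_compose_gen[OF holomorphic_on_exp hol]) (use expS in auto)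
  define G1 where "G1 = deriv G"
  define G2 where "G2 = deriv G1"
  have holG1: "G1 holomorphic_on S" and holG2: "G2 holomorphic_on S"
    unfolding G2_def G1_def by (auto intro!: holomorphic_deriv holG oS)
  have dG: "(G has_field_derivative G1 z) (at z)" "(G1 has_field_derivative G2 z) (at z)" if "z \<in> S" for z
    unfolding G1_def G2_def using that holG holG1 oS
    by (auto intro!: holomorphic_derivI simp: G1_def)
  have ex: "Complex x y = of_real x + \<i> * of_real y" for x y
    by (simp add: complex_eq_iff)
  have dx: "((\<lambda>x. K (Complex x y)) has_vector_derivative D) (at x)"
    if "(K has_field_derivative D) (at (Complex x y))" for K D x y
  proof -
    have "((\<lambda>x. Complex x y) has_vector_derivative 1) (at x)"
      unfolding ex by (auto intro!: derivative_eq_intros)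
    from field_vector_diff_chain_at[OF this that] show ?thesis by (simp add: o_def)
  qed
  have dy: "((\<lambda>y. K (Complex x y)) has_vector_derivative \<i> * D) (at y)"
    if "(K has_field_derivative D) (at (Complex x y))" for K D x y
  proof -
    have "((\<lambda>y. Complex x y) has_vector_derivative \<i>) (at y)"
      unfolding ex by (auto intro!: derivative_eq_intros)
    from field_vector_diff_chain_at[OF this that] show ?thesis by (simp add: o_def)
  qed
  \<comment> \<open>\<open>N\<close> is |G|^2 + e, with partial derivatives 2A and 2B in x and y;
    \<open>A'\<close> and \<open>B'\<close> are the derivatives of \<open>A\<close> in x and of
    \<open>B\<close> in y. The second derivative of G enters these with opposite signs, because
    differentiating in y multiplies by \<i>.\<close>
  define N where "N = (\<lambda>z. (Re (G z))\<^sup>2 + (Im (G z))\<^sup>2 + e)"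
  define A where "A = (\<lambda>z. Re (G z) * Re (G1 z) + Im (G z) * Im (G1 z))"
  define B where "B = (\<lambda>z. Im (G z) * Re (G1 z) - Re (G z) * Im (G1 z))"
  define A' where "A' = (\<lambda>z. (cmod (G1 z))\<^sup>2 + (Re (G z) * Re (G2 z) + Im (G z) * Im (G2 z)))"
  define B' where "B' = (\<lambda>z. (cmod (G1 z))\<^sup>2 - (Re (G z) * Re (G2 z) + Im (G z) * Im (G2 z)))"
  have Npos: "N z > 0" for z
    unfolding N_def using e by (simp add: add_nonneg_pos)
  define u where "u = (\<lambda>x y. N (Complex x y) powr q)"
  define ux where "ux = (\<lambda>x y. 2 * q * (N (Complex x y) powr (q - 1) * A (Complex x y)))"
  define uy where "uy = (\<lambda>x y. 2 * q * (N (Complex x y) powr (q - 1) * B (Complex x y)))"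
  define uxx where "uxx = (\<lambda>x y. 2 * q * (2 * (q - 1) * N (Complex x y) powr (q - 2) * (A (Complex x y))\<^sup>2
      + N (Complex x y) powr (q - 1) * A' (Complex x y)))"
  define uyy where "uyy = (\<lambda>x y. 2 * q * (2 * (q - 1) * N (Complex x y) powr (q - 2) * (B (Complex x y))\<^sup>2
      + N (Complex x y) powr (q - 1) * B' (Complex x y)))"
  have RI: "((\<lambda>x. Re (K x)) has_real_derivative Re K') (at w)" "((\<lambda>x. Im (K x)) has_real_derivative Im K') (at w)"
    if "(K has_vector_derivative K') (at w)" for K K' and w :: real
    using bounded_linear.has_vector_derivative[OF bounded_linear_Re that]
      bounded_linear.has_vector_derivative[OF bounded_linear_Im that]
    by (auto simp: has_real_derivative_iff_has_vector_derivative)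
  have Sxy: "Complex x y \<in> S" if "x < c" for x y using that by (simp add: S_def)
  have dNx: "((\<lambda>x. N (Complex x y)) has_real_derivative 2 * A (Complex x y)) (at x)"
    and dA: "((\<lambda>x. A (Complex x y)) has_real_derivative A' (Complex x y)) (at x)" if "x < c" for x y
  proof -
    note d = RI[OF dx[OF dG(1)[OF Sxy[OF that, of y]]]] RI[OF dx[OF dG(2)[OF Sxy[OF that, of y]]]]
    show "((\<lambda>x. N (Complex x y)) has_real_derivative 2 * A (Complex x y)) (at x)"
      unfolding N_def by (rule d derivative_eq_intros refl)+ (simp add: A_def algebra_simps)
    show "((\<lambda>x. A (Complex x y)) has_real_derivative A' (Complex x y)) (at x)"
      unfolding A_def by (rule d derivative_eq_intros refl)+
        (simp only: A'_def cmod_power2, simp add: power2_eq_square algebra_simps)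
  qed
  have dux: "((\<lambda>x. u x y) has_real_derivative ux x y) (at x)"
    and duxx: "((\<lambda>x. ux x y) has_real_derivative uxx x y) (at x)" if "x < c" for x y
  proof -
    note P = DERIV_fun_powr[OF dNx[OF that] Npos]
    show "((\<lambda>x. u x y) has_real_derivative ux x y) (at x)"
      using P[of y q] by (simp add: u_def ux_def mult_ac)
    show "((\<lambda>x. ux x y) has_real_derivative uxx x y) (at x)"
      unfolding ux_def
      by (rule P dA that derivative_eq_intros refl)+ (simp add: uxx_def power2_eq_square algebra_simps)
  qed
  have dNy: "((\<lambda>y. N (Complex x y)) has_real_derivative 2 * B (Complex x y)) (at y)"
    and dB: "((\<lambda>y. B (Complex x y)) has_real_derivative B' (Complex x y)) (at y)" if "x < c" for x y
  proof -
    note d = RI[OF dy[OF dG(1)[OF Sxy[OF that, of y]]]] RI[OF dy[OF dG(2)[OF Sxy[OF that, of y]]]]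
    show "((\<lambda>y. N (Complex x y)) has_real_derivative 2 * B (Complex x y)) (at y)"
      unfolding N_def by (rule d derivative_eq_intros refl)+ (simp add: B_def algebra_simps)
    show "((\<lambda>y. B (Complex x y)) has_real_derivative B' (Complex x y)) (at y)"
      unfolding B_def by (rule d derivative_eq_intros refl)+
        (simp only: B'_def cmod_power2, simp add: power2_eq_square algebra_simps)
  qed
  have duyy: "((\<lambda>y. uy x y) has_real_derivative uyy x y) (at y)" if "x < c" for x y
  proof -
    note P = DERIV_fun_powr[OF dNy[OF that] Npos]
    show "((\<lambda>y. uy x y) has_real_derivative uyy x y) (at y)"
      unfolding uy_def
      by (rule P dB that derivative_eq_intros refl)+ (simp add: uyy_def power2_eq_square algebra_simps)
  qed
  \<comment> \<open>In the sum the terms with \<open>G2\<close> cancel and A^2 + B^2 becomes |G|^2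
    |G'|^2, so the Laplacian is 4q N^(q-2) |G'|^2 (q |G|^2 + e). The positive \<open>e\<close> keeps
    the negative powers of \<open>N\<close> harmless at the zeros of G.\<close>
  have lap: "0 \<le> uxx x y + uyy x y" for x y
  proof -
    define z where "z = Complex x y"
    have AB: "(A z)\<^sup>2 + (B z)\<^sup>2 = (cmod (G z))\<^sup>2 * (cmod (G1 z))\<^sup>2"
      unfolding A_def B_def cmod_power2 by (simp add: power2_eq_square algebra_simps)
    have N1: "N z powr (q - 1) = N z powr (q - 2) * N z"
      using Npos[of z] by (simp add: powr_diff power2_eq_square divide_simps powr_numeral)
    have Nz: "N z = (cmod (G z))\<^sup>2 + e" by (simp add: N_def cmod_power2)
    have "uxx x y + uyy x y = 2 * q * N z powr (q - 2) *
        (2 * (q - 1) * ((A z)\<^sup>2 + (B z)\<^sup>2) + N z * (A' z + B' z))"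
      unfolding uxx_def uyy_def z_def[symmetric] N1 by (simp add: algebra_simps)
    also have "\<dots> = 2 * q * N z powr (q - 2) * (2 * (cmod (G1 z))\<^sup>2 * (q * (cmod (G z))\<^sup>2 + e))"
      unfolding AB by (simp add: A'_def B'_def Nz algebra_simps)
    also have "\<dots> \<ge> 0" using q e by simp
    finally show ?thesis .
  qed
  have contG: "continuous_on S G" "continuous_on S G1" "continuous_on S G2"
    using holG holG1 holG2 by (auto intro: holomorphic_on_imp_continuous_on)
  have contc: "continuous_on ({..<c} \<times> {0..2*pi}) (\<lambda>w. Complex (fst w) (snd w))"
    by (auto intro!: continuous_intros)
  have contK: "continuous_on ({..<c} \<times> {0..2*pi}) (\<lambda>w. K (Complex (fst w) (snd w)))"
    if "continuous_on S K" for K :: "complex \<Rightarrow> complex"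
    using Sxy by (intro continuous_on_compose2[OF that contc]) auto
  note cc = contK[OF contG(1)] contK[OF contG(2)] contK[OF contG(3)]
  have Nne: "N z \<noteq> 0" for z using Npos[of z] by simp
  have contN: "continuous_on ({..<c} \<times> {0..2*pi}) (\<lambda>w. N (Complex (fst w) (snd w)))"
    unfolding N_def by (intro continuous_intros cc)
  have contu: "continuous_on ({..<c} \<times> {0..2*pi}) (\<lambda>(x, y). u x y)"
    "continuous_on ({..<c} \<times> {0..2*pi}) (\<lambda>(x, y). ux x y)"
    "continuous_on ({..<c} \<times> {0..2*pi}) (\<lambda>(x, y). uxx x y)"
    "continuous_on ({..<c} \<times> {0..2*pi}) (\<lambda>(x, y). uyy x y)"
    unfolding u_def ux_def uxx_def uyy_def A_def B_def A'_def B'_def case_prod_unfold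
    by (intro continuous_intros cc contN; use Nne in simp)+
  have slice: "(\<lambda>y. h x y) integrable_on {0..2*pi}"
    if "continuous_on ({..<c} \<times> {0..2*pi}) (\<lambda>(x, y). h x y)" "x < c" for h :: "real \<Rightarrow> real \<Rightarrow> real" and x
  proof (rule integrable_continuous_real)
    have "continuous_on {0..2*pi} (\<lambda>y. (\<lambda>(x, y). h x y) (x, y))"
      by (rule continuous_on_compose2[OF that(1)]) (use that(2) in \<open>auto intro!: continuous_intros\<close>)
    then show "continuous_on {0..2*pi} (\<lambda>y. h x y)" by simp
  qed
  have leib: "((\<lambda>x. integral {0..2*pi} (h x)) has_real_derivative integral {0..2*pi} (h' x)) (at x)"
    if "\<And>x y. x < c \<Longrightarrow> ((\<lambda>x. h x y) has_real_derivative h' x y) (at x)"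
      "continuous_on ({..<c} \<times> {0..2*pi}) (\<lambda>(x, y). h x y)"
      "continuous_on ({..<c} \<times> {0..2*pi}) (\<lambda>(x, y). h' x y)" "x < c" for h h' :: "real \<Rightarrow> real \<Rightarrow> real" and x
  proof -
    have "((\<lambda>x. integral (cbox 0 (2*pi)) (h x)) has_real_derivative integral (cbox 0 (2*pi)) (h' x)) (at x within {..<c})"
      using that slice[OF that(2)]
      by (intro leibniz_rule_field_derivative) (auto intro: DERIV_subset)
    then show ?thesis using that(4) by (simp add: at_within_open[of x "{..<c}"])
  qed
  define \<phi> where "\<phi> = (\<lambda>x. integral {0..2*pi} (u x))"
  \<comment> \<open>The integral is the increment of \<open>uy\<close> over one period. It vanishes
    because \<open>G\<close> has period 2 pi \<i> and its derivative inherits the period, by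
    shifting the argument and uniqueness of derivatives.\<close>
  have uyy0: "integral {0..2*pi} (uyy x) = 0" if "x < c" for x
  proof -
    have "(uyy x has_integral (uy x (2*pi) - uy x 0)) {0..2*pi}"
      using duyy[OF that] by (intro fundamental_theorem_of_calculus)
        (auto simp: has_real_derivative_iff_has_vector_derivative[symmetric] intro: DERIV_subset)
    moreover have "uy x (2*pi) = uy x 0"
    proof -
      have per: "G (z + \<i> * of_real (2*pi)) = G z" for z
        using cis_2pi by (simp add: G_def exp_add cis_conv_exp)
      have "exp (Complex x (2*pi)) = exp (Complex x 0)" by (simp add: exp_eq_polar)
      then have g: "G (Complex x (2*pi)) = G (Complex x 0)" by (simp add: G_def)
      have "((\<lambda>z. G (z + \<i> * of_real (2*pi))) has_field_derivative G1 (Complex x 0 + \<i> * of_real (2*pi))) (at (Complex x 0))"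
        using dG(1)[of "Complex x 0 + \<i> * of_real (2*pi)"] that
        by (intro DERIV_shift[THEN iffD1]) (simp add: S_def)
      then have "(G has_field_derivative G1 (Complex x 0 + \<i> * of_real (2*pi))) (at (Complex x 0))"
        by (simp only: per)
      moreover have "Complex x 0 + \<i> * of_real (2*pi) = Complex x (2*pi)"
        by (simp add: complex_eq_iff)
      ultimately have "G1 (Complex x (2*pi)) = G1 (Complex x 0)"
        using DERIV_unique[OF dG(1)[OF Sxy[OF that, of 0]]] by simp
      with g show ?thesis by (simp add: uy_def N_def B_def)
    qed
    ultimately show ?thesis by (simp add: integral_unique)
  qed
  have tc: "t < c" using st R by (simp add: c_def ln_less_cancel_iff[symmetric] del: ln_less_cancel_iff)
  \<comment> \<open>Analyticity at the centre enters here: for real parts up to t the point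
    \<open>exp z\<close> stays in this compact disc, so the means are bounded as the radius tends to
    0.\<close>
  have "cball 0 (exp t) \<subseteq> ball 0 R" using st by auto
  then have "continuous_on (cball 0 (exp t)) F"
    using hol holomorphic_on_imp_continuous_on continuous_on_subset by blast
  then have "bounded (F ` cball 0 (exp t))"
    by (intro compact_imp_bounded compact_continuous_image) auto
  then obtain b where b: "\<And>z. z \<in> cball 0 (exp t) \<Longrightarrow> cmod (F z) \<le> b"
      unfolding bounded_iff by blast
  have "\<phi> s \<le> \<phi> t"
  proof (rule convex_bounded_above_imp_mono[where \<phi> = \<phi> and s = s and t = t and c = c and
        \<phi>' = "\<lambda>x. integral {0..2*pi} (ux x)"
        and \<phi>'' = "\<lambda>x. integral {0..2*pi} (uxx x)" and a = t and B = "2 * pi * (b\<^sup>2 + e) powr q"])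
    fix x assume x: "x < c"
    show "(\<phi> has_real_derivative integral {0..2*pi} (ux x)) (at x)"
      unfolding \<phi>_def by (rule leib[OF dux contu(1,2) x])
    show "((\<lambda>x. integral {0..2*pi} (ux x)) has_real_derivative integral {0..2*pi} (uxx x)) (at x)"
      by (rule leib[OF duxx contu(2,3) x])
    have "integral {0..2*pi} (uxx x) = integral {0..2*pi} (uxx x) + integral {0..2*pi} (uyy x)"
      by (simp add: uyy0 x)
    also have "\<dots> = integral {0..2*pi} (\<lambda>y. uxx x y + uyy x y)"
      by (rule integral_add[symmetric]) (use slice contu x in blast)+
    also have "\<dots> \<ge> 0" by (rule integral_nonneg) (use slice contu x lap in \<open>auto intro!: integrable_add\<close>)
    finally show "0 \<le> integral {0..2*pi} (uxx x)" .
  next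
    show "t < c" by (rule tc)
    fix x assume x: "x \<le> t"
    have "u x y \<le> (b\<^sup>2 + e) powr q" for y
    proof -
      have "cmod (G (Complex x y)) \<le> b"
        unfolding G_def o_def by (rule b) (use x in simp)
      then have "N (Complex x y) \<le> b\<^sup>2 + e"
        unfolding N_def cmod_power2[symmetric] by (simp add: power_mono)
      then show ?thesis unfolding u_def using Npos[of "Complex x y"] q by (intro powr_mono2) auto
    qed
    then have "\<phi> x \<le> integral {0..2*pi} (\<lambda>y. (b\<^sup>2 + e) powr q)"
      unfolding \<phi>_def using x tc by (intro integral_le slice contu) auto
    then show "\<phi> x \<le> 2 * pi * (b\<^sup>2 + e) powr q" by simp
  qed (fact st)
  then show ?thesis
    by (simp add: \<phi>_def u_def[abs_def] N_def G_def flip: cmod_power2)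
qed

lemma continuous_on_circle_mean:
  assumes "F holomorphic_on ball 0 R" "0 < p"
  shows "continuous_on {0..<R} (\<lambda>r. integral {0..2*pi} (\<lambda>x. cmod (F (of_real r * cis x)) powr p))"
proof -
  have "continuous_on ({0..<R} \<times> {0..2*pi}) (\<lambda>w. F (of_real (fst w) * cis (snd w)))"
    by (rule continuous_on_compose2[OF holomorphic_on_imp_continuous_on[OF assms(1)]])
       (auto intro!: continuous_intros simp: norm_mult)
  then have "continuous_on ({0..<R} \<times> cbox 0 (2*pi)) (\<lambda>(r, x). cmod (F (of_real r * cis x)) powr p)"
    using assms(2) unfolding case_prod_unfold by (intro continuous_on_powr' continuous_intros) auto
  from integral_continuous_on_param[OF this] show ?thesis by simp
qed

lemma continuous_on_circle_powr:
  assumes "F holomorphic_on ball 0 R" "0 < p" "0 \<le> r" "r < R"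
  shows "continuous_on A (\<lambda>x. cmod (F (of_real r * cis x)) powr p)"
proof -
  have "continuous_on A (\<lambda>x. F (of_real r * cis x))"
    using assms by (intro continuous_on_compose2[OF holomorphic_on_imp_continuous_on[OF assms(1)]])
       (auto intro!: continuous_intros simp: norm_mult)
  then show ?thesis
    using assms by (intro continuous_on_powr' continuous_intros) auto
qed

lemma integrable_on_circle_powr:
  assumes "F holomorphic_on ball 0 R" "0 < p" "0 \<le> r" "r < R"
  shows "(\<lambda>x. cmod (F (of_real r * cis x)) powr p) integrable_on {a..b}"
  by (rule integrable_continuous_real[OF continuous_on_circle_powr[OF assms]])

text \<open>The regularisation is removed with exponent q = p/2. Since p <= 2, subadditivity of
  \<open>powr\<close> bounds (|F|^2 + e)^(p/2) by |F|^p + e^(p/2), and the second term is made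
  arbitrarily small.\<close>

theorem circle_mean_powr_mono:
  fixes F :: "complex \<Rightarrow> complex"
  assumes hol: "F holomorphic_on ball 0 R" and p: "0 < p" "p \<le> 2" and r: "0 \<le> r" "r \<le> \<rho>" "\<rho> < R"
  shows "integral {0..2*pi} (\<lambda>x. cmod (F (of_real r * cis x)) powr p)
       \<le> integral {0..2*pi} (\<lambda>x. cmod (F (of_real \<rho> * cis x)) powr p)"
proof -
  define M where "M = (\<lambda>r. integral {0..2*pi} (\<lambda>x. cmod (F (of_real r * cis x)) powr p))"
  have pos: "M r \<le> M \<rho>" if r: "0 < r" "r \<le> \<rho>" "\<rho> < R" for r \<rho>
  proof (rule field_le_epsilon)
    fix d :: real assume d: "0 < d"
    \<comment> \<open>Chosen so that e^(p/2) integrates over the circle to exactly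
      \<open>d\<close>.\<close>
    define e where "e = (d / (2*pi)) powr (2 / p)"
    have e: "0 < e" "e powr (p/2) = d / (2*pi)"
      using d p by (auto simp: e_def powr_powr)
    have p2: "(x\<^sup>2) powr (p/2) = x powr p" if "0 \<le> x" for x :: real
      using that by (simp add: powr_powr flip: powr_numeral)
    have cE: "exp (Complex (ln a) x) = of_real a * cis x" if "0 < a" for a x
      using that by (simp add: exp_eq_polar exp_of_real[symmetric])
    define Me where "Me = (\<lambda>r. integral {0..2*pi} (\<lambda>x. ((cmod (F (of_real r * cis x)))\<^sup>2 + e) powr (p/2)))"
    have int: "(\<lambda>x. ((cmod (F (of_real a * cis x)))\<^sup>2 + e) powr (p/2)) integrable_on {0..2*pi}"
      if "0 \<le> a" "a < R" for a
    proof (rule integrable_continuous_real)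
      have "continuous_on {0..2*pi} (\<lambda>x. F (of_real a * cis x))"
        using that by (intro continuous_on_compose2[OF holomorphic_on_imp_continuous_on[OF hol]])
           (auto intro!: continuous_intros simp: norm_mult)
      moreover have "(cmod z)\<^sup>2 + e \<noteq> 0" for z
        using e by (metis add_nonneg_pos less_irrefl zero_le_power2)
      ultimately show "continuous_on {0..2*pi} (\<lambda>x. ((cmod (F (of_real a * cis x)))\<^sup>2 + e) powr (p/2))"
        by (intro continuous_intros) auto
    qed
    have "M r \<le> Me r"
      unfolding M_def Me_def
    proof (rule integral_le)
      fix x
      show "cmod (F (of_real r * cis x)) powr p \<le> ((cmod (F (of_real r * cis x)))\<^sup>2 + e) powr (p/2)"
        using e p by (subst p2[symmetric]) (auto intro!: powr_mono2)
    qed (use that int p in \<open>auto intro!: integrable_on_circle_powr[OF hol]\<close>)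
    also have "Me r \<le> Me \<rho>"
      using circle_mean_regularised_mono[OF hol, of "p/2" e "ln r" "ln \<rho>"] that p e
      by (simp add: Me_def cE)
    also have "Me \<rho> \<le> integral {0..2*pi} (\<lambda>x. cmod (F (of_real \<rho> * cis x)) powr p + d / (2*pi))"
      unfolding Me_def
    proof (rule integral_le)
      fix x
      show "((cmod (F (of_real \<rho> * cis x)))\<^sup>2 + e) powr (p/2) \<le> cmod (F (of_real \<rho> * cis x)) powr p + d / (2*pi)"
        using powr_add_le_add_powr[of "(cmod (F (of_real \<rho> * cis x)))\<^sup>2" e "p/2"] e p
        by (simp add: p2)
    qed (use that int p in \<open>auto intro!: integrable_on_circle_powr[OF hol] integrable_add\<close>)
    also have "\<dots> = M \<rho> + d"
      unfolding M_def using that p by (subst integral_add) (auto intro!: integrable_on_circle_powr[OF hol])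
    finally show "M r \<le> M \<rho> + d" .
  qed
  show ?thesis
  proof (cases "r = 0")
    case False
    then show ?thesis using pos[of r \<rho>] r by (simp add: M_def)
  next
    case True
    show ?thesis
    proof (cases "\<rho> = 0")
      case False
      then have rho: "0 < \<rho>" using r by simp
      \<comment> \<open>Logarithmic coordinates do not reach radius 0, so this case is a limit from
        the right.\<close>
      have "continuous_on {0..<R} M" unfolding M_def by (rule continuous_on_circle_mean[OF hol p(1)])
      then have "(M \<longlongrightarrow> M 0) (at 0 within {0..<R})"
        using r by (auto simp: continuous_on_def)
      then have "(M \<longlongrightarrow> M 0) (at 0 within {0..\<rho>})"
        by (rule tendsto_within_subset) (use r in auto)
      then have lim: "(M \<longlongrightarrow> M 0) (at_right 0)"
        using rho by (simp add: at_within_Icc_at_right)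
      have "eventually (\<lambda>r. M r \<le> M \<rho>) (at_right 0)"
        using eventually_at_right_less[of 0] eventually_at_right_real[OF rho]
        by eventually_elim (use pos r in auto)
      then have "M 0 \<le> M \<rho>"
        by (intro tendsto_upperbound[OF lim]) auto
      then show ?thesis by (simp add: M_def True)
    qed (use True in simp)
  qed
qed

section \<open>Radial weights and the supremum conditions\<close>

definition ratio_bounded :: "real \<Rightarrow> (real \<Rightarrow> real) \<Rightarrow> bool" where
  "ratio_bounded p \<omega> \<longleftrightarrow> (\<exists>M. \<forall>r\<in>{0..<1}. (1 - r) powr (2 - 1/p) / omega_hat \<omega> r powr (1/p) \<le> M)"

lemma omega_hat_set_integrable:
  assumes "radial_weight \<omega>" "0 \<le> r"
  shows "set_integrable lborel {r..<1} \<omega>"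
  using assms by (auto simp: radial_weight_def intro: set_integrable_subset)

lemma omega_hat_pos:
  assumes "radial_weight \<omega>" "0 \<le> r" "r < 1"
  shows "0 < omega_hat \<omega> r"
  using assms by (auto simp: radial_weight_def)

lemma omega_hat_nn_integral:
  assumes "radial_weight \<omega>" "0 \<le> r"
  shows "ennreal (omega_hat \<omega> r) = (\<integral>\<^sup>+s\<in>{r..<1}. ennreal (\<omega> s) \<partial>lborel)"
proof -
  have "(\<integral>\<^sup>+s. ennreal (indicator {r..<1} s * \<omega> s) \<partial>lborel) = ennreal (LINT s|lborel. indicator {r..<1} s * \<omega> s)"
    using omega_hat_set_integrable[OF assms] assms unfolding set_integrable_def
    by (intro nn_integral_eq_integral) (auto simp: radial_weight_def split: split_indicator)
  then show ?thesis
    by (simp add: omega_hat_def set_lebesgue_integral_def ennreal_mult'' ennreal_indicator mult.commute)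
qed

lemma omega_hat_antimono:
  assumes "radial_weight \<omega>" "0 \<le> r" "r \<le> s" "s < 1"
  shows "omega_hat \<omega> s \<le> omega_hat \<omega> r"
proof -
  have "ennreal (omega_hat \<omega> s) \<le> ennreal (omega_hat \<omega> r)"
    using assms by (auto simp: omega_hat_nn_integral intro!: nn_integral_mono split: split_indicator)
  then show ?thesis
    using omega_hat_pos[OF assms(1,2)] assms by (simp add: ennreal_le_iff2)
qed

lemma SUP_ennreal_eq_top_iff:
  assumes "\<And>x. x \<in> A \<Longrightarrow> 0 \<le> f x"
  shows "(SUP x\<in>A. ennreal (f x)) = \<infinity> \<longleftrightarrow> \<not> (\<exists>M. \<forall>x\<in>A. f x \<le> M)"
proof
  assume L: "(SUP x\<in>A. ennreal (f x)) = \<infinity>"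
  show "\<not> (\<exists>M. \<forall>x\<in>A. f x \<le> M)"
  proof
    assume "\<exists>M. \<forall>x\<in>A. f x \<le> M"
    then obtain M where "\<And>x. x \<in> A \<Longrightarrow> f x \<le> M" by auto
    then have "(SUP x\<in>A. ennreal (f x)) \<le> ennreal M"
      by (intro SUP_least ennreal_leI) auto
    with L show False by (metis ennreal_neq_top infinity_ennreal_def top_unique)
  qed
next
  assume R: "\<not> (\<exists>M. \<forall>x\<in>A. f x \<le> M)"
  show "(SUP x\<in>A. ennreal (f x)) = \<infinity>"
  proof (rule ccontr)
    assume "(SUP x\<in>A. ennreal (f x)) \<noteq> \<infinity>"
    then obtain M where M: "0 \<le> M" "(SUP x\<in>A. ennreal (f x)) = ennreal M"
      by (cases "SUP x\<in>A. ennreal (f x)") auto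
    have "f x \<le> M" if "x \<in> A" for x
      using SUP_upper[OF that, of "\<lambda>x. ennreal (f x)"] M by (simp add: ennreal_le_iff)
    with R show False by auto
  qed
qed

lemma SUP_ratio_eq_top_iff:
  "(SUP r\<in>{0..<1}. ennreal ((1 - r) powr (2 - 1/p) / omega_hat \<omega> r powr (1/p))) = \<infinity>
    \<longleftrightarrow> \<not> ratio_bounded p \<omega>"
  unfolding ratio_bounded_def by (intro SUP_ennreal_eq_top_iff) auto

text \<open>The absolute value is there because the exponent 2 - 1/p to which this is applied may
  have either sign.\<close>

lemma powr_le_powr_abs:
  fixes x y c a :: real
  assumes "0 < x" "0 < y" "y \<le> c * x" "x \<le> c * y" "1 \<le> c"
  shows "x powr a \<le> c powr \<bar>a\<bar> * y powr a"
proof (cases "0 \<le> a")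
  case True
  have "x powr a \<le> (c * y) powr a" using assms True by (intro powr_mono2) auto
  then show ?thesis using True assms by (simp add: powr_mult)
next
  case False
  have "x powr a \<le> (y / c) powr a"
    using assms False by (intro powr_mono2') (auto simp: field_simps)
  also have "\<dots> = c powr \<bar>a\<bar> * y powr a"
    using False assms by (simp add: powr_divide powr_minus_divide)
  finally show ?thesis .
qed

text \<open>With \<open>a k\<close> for the ratio at the radius 1 - 1/(k+1), the series is the power
  series with coefficients \<open>a k\<close> at r^2; sums start at 0, whence \<open>Suc k\<close>.
  A bound on \<open>a\<close> gives a geometric series and (1-r)/(1-r^2) <= 1. Conversely, the terms
  from n to 2n already control \<open>a n\<close>, and the radii 1 - 1/(k+1) are close enough to
  each other to control all radii.\<close>

lemma SUP_series_eq_top_iff: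
  assumes rw: "radial_weight \<omega>" and p: "0 < p"
  shows "(SUP r\<in>{0..<1}. ennreal (1 - r) *
           (\<Sum>k. ennreal (r ^ (2 * k) /
              (omega_hat \<omega> (1 - 1 / real (Suc k)) powr (1/p) * real (Suc k) powr (2 - 1/p))))) = \<infinity>
    \<longleftrightarrow> \<not> ratio_bounded p \<omega>"
    (is "(SUP r\<in>_. ?S r) = \<infinity> \<longleftrightarrow> _")
proof -
  define c where "c = 2 - 1/p"
  define a where "a = (\<lambda>k. (1 / real (Suc k)) powr c / omega_hat \<omega> (1 - 1 / real (Suc k)) powr (1/p))"
  have in01: "0 \<le> 1 - 1 / real (Suc k)" "1 - 1 / real (Suc k) < 1" for k
    by (auto simp: field_simps)
  have a0: "0 \<le> a k" for k by (simp add: a_def)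
  have summand: "r ^ (2 * k) / (omega_hat \<omega> (1 - 1 / real (Suc k)) powr (1/p) * real (Suc k) powr (2 - 1/p))
      = (r\<^sup>2) ^ k * a k" for r k
    by (simp add: a_def c_def powr_divide power_mult del: of_nat_Suc)
  have S: "?S r = ennreal (1 - r) * (\<Sum>k. ennreal ((r\<^sup>2) ^ k * a k))" for r
    by (simp only: summand)
  have up: "(SUP r\<in>{0..<1}. ?S r) \<noteq> \<infinity>" if rb: "ratio_bounded p \<omega>"
  proof -
    obtain M where M: "\<And>r. 0 \<le> r \<Longrightarrow> r < 1 \<Longrightarrow> (1 - r) powr c / omega_hat \<omega> r powr (1/p) \<le> M"
      using rb unfolding ratio_bounded_def c_def by (metis atLeastLessThan_iff)
    have aM: "a k \<le> M" for k
      using M[OF in01[of k]] by (simp add: a_def)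
    have M0: "0 \<le> M" using a0[of 0] aM[of 0] by simp
    have "?S r \<le> ennreal M" if r: "r \<in> {0..<1}" for r
    proof -
      have r2: "0 \<le> r\<^sup>2" "r\<^sup>2 < 1" using r by (auto simp: power_less_one_iff abs_square_less_1)
      have "(\<Sum>k. ennreal ((r\<^sup>2) ^ k * a k)) \<le> (\<Sum>k. ennreal ((r\<^sup>2) ^ k * M))"
        using aM by (intro suminf_le ennreal_leI mult_left_mono) auto
      also have "\<dots> = ennreal (\<Sum>k. (r\<^sup>2) ^ k * M)"
        using r2 M0 by (intro suminf_ennreal2 summable_mult2 summable_geometric) auto
      also have "(\<Sum>k. (r\<^sup>2) ^ k * M) = M / (1 - r\<^sup>2)"
        using r2 by (subst suminf_mult2[symmetric]) (auto simp: suminf_geometric summable_geometric)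
      finally have "?S r \<le> ennreal (1 - r) * ennreal (M / (1 - r\<^sup>2))"
        unfolding S by (intro mult_left_mono) auto
      also have "\<dots> = ennreal ((1 - r) * (M / (1 - r\<^sup>2)))"
        using r by (intro ennreal_mult'[symmetric]) auto
      also have "\<dots> \<le> ennreal M"
      proof (rule ennreal_leI)
        have "1 - r\<^sup>2 = (1 - r) * (1 + r)" by (simp add: power2_eq_square algebra_simps)
        then have "(1 - r) * (M / (1 - r\<^sup>2)) = M / (1 + r)" using r by simp
        also have "\<dots> \<le> M" using r M0 by (simp add: field_simps)
        finally show "(1 - r) * (M / (1 - r\<^sup>2)) \<le> M" .
      qed
      finally show ?thesis .
    qed
    then have "(SUP r\<in>{0..<1}. ?S r) \<le> ennreal M" by (rule SUP_least)
    then show ?thesis by (metis ennreal_neq_top infinity_ennreal_def top_unique)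
  qed
  have down: "ratio_bounded p \<omega>" if fin: "(SUP r\<in>{0..<1}. ?S r) \<noteq> \<infinity>"
  proof -
    define X where "X = (SUP r\<in>{0..<1}. ?S r)"
    have "X \<noteq> \<infinity>" using fin unfolding X_def .
    then obtain B where B': "0 \<le> B" "X = ennreal B" by (cases X) auto
    note B = B'[unfolded X_def]
    have SB: "?S r \<le> ennreal B" if "0 \<le> r" "r < 1" for r
      using SUP_upper[of r "{0..<1}" ?S] that unfolding B(2) by (metis atLeastLessThan_iff)
    define L where "L = 2 powr \<bar>c\<bar>"
    have L: "1 \<le> L" by (simp add: L_def ge_one_powr_ge_zero)
    text \<open>Averaging over the indices \<open>n, \<dots>, 2n\<close> at the radius \<open>1 - 1/(2n+2)\<close>, where the weights
      \<open>r\<^bsup>2k\<^esup>\<close> are at least \<open>1/16\<close> because \<open>r\<^bsup>n+1\<^esup> \<ge> 1/2\<close>.\<close>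
    have an: "a n \<le> 32 * L * B" for n
    proof -
      define r where "r = 1 - 1 / (2 * real (Suc n))"
      have r: "0 \<le> r" "r < 1" by (auto simp: r_def field_simps)
      have "- 1 \<le> - (1 / (2 * real (Suc n)))" by (simp add: field_simps)
      from Bernoulli_inequality[OF this, of "Suc n"] have half: "1 / 2 \<le> r ^ Suc n"
        by (simp add: r_def del: power_Suc of_nat_Suc)
      have r4: "1 / 16 \<le> (r\<^sup>2) ^ k" if "k \<le> 2 * n" for k
      proof -
        have "(1 / 2) ^ 4 \<le> (r ^ Suc n) ^ 4" by (rule power_mono) (use half in auto)
        also have "\<dots> = r ^ (4 * Suc n)" by (simp only: power_mult[symmetric] mult.commute)
        also have "\<dots> \<le> r ^ (2 * k)" using that r by (intro power_decreasing) auto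
        finally show ?thesis by (simp add: power_mult power_one_over)
      qed
      \<comment> \<open>The numerators differ by a factor of at most \<open>L\<close>, as
        (k+1)/(n+1) <= 2, and the tail integral in the denominator decreases from n to k.\<close>
      have ank: "a n \<le> L * a k" if k: "n \<le> k" "k \<le> 2 * n" for k
      proof -
        have "(1 / real (Suc n)) powr c \<le> 2 powr \<bar>c\<bar> * (1 / real (Suc k)) powr c"
          using k by (intro powr_le_powr_abs) (auto simp: field_simps simp del: of_nat_Suc, auto)
        moreover have "omega_hat \<omega> (1 - 1 / real (Suc k)) powr (1/p) \<le> omega_hat \<omega> (1 - 1 / real (Suc n)) powr (1/p)"
          using k p omega_hat_pos[OF rw in01[of k]] in01[of n] in01[of k]
          by (intro powr_mono2 omega_hat_antimono[OF rw]) (auto simp: frac_le)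
        moreover have "0 < omega_hat \<omega> (1 - 1 / real (Suc k)) powr (1/p)"
          using omega_hat_pos[OF rw in01[of k]] by simp
        ultimately have "a n \<le> (L * (1 / real (Suc k)) powr c) / omega_hat \<omega> (1 - 1 / real (Suc k)) powr (1/p)"
          unfolding a_def L_def by (intro frac_le) auto
        then show ?thesis by (simp add: a_def)
      qed
      have "ennreal (\<Sum>k\<in>{n..2*n}. (r\<^sup>2) ^ k * a k) = (\<Sum>k\<in>{n..2*n}. ennreal ((r\<^sup>2) ^ k * a k))"
        using a0 by (intro sum_ennreal[symmetric]) auto
      also have "\<dots> \<le> (\<Sum>k. ennreal ((r\<^sup>2) ^ k * a k))"
        by (rule sum_le_suminf) auto
      finally have "ennreal (1 - r) * ennreal (\<Sum>k\<in>{n..2*n}. (r\<^sup>2) ^ k * a k) \<le> ennreal B"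
        using SB[OF r] unfolding S by (meson mult_left_mono order_trans zero_le)
      then have 1: "(1 - r) * (\<Sum>k\<in>{n..2*n}. (r\<^sup>2) ^ k * a k) \<le> B"
        using r B by (simp add: ennreal_mult'[symmetric] ennreal_le_iff)
      have "(\<Sum>k\<in>{n..2*n}. a n / (16 * L)) \<le> (\<Sum>k\<in>{n..2*n}. (r\<^sup>2) ^ k * a k)"
      proof (rule sum_mono)
        fix k assume k: "k \<in> {n..2*n}"
        have "a n / (16 * L) \<le> 1 / 16 * a k" using ank[of k] k L by (simp add: field_simps)
        also have "\<dots> \<le> (r\<^sup>2) ^ k * a k" using r4[of k] k a0 by (intro mult_right_mono) auto
        finally show "a n / (16 * L) \<le> (r\<^sup>2) ^ k * a k" .
      qed
      then have "real (Suc n) * (a n / (16 * L)) \<le> (\<Sum>k\<in>{n..2*n}. (r\<^sup>2) ^ k * a k)" by simp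
      then have "(1 - r) * (real (Suc n) * (a n / (16 * L))) \<le> B"
        using 1 r by (smt (verit) mult_left_mono)
      \<comment> \<open>The n + 1 terms times 1 - r make 1/2, which together with the weight bound
        1/16 gives 32.\<close>
      moreover have "(1 - r) * (real (Suc n) * (a n / (16 * L))) = a n / (32 * L)"
        by (simp add: r_def field_simps del: of_nat_Suc)
      ultimately have "a n / (32 * L) \<le> B" by (simp only:)
      then show ?thesis using L by (simp add: divide_le_eq mult_ac)
    qed
    have "(1 - r) powr c / omega_hat \<omega> r powr (1/p) \<le> L * (32 * L * B)" if r: "0 \<le> r" "r < 1" for r
    proof -
      \<comment> \<open>This puts 1 - r between 1/(n+1) and 1/n, within a factor 2 of 1/(n+1), and r
        below the grid radius 1 - 1/(n+1), where the tail is smaller.\<close>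
      define k where "k = \<lfloor>1 / (1 - r)\<rfloor>"
      have k: "of_int k \<le> 1 / (1 - r)" "1 / (1 - r) < of_int k + 1"
        by (simp_all add: k_def)
      have "1 / (1 - r) \<ge> 1" using r by simp
      with k have "1 \<le> k" by linarith
      define n where "n = nat k"
      have "real n = of_int k" using \<open>1 \<le> k\<close> by (simp add: n_def)
      with k \<open>1 \<le> k\<close> have n: "1 \<le> real n" "real n \<le> 1 / (1 - r)" "1 / (1 - r) < real (Suc n)"
        by simp_all
      have rle: "r \<le> 1 - 1 / real (Suc n)" "1 - r \<le> 1 / real n"
        using n r by (auto simp: field_simps)
      have "(1 - r) powr c \<le> L * (1 / real (Suc n)) powr c"
        unfolding L_def
      proof (rule powr_le_powr_abs)
        show "1 - r \<le> 2 * (1 / real (Suc n))"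
          by (rule order_trans[OF rle(2)]) (use n in \<open>simp add: field_simps\<close>)
        show "1 / real (Suc n) \<le> 2 * (1 - r)" using rle(1) r by simp
      qed (use r in auto)
      moreover have "omega_hat \<omega> (1 - 1 / real (Suc n)) powr (1/p) \<le> omega_hat \<omega> r powr (1/p)"
        using p omega_hat_pos[OF rw in01[of n]] r in01[of n] rle
        by (intro powr_mono2 omega_hat_antimono[OF rw]) auto
      moreover have "0 < omega_hat \<omega> (1 - 1 / real (Suc n)) powr (1/p)"
        using omega_hat_pos[OF rw in01[of n]] by simp
      ultimately have "(1 - r) powr c / omega_hat \<omega> r powr (1/p) \<le> (L * (1 / real (Suc n)) powr c) / omega_hat \<omega> (1 - 1 / real (Suc n)) powr (1/p)"
        using L by (intro frac_le) auto
      also have "\<dots> = L * a n" by (simp add: a_def)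
      also have "\<dots> \<le> L * (32 * L * B)" using an L by (intro mult_left_mono) auto
      finally show ?thesis .
    qed
    then show ?thesis unfolding ratio_bounded_def c_def by (intro exI ballI) auto
  qed
  show ?thesis using up down by blast
qed

section \<open>Kernel estimates\<close>

lemma nn_integral_continuous_eq_integral:
  fixes f :: "real \<Rightarrow> real"
  assumes cont: "continuous_on {a..b} f" and nn: "\<And>x. x \<in> {a..b} \<Longrightarrow> 0 \<le> f x"
  shows "(\<integral>\<^sup>+x\<in>{a..<b}. ennreal (f x) \<partial>lborel) = ennreal (integral {a..b} f)"
proof -
  have si: "set_integrable lborel {a..b} f"
    by (rule borel_integrable_atLeastAtMost'[OF cont])
  have "(\<integral>\<^sup>+x\<in>{a..<b}. ennreal (f x) \<partial>lborel) = (\<integral>\<^sup>+x. ennreal (indicator {a..b} x * f x) \<partial>lborel)"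
    using AE_lborel_singleton[of b]
    by (intro nn_integral_cong_AE, eventually_elim) (auto split: split_indicator)
  also have "\<dots> = ennreal (LINT x|lborel. indicator {a..b} x * f x)"
    using si nn unfolding set_integrable_def
    by (intro nn_integral_eq_integral) (auto split: split_indicator)
  also have "(LINT x|lborel. indicator {a..b} x * f x) = integral {a..b} f"
    using set_borel_integral_eq_integral(2)[OF si] by (simp add: set_lebesgue_integral_def)
  finally show ?thesis .
qed

text \<open>Cauchy's formula for the n-th derivative, written out on the parametrised circle and
  multiplied by r^n / \<i>.\<close>

lemma circle_integral_coefficient:
  assumes hol: "h holomorphic_on ball 0 R" and r: "0 < r" "r < R"
  shows "((\<lambda>x. cis (- (real n * x)) * h (of_real r * cis x)) has_integral
      2 * of_real pi * of_real r ^ n * ((deriv ^^ n) h 0 / fact n)) {0..2*pi}"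
proof -
  have "cball 0 r \<subseteq> ball 0 R" using r by auto
  then have "continuous_on (cball 0 r) h"
    by (rule continuous_on_subset[OF holomorphic_on_imp_continuous_on[OF hol]])
  moreover have "h holomorphic_on ball 0 r"
    by (rule holomorphic_on_subset[OF hol]) (use r in auto)
  ultimately have "((\<lambda>u. h u / (u - 0) ^ Suc n) has_contour_integral (2 * pi * \<i> / fact n) * (deriv ^^ n) h 0) (circlepath 0 r)"
    using r by (intro Cauchy_has_contour_integral_higher_derivative_circlepath) auto
  then have "((\<lambda>x. h (0 + of_real r * cis x) / (0 + of_real r * cis x - 0) ^ Suc n * of_real r * \<i> * cis x) has_integral
      (2 * pi * \<i> / fact n) * (deriv ^^ n) h 0) {0..2*pi}"
    unfolding circlepath_def by (subst (asm) has_contour_integral_part_circlepath_iff) auto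
  from has_integral_mult_right[OF this, of "of_real r ^ n / \<i>"]
  have "((\<lambda>x. of_real r ^ n / \<i> * (h (0 + of_real r * cis x) / (0 + of_real r * cis x - 0) ^ Suc n * of_real r * \<i> * cis x)) has_integral
      of_real r ^ n / \<i> * ((2 * pi * \<i> / fact n) * (deriv ^^ n) h 0)) {0..2*pi}" .
  moreover have "of_real r ^ n / \<i> * (h (0 + of_real r * cis x) / (0 + of_real r * cis x - 0) ^ Suc n * of_real r * \<i> * cis x)
      = cis (- (real n * x)) * h (of_real r * cis x)" for x
  proof -
    have "cis (- (real n * x)) = 1 / cis x ^ n"
      by (simp add: Complex.DeMoivre cis_inverse[symmetric] inverse_eq_divide)
    then show ?thesis using r by (simp add: power_mult_distrib field_simps)
  qed
  moreover have "of_real r ^ n / \<i> * ((2 * pi * \<i> / fact n) * (deriv ^^ n) h 0)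
      = 2 * of_real pi * of_real r ^ n * ((deriv ^^ n) h 0 / fact n)"
    by (simp add: field_simps)
  ultimately show ?thesis by simp
qed

lemma circle_mean_value:
  assumes hol: "h holomorphic_on ball 0 R" and r: "0 \<le> r" "r < R"
  shows "((\<lambda>x. h (of_real r * cis x)) has_integral 2 * of_real pi * h 0) {0..2*pi}"
proof (cases "r = 0")
  case True
  then show ?thesis using has_integral_const_real[of "h 0" 0 "2*pi"] by (simp add: scaleR_conv_of_real)
next
  case False
  then show ?thesis using circle_integral_coefficient[OF hol, of r 0] r by simp
qed

lemma one_minus_cnj_mult_nonzero:
  assumes "cmod a < 1" "cmod z < 1"
  shows "1 - cnj a * z \<noteq> 0" "1 - cmod a * cmod z \<le> cmod (1 - cnj a * z)" "0 < 1 - cmod a * cmod z"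
proof -
  have *: "cmod a * cmod z < 1"
    using mult_strict_mono'[of "cmod a" 1 "cmod z" 1] assms by simp
  then show "0 < 1 - cmod a * cmod z" by simp
  show "1 - cmod a * cmod z \<le> cmod (1 - cnj a * z)"
    using norm_triangle_ineq2[of 1 "cnj a * z"] by (simp add: norm_mult)
  with * show "1 - cnj a * z \<noteq> 0" by auto
qed

text \<open>For w = \<open>cnj a * z\<close> the quotient (1 - |w|^2)/|1 - w|^2 is the real part of
  (1 + w)/(1 - w), a function analytic in z with value 1 at 0. The mean value property evaluates its
  integral, and |w| is constant on the circle.\<close>

lemma poisson_kernel_nn_integral:
  assumes a: "cmod a < 1" and r: "0 \<le> r" "r < 1"
  shows "(\<integral>\<^sup>+x\<in>{0..<2*pi}. ennreal (1 / (cmod (1 - cnj a * (of_real r * cis x)))\<^sup>2) \<partial>lborel)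
    = ennreal (2 * pi / (1 - (cmod a * r)\<^sup>2))"
proof -
  define h where "h = (\<lambda>z. (1 + cnj a * z) / (1 - cnj a * z))"
  have nz: "1 - cnj a * z \<noteq> 0" if "cmod z < 1" for z
    using one_minus_cnj_mult_nonzero[OF a that] by simp
  have cz: "cmod (of_real r * cis x) = r" for x using r by (simp add: norm_mult)
  have "h holomorphic_on ball 0 1"
    unfolding h_def using nz by (intro holomorphic_intros) auto
  from circle_mean_value[OF this r]
  have "((\<lambda>x. Re (h (of_real r * cis x))) has_integral Re (2 * of_real pi * h 0)) {0..2*pi}"
    by (rule has_integral_Re)
  then have I: "((\<lambda>x. Re (h (of_real r * cis x))) has_integral 2 * pi) {0..2*pi}"
    by (simp add: h_def)
  have ar: "(cmod a * r)\<^sup>2 < 1"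
  proof -
    have "cmod a * r < 1" using one_minus_cnj_mult_nonzero(3)[of a "of_real r"] a r by simp
    then show ?thesis using r by (simp add: power_less_one_iff abs_square_less_1)
  qed
  have Re_h: "Re (h z) = (1 - (cmod a * cmod z)\<^sup>2) / (cmod (1 - cnj a * z))\<^sup>2" if "cmod z < 1" for z
  proof -
    define w where "w = cnj a * z"
    have w: "cmod w = cmod a * cmod z" by (simp add: w_def norm_mult)
    have "Re ((1 + w) / (1 - w)) = ((1 + Re w) * (1 - Re w) - Im w * Im w) / (cmod (1 - w))\<^sup>2"
      by (simp add: Re_divide cmod_power2)
    also have "(1 + Re w) * (1 - Re w) - Im w * Im w = 1 - (cmod w)\<^sup>2"
      unfolding cmod_power2 by (simp add: power2_eq_square algebra_simps)
    finally show ?thesis by (simp add: h_def w_def[symmetric] w)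
  qed
  have eq: "1 / (cmod (1 - cnj a * (of_real r * cis x)))\<^sup>2 = Re (h (of_real r * cis x)) / (1 - (cmod a * r)\<^sup>2)" for x
    using Re_h[of "of_real r * cis x"] cz r ar by simp
  have cont: "continuous_on {0..2*pi} (\<lambda>x. 1 / (cmod (1 - cnj a * (of_real r * cis x)))\<^sup>2)"
    using nz cz r by (intro continuous_intros) auto
  have "((\<lambda>x. 1 / (cmod (1 - cnj a * (of_real r * cis x)))\<^sup>2) has_integral 2 * pi / (1 - (cmod a * r)\<^sup>2)) {0..2*pi}"
    unfolding eq using has_integral_divide[OF I] by simp
  then show ?thesis
    using nn_integral_continuous_eq_integral[OF cont] by (simp add: integral_unique)
qed

text \<open>The exponent is split as (1 - \<kappa>) + (-2). The first factor is largest where |1 -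
  \<open>cnj a * z\<close>| attains its lower bound 1 - |a| r, and the second is integrated exactly
  as a Poisson kernel.\<close>

lemma cauchy_kernel_circle_bound:
  assumes a: "cmod a < 1" and r: "0 \<le> r" "r < 1" and k: "1 \<le> \<kappa>"
  shows "(\<integral>\<^sup>+x\<in>{0..<2*pi}. ennreal (cmod (1 - cnj a * (of_real r * cis x)) powr (- \<kappa> - 1)) \<partial>lborel)
    \<le> ennreal (2 * pi * (1 - cmod a * r) powr (- \<kappa>))"
proof -
  define s where "s = 1 - cmod a * r"
  have s: "0 < s" "s \<le> 1" using one_minus_cnj_mult_nonzero(3)[of a "of_real r"] a r by (auto simp: s_def)
  have "cmod (1 - cnj a * (of_real r * cis x)) powr (- \<kappa> - 1)
      \<le> s powr (1 - \<kappa>) * (1 / (cmod (1 - cnj a * (of_real r * cis x)))\<^sup>2)" for x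
  proof -
    define m where "m = cmod (1 - cnj a * (of_real r * cis x))"
    have m: "s \<le> m" unfolding m_def s_def
      using one_minus_cnj_mult_nonzero(2)[OF a, of "of_real r * cis x"] r by (simp add: norm_mult)
    then have m0: "0 < m" using s by simp
    have "- \<kappa> - 1 = (1 - \<kappa>) + (- 2)" by simp
    then have "m powr (- \<kappa> - 1) = m powr (1 - \<kappa>) * m powr (- 2)"
      by (simp only: powr_add)
    also have "m powr (- 2) = 1 / m\<^sup>2"
      using m0 by (simp add: powr_minus_divide powr_numeral)
    also have "m powr (1 - \<kappa>) * (1 / m\<^sup>2) \<le> s powr (1 - \<kappa>) * (1 / m\<^sup>2)"
      using m s k by (intro mult_right_mono powr_mono2') auto
    finally show ?thesis by (simp add: m_def)
  qed
  then have "(\<integral>\<^sup>+x\<in>{0..<2*pi}. ennreal (cmod (1 - cnj a * (of_real r * cis x)) powr (- \<kappa> - 1)) \<partial>lborel)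
    \<le> (\<integral>\<^sup>+x\<in>{0..<2*pi}. ennreal (s powr (1 - \<kappa>) * (1 / (cmod (1 - cnj a * (of_real r * cis x)))\<^sup>2)) \<partial>lborel)"
    by (intro nn_integral_mono mult_right_mono ennreal_leI) auto
  also have "\<dots> = ennreal (s powr (1 - \<kappa>)) *
      (\<integral>\<^sup>+x\<in>{0..<2*pi}. ennreal (1 / (cmod (1 - cnj a * (of_real r * cis x)))\<^sup>2) \<partial>lborel)"
  proof -
    have [measurable]: "(\<lambda>x. cmod (1 - cnj a * (of_real r * cis x))) \<in> borel_measurable borel"
      by (intro borel_measurable_continuous_onI continuous_intros)
    have "(\<integral>\<^sup>+x\<in>{0..<2*pi}. ennreal (s powr (1 - \<kappa>) * (1 / (cmod (1 - cnj a * (of_real r * cis x)))\<^sup>2)) \<partial>lborel)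
       = (\<integral>\<^sup>+x. ennreal (s powr (1 - \<kappa>)) * (ennreal (1 / (cmod (1 - cnj a * (of_real r * cis x)))\<^sup>2) * indicator {0..<2*pi} x) \<partial>lborel)"
      by (intro nn_integral_cong) (auto simp: ennreal_mult'[symmetric] split: split_indicator)
    also have "\<dots> = ennreal (s powr (1 - \<kappa>)) *
      (\<integral>\<^sup>+x\<in>{0..<2*pi}. ennreal (1 / (cmod (1 - cnj a * (of_real r * cis x)))\<^sup>2) \<partial>lborel)"
      by (rule nn_integral_cmult) measurable
    finally show ?thesis .
  qed
  also have "\<dots> = ennreal (s powr (1 - \<kappa>) * (2 * pi / (1 - (cmod a * r)\<^sup>2)))"
    unfolding poisson_kernel_nn_integral[OF a r] by (rule ennreal_mult'[symmetric]) simp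
  also have "\<dots> \<le> ennreal (2 * pi * s powr (- \<kappa>))"
  proof (rule ennreal_leI)
    have "1 - (cmod a * r)\<^sup>2 = s * (1 + cmod a * r)" by (simp add: s_def power2_eq_square algebra_simps)
    also have "\<dots> \<ge> s * 1" using s r by (intro mult_left_mono) auto
    finally have "2 * pi / (1 - (cmod a * r)\<^sup>2) \<le> 2 * pi / s" using s by (intro divide_left_mono) auto
    then have "s powr (1 - \<kappa>) * (2 * pi / (1 - (cmod a * r)\<^sup>2)) \<le> s powr (1 - \<kappa>) * (2 * pi / s)"
      by (intro mult_left_mono) auto
    also have "\<dots> = 2 * pi * s powr (- \<kappa>)"
      using s by (simp add: powr_diff powr_minus_divide)
    finally show "s powr (1 - \<kappa>) * (2 * pi / (1 - (cmod a * r)\<^sup>2)) \<le> 2 * pi * s powr (- \<kappa>)" .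
  qed
  finally show ?thesis by (simp add: s_def)
qed

text \<open>Dyadic induction: halving the scale adds at most t^(-\<kappa>) times the tail at 1 - 2t,
  and doubling bounds that tail by C times the tail at 1 - t. The constant 2C reproduces itself once
  2C <= 2^\<kappa>. With t = 1 - |a|, the maximum of t and 1 - r is a lower bound for 1 - |a|
  r.\<close>

lemma weight_kernel_bound:
  assumes rw: "radial_weight \<omega>" and C: "1 \<le> C"
    and D: "\<And>r. 0 \<le> r \<Longrightarrow> r < 1 \<Longrightarrow> omega_hat \<omega> r \<le> C * omega_hat \<omega> ((1 + r) / 2)"
    and k: "0 < \<kappa>" "2 * C \<le> 2 powr \<kappa>" and t: "0 < t" "t \<le> 1"
  shows "(\<integral>\<^sup>+r\<in>{0..<1}. ennreal (max t (1 - r) powr (- \<kappa>) * \<omega> r) \<partial>lborel)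
     \<le> ennreal (2 * C * t powr (- \<kappa>) * omega_hat \<omega> (1 - t))"
proof -
  define J where "J = (\<lambda>t. \<integral>\<^sup>+r\<in>{0..<1}. ennreal (max t (1 - r) powr (- \<kappa>) * \<omega> r) \<partial>lborel)"
  have om: "0 \<le> \<omega> s" if "0 \<le> s" "s < 1" for s using rw that by (auto simp: radial_weight_def)
  have mw: "(\<lambda>s. indicator {0..<1} s * \<omega> s) \<in> borel_measurable borel"
    using rw by (auto simp: radial_weight_def set_integrable_def)
  have tail: "(\<integral>\<^sup>+r\<in>{s..<1}. ennreal (A * \<omega> r) \<partial>lborel) = ennreal (A * omega_hat \<omega> s)"
    if "0 \<le> A" "0 \<le> s" for A s
  proof -
    have [measurable]: "(\<lambda>r. indicator {s..<1} r * \<omega> r) \<in> borel_measurable borel"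
      using omega_hat_set_integrable[OF rw that(2)] by (auto simp: set_integrable_def)
    have "(\<integral>\<^sup>+r\<in>{s..<1}. ennreal (A * \<omega> r) \<partial>lborel) = (\<integral>\<^sup>+r. ennreal A * ennreal (indicator {s..<1} r * \<omega> r) \<partial>lborel)"
      using that by (intro nn_integral_cong) (auto simp: ennreal_mult' split: split_indicator)
    also have "\<dots> = ennreal A * (\<integral>\<^sup>+r. ennreal (indicator {s..<1} r * \<omega> r) \<partial>lborel)"
      by (rule nn_integral_cmult) measurable
    also have "(\<integral>\<^sup>+r. ennreal (indicator {s..<1} r * \<omega> r) \<partial>lborel) = (\<integral>\<^sup>+r\<in>{s..<1}. ennreal (\<omega> r) \<partial>lborel)"
      by (intro nn_integral_cong) (auto split: split_indicator)
    finally show ?thesis using that by (simp add: omega_hat_nn_integral[OF rw] ennreal_mult')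
  qed
  have main: "J t \<le> ennreal (2 * C * t powr (- \<kappa>) * omega_hat \<omega> (1 - t))"
    if "(1/2) ^ n \<le> t" "t \<le> 1" for t n
    using that
  proof (induction n arbitrary: t)
    have big: "J t \<le> ennreal (2 * C * t powr (- \<kappa>) * omega_hat \<omega> (1 - t))" if t: "1/2 \<le> t" "t \<le> 1" for t
    proof -
      have "J t \<le> (\<integral>\<^sup>+r\<in>{0..<1}. ennreal (t powr (- \<kappa>) * \<omega> r) \<partial>lborel)"
        unfolding J_def
      proof (intro nn_integral_mono)
        fix r :: real
        have "max t (1 - r) powr (- \<kappa>) * \<omega> r \<le> t powr (- \<kappa>) * \<omega> r" if "0 \<le> r" "r < 1"
          using t k om[OF that] by (intro mult_right_mono powr_mono2') auto
        then show "ennreal (max t (1 - r) powr (- \<kappa>) * \<omega> r) * indicator {0..<1} r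
            \<le> ennreal (t powr (- \<kappa>) * \<omega> r) * indicator {0..<1} r"
          by (simp add: ennreal_leI split: split_indicator)
      qed
      also have "\<dots> = ennreal (t powr (- \<kappa>) * omega_hat \<omega> 0)" by (rule tail) auto
      also have "\<dots> \<le> ennreal (2 * C * t powr (- \<kappa>) * omega_hat \<omega> (1 - t))"
      proof (rule ennreal_leI)
        \<comment> \<open>For t >= 1/2 a single doubling from 0 suffices, because 1 - t <=
          1/2.\<close>
        have "omega_hat \<omega> 0 \<le> C * omega_hat \<omega> (1/2)" using D[of 0] by simp
        also have "\<dots> \<le> C * omega_hat \<omega> (1 - t)" using t C by (intro mult_left_mono omega_hat_antimono[OF rw]) auto
        finally have "omega_hat \<omega> 0 \<le> C * omega_hat \<omega> (1 - t)" .
        moreover have "0 \<le> C * omega_hat \<omega> (1 - t)"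
          using C omega_hat_pos[OF rw, of "1 - t"] t by simp
        ultimately have "omega_hat \<omega> 0 \<le> 2 * (C * omega_hat \<omega> (1 - t))" by linarith
        from mult_left_mono[OF this, of "t powr (- \<kappa>)"]
        show "t powr (- \<kappa>) * omega_hat \<omega> 0 \<le> 2 * C * t powr (- \<kappa>) * omega_hat \<omega> (1 - t)"
          by (simp add: mult_ac)
      qed
      finally show ?thesis .
    qed
    {
      case 0
      then show ?case by (intro big) auto
    next
      case (Suc n)
      show ?case
      proof (cases "1/2 \<le> t")
        case True
        then show ?thesis using Suc.prems by (intro big) auto
      next
        case False
        then have t2: "2 * t \<le> 1" "(1/2) ^ n \<le> 2 * t" "0 < t" 
          using Suc.prems by (auto intro: less_le_trans[of 0 "(1/2) ^ Suc n"])
        \<comment> \<open>For r < 1 - 2t the two maxima, with t and with 2t, both equal 1 - r; on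
          the rest the integrand is at most t^(-\<kappa>) \<omega>(r).\<close>
        have "J t \<le> (\<integral>\<^sup>+r. ennreal (max (2*t) (1 - r) powr (- \<kappa>) * \<omega> r) * indicator {0..<1} r
             + ennreal (t powr (- \<kappa>) * \<omega> r) * indicator {1 - 2*t..<1} r \<partial>lborel)"
          unfolding J_def
        proof (intro nn_integral_mono)
          fix r :: real
          show "ennreal (max t (1 - r) powr (- \<kappa>) * \<omega> r) * indicator {0..<1} r
             \<le> ennreal (max (2*t) (1 - r) powr (- \<kappa>) * \<omega> r) * indicator {0..<1} r
             + ennreal (t powr (- \<kappa>) * \<omega> r) * indicator {1 - 2*t..<1} r"
          proof (cases "0 \<le> r \<and> r < 1 - 2 * t")
            case True
            then have "max t (1 - r) = max (2*t) (1 - r)" using t2 by auto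
            then show ?thesis by simp
          next
            case False
            show ?thesis
            proof (cases "0 \<le> r \<and> r < 1")
              case True
              then have ind: "indicator {0..<1} r = (1::ennreal)" "indicator {1 - 2*t..<1} r = (1::ennreal)"
                using False by auto
              have "ennreal (max t (1 - r) powr (- \<kappa>) * \<omega> r) \<le> ennreal (t powr (- \<kappa>) * \<omega> r)"
                using t2 k om[of r] True by (intro ennreal_leI mult_right_mono powr_mono2') auto
              then show ?thesis unfolding ind mult_1_right by (rule order_trans) simp
            qed simp
          qed
        qed
        also have "\<dots> = J (2*t) + (\<integral>\<^sup>+r\<in>{1 - 2*t..<1}. ennreal (t powr (- \<kappa>) * \<omega> r) \<partial>lborel)"
        proof -
          have m1: "(\<lambda>r. ennreal (max (2*t) (1 - r) powr (- \<kappa>) * \<omega> r) * indicator {0..<1} r) \<in> borel_measurable borel"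
          proof -
            have "(\<lambda>r. ennreal (max (2*t) (1 - r) powr (- \<kappa>) * (indicator {0..<1} r * \<omega> r))) \<in> borel_measurable borel"
              using mw by measurable
            then show ?thesis by (rule measurable_cong[THEN iffD1, rotated]) (auto split: split_indicator)
          qed
          have m2: "(\<lambda>r. ennreal (t powr (- \<kappa>) * \<omega> r) * indicator {1 - 2*t..<1} r) \<in> borel_measurable borel"
          proof -
            have "(\<lambda>r. ennreal (t powr (- \<kappa>) * (indicator {1 - 2*t..<1} r * \<omega> r))) \<in> borel_measurable borel"
              using omega_hat_set_integrable[OF rw, of "1 - 2*t"] t2 by (auto simp: set_integrable_def)
            then show ?thesis by (rule measurable_cong[THEN iffD1, rotated]) (auto split: split_indicator)
          qed
          show ?thesis unfolding J_def by (rule nn_integral_add) (rule m1[folded measurable_lborel2] m2[folded measurable_lborel2])+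
        qed
        also have "(\<integral>\<^sup>+r\<in>{1 - 2*t..<1}. ennreal (t powr (- \<kappa>) * \<omega> r) \<partial>lborel)
            = ennreal (t powr (- \<kappa>) * omega_hat \<omega> (1 - 2*t))"
          using t2 by (intro tail) auto
        also have "J (2*t) \<le> ennreal (2 * C * (2*t) powr (- \<kappa>) * omega_hat \<omega> (1 - 2*t))"
          by (rule Suc.IH) (use t2 in auto)
        also have "ennreal (2 * C * (2*t) powr (- \<kappa>) * omega_hat \<omega> (1 - 2*t)) + ennreal (t powr (- \<kappa>) * omega_hat \<omega> (1 - 2*t))
            = ennreal ((2 * C * (2*t) powr (- \<kappa>) + t powr (- \<kappa>)) * omega_hat \<omega> (1 - 2*t))"
          using C omega_hat_pos[OF rw, of "1 - 2*t"] t2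
          by (subst ennreal_plus[symmetric]) (auto simp: algebra_simps)
        also have "\<dots> \<le> ennreal (2 * C * t powr (- \<kappa>) * omega_hat \<omega> (1 - t))"
        proof (rule ennreal_leI)
          \<comment> \<open>The bound inherited from 2t shrinks to t^(-\<kappa>) by the choice of
            \<kappa>. The new end segment contributes another t^(-\<kappa>), and the factor C comes
            from doubling.\<close>
          have "2 * C * (2*t) powr (- \<kappa>) = (2 * C / 2 powr \<kappa>) * t powr (- \<kappa>)"
            using t2 by (simp add: powr_mult powr_minus_divide)
          also have "\<dots> \<le> 1 * t powr (- \<kappa>)" using k by (intro mult_right_mono) auto
          finally have "2 * C * (2*t) powr (- \<kappa>) + t powr (- \<kappa>) \<le> 2 * t powr (- \<kappa>)" by simp
          moreover have "omega_hat \<omega> (1 - 2*t) \<le> C * omega_hat \<omega> (1 - t)"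
          proof -
            have eq: "(1 + (1 - 2*t)) / 2 = 1 - t" by (simp add: field_simps)
            have "0 \<le> 1 - 2*t" "1 - 2*t < 1" using t2 by auto
            from D[OF this] show ?thesis by (simp only: eq)
          qed
          ultimately have "(2 * C * (2*t) powr (- \<kappa>) + t powr (- \<kappa>)) * omega_hat \<omega> (1 - 2*t)
              \<le> (2 * t powr (- \<kappa>)) * (C * omega_hat \<omega> (1 - t))"
            using omega_hat_pos[OF rw, of "1 - 2*t"] t2 by (intro mult_mono) auto
          then show "(2 * C * (2*t) powr (- \<kappa>) + t powr (- \<kappa>)) * omega_hat \<omega> (1 - 2*t)
              \<le> 2 * C * t powr (- \<kappa>) * omega_hat \<omega> (1 - t)" by (simp add: mult_ac)
        qed
        finally show ?thesis by (simp add: add_right_mono)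
      qed
    }
  qed
  obtain n where "(1/2) ^ n < t" using real_arch_pow_inv[of t "1/2"] t by auto
  then show ?thesis using main[of n t] t by (simp add: J_def)
qed

text \<open>A weight is an arbitrary function outside [0,1), so measurability is available only for
  its product with the indicator. The integrand is truncated accordingly before polar coordinates
  apply.\<close>

lemma D_int_polar:
  assumes hol: "f holomorphic_on disc" and p: "0 < p"
    and nn: "\<And>s. 0 \<le> s \<Longrightarrow> s < 1 \<Longrightarrow> 0 \<le> \<omega> s"
    and meas: "(\<lambda>s. indicator {0..<1} s * \<omega> s) \<in> borel_measurable borel"
  shows "D_int p \<omega> f = (\<integral>\<^sup>+r\<in>{0..<1}. (\<integral>\<^sup>+x\<in>{0..<2*pi}. ennreal (cmod (deriv f (of_real r * cis x)) powr p) \<partial>lborel)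
      * ennreal (\<omega> r * r) \<partial>lborel) / ennreal pi"
proof -
  have contd: "continuous_on disc (deriv f)"
    using hol by (intro holomorphic_on_imp_continuous_on holomorphic_deriv) (auto simp: disc_def)
  define g where "g = (\<lambda>z. indicator disc z *\<^sub>R (cmod (deriv f z) powr p))"
  have [measurable]: "g \<in> borel_measurable borel"
    unfolding g_def using p
    by (intro borel_measurable_continuous_on_indicator continuous_on_powr' continuous_intros contd) (auto simp: disc_def)
  define w where "w = (\<lambda>s. indicator {0..<1} s * \<omega> s)"
  have [measurable]: "w \<in> borel_measurable borel" using meas by (simp add: w_def)
  have m1: "(\<lambda>x. ennreal (g (of_real r * cis x)) * indicator {0..<2*pi} x) \<in> borel_measurable borel" for r
  proof -
    have "(\<lambda>x. of_real r * cis x) \<in> borel_measurable borel"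
      by (intro borel_measurable_continuous_onI continuous_intros)
    then show ?thesis by measurable
  qed
  have "(\<integral>\<^sup>+ z \<in> disc. ennreal (cmod (deriv f z) powr p * \<omega> (cmod z)) \<partial>lborel)
      = (\<integral>\<^sup>+ z. ennreal (g z * w (cmod z)) \<partial>lborel)"
    by (intro nn_integral_cong) (auto simp: g_def w_def disc_def split: split_indicator)
  also have "\<dots> = (\<integral>\<^sup>+r\<in>{0..}. (\<integral>\<^sup>+x\<in>{0..<2*pi}. ennreal (g (of_real r * cis x) * w (cmod (of_real r * cis x))) \<partial>lborel) * ennreal r \<partial>lborel)"
    by (rule nn_integral_lborel_polar) measurable
  also have "\<dots> = (\<integral>\<^sup>+r\<in>{0..<1}. (\<integral>\<^sup>+x\<in>{0..<2*pi}. ennreal (cmod (deriv f (of_real r * cis x)) powr p) \<partial>lborel)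
      * ennreal (\<omega> r * r) \<partial>lborel)"
  proof (intro nn_integral_cong)
    fix r :: real
    show "(\<integral>\<^sup>+x\<in>{0..<2*pi}. ennreal (g (of_real r * cis x) * w (cmod (of_real r * cis x))) \<partial>lborel) * ennreal r * indicator {0..} r
       = (\<integral>\<^sup>+x\<in>{0..<2*pi}. ennreal (cmod (deriv f (of_real r * cis x)) powr p) \<partial>lborel) * ennreal (\<omega> r * r) * indicator {0..<1} r"
    proof (cases "0 \<le> r \<and> r < 1")
      case False
      then show ?thesis by (auto simp: w_def norm_mult split: split_indicator)
    next
      case True
      then have g: "g (of_real r * cis x) = cmod (deriv f (of_real r * cis x)) powr p" for x
        by (simp add: g_def disc_def norm_mult)
      have w: "w (cmod (of_real r * cis x)) = \<omega> r" for x using True by (simp add: w_def norm_mult)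
      have "(\<integral>\<^sup>+x\<in>{0..<2*pi}. ennreal (g (of_real r * cis x) * w (cmod (of_real r * cis x))) \<partial>lborel)
          = (\<integral>\<^sup>+x. ennreal (g (of_real r * cis x)) * indicator {0..<2*pi} x * ennreal (\<omega> r) \<partial>lborel)"
        unfolding w using nn[of r] True by (intro nn_integral_cong) (auto simp: ennreal_mult'' split: split_indicator)
      also have "\<dots> = (\<integral>\<^sup>+x\<in>{0..<2*pi}. ennreal (g (of_real r * cis x)) \<partial>lborel) * ennreal (\<omega> r)"
        using m1 by (intro nn_integral_multc) simp
      finally show ?thesis using True nn[of r] by (simp add: g ennreal_mult' mult.assoc)
    qed
  qed
  finally show ?thesis by (simp add: D_int_def area_int_def)
qed

section \<open>Test functions\<close>

lemma deriv_kernel_power: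
  assumes "1 - b * z \<noteq> (0::complex)"
  shows "((\<lambda>z. 1 / (1 - b * z) ^ M) has_field_derivative of_nat M * b / (1 - b * z) ^ Suc M) (at z)"
proof (cases M)
  case (Suc m)
  have "((\<lambda>z. inverse (1 - b * z)) has_field_derivative b * inverse (1 - b * z) ^ 2) (at z)"
    using assms by (auto intro!: derivative_eq_intros simp: power2_eq_square)
  from DERIV_power[OF this, of "Suc m"]
  have "((\<lambda>z. inverse (1 - b * z) ^ Suc m) has_field_derivative
      of_nat (Suc m) * (b * inverse (1 - b * z) ^ 2 * inverse (1 - b * z) ^ m)) (at z)"
    by simp
  moreover have "of_nat (Suc m) * (b * inverse (1 - b * z) ^ 2 * inverse (1 - b * z) ^ m)
      = of_nat (Suc m) * b / (1 - b * z) ^ Suc (Suc m)"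
    by (simp add: power_inverse[symmetric] power2_eq_square divide_inverse)
  ultimately show ?thesis by (simp only: Suc inverse_eq_divide power_one_over)
qed simp

text \<open>|f'|^p is at most M^p |1 - \<open>cnj a * z\<close>|^(-\<kappa>-1) with \<kappa> =
  (M+1)p - 1; the circle bound and then the weight bound finish. \<open>M\<close> and
  \<open>K\<close> depend on p and \<omega> but not on \<open>a\<close>.\<close>

lemma test_function_norm_bound:
  assumes p: "0 < p" and rw: "radial_weight \<omega>" and Dh: "D_hat \<omega>"
  shows "\<exists>M K. 0 < K \<and> (\<forall>a. cmod a < 1 \<longrightarrow> (\<lambda>z. 1 / (1 - cnj a * z) ^ M) \<in> D_space p \<omega> \<and>
     D_norm p \<omega> (\<lambda>z. 1 / (1 - cnj a * z) ^ M)
       \<le> (K * (1 - cmod a) powr (1 - real (Suc M) * p) * omega_hat \<omega> (cmod a)) powr (1/p))"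
proof -
  obtain C where C: "1 \<le> C" and D: "\<And>r. 0 \<le> r \<Longrightarrow> r < 1 \<Longrightarrow> omega_hat \<omega> r \<le> C * omega_hat \<omega> ((1 + r) / 2)"
    using Dh unfolding D_hat_def by (metis atLeastLessThan_iff)
  have om: "0 \<le> \<omega> s" if "0 \<le> s" "s < 1" for s using rw that by (auto simp: radial_weight_def)
  have mw: "(\<lambda>s. indicator {0..<1} s * \<omega> s) \<in> borel_measurable borel"
    using rw by (auto simp: radial_weight_def set_integrable_def)
  \<comment> \<open>This makes \<kappa> >= 1 + log 2 C, which yields both \<kappa> >= 1 for the
    circle bound and 2C <= 2^\<kappa> for the weight bound.\<close>
  obtain M where M: "(2 + log 2 C) / p \<le> real M" using real_arch_simple by blast
  define \<kappa> where "\<kappa> = real (Suc M) * p - 1"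
  have "2 + log 2 C \<le> real M * p" using M p by (simp add: field_simps)
  then have k1: "1 + log 2 C \<le> \<kappa>" using p by (simp add: \<kappa>_def algebra_simps)
  have l0: "0 \<le> log 2 C" using C by simp
  have k: "1 \<le> \<kappa>" using k1 l0 by linarith
  have kC: "2 * C \<le> 2 powr \<kappa>"
  proof -
    have "2 powr (1 + log 2 C) = 2 * C" using C by (simp add: powr_add)
    moreover have "2 powr (1 + log 2 C) \<le> 2 powr \<kappa>" by (rule powr_mono[OF k1]) simp
    ultimately show ?thesis by simp
  qed
  \<comment> \<open>The first summand is 2 pi M^p times 2C divided by pi, for the derivative; the
    second absorbs |f(0)|^p = 1.\<close>
  define K where "K = 4 * real M powr p * C + 2 * C / omega_hat \<omega> 0"
  have w0: "0 < omega_hat \<omega> 0" by (rule omega_hat_pos[OF rw]) auto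
  have K: "0 < K" using C w0 by (auto simp: K_def intro!: add_nonneg_pos)
  have main: "(\<lambda>z. 1 / (1 - cnj a * z) ^ M) \<in> D_space p \<omega> \<and>
     D_norm p \<omega> (\<lambda>z. 1 / (1 - cnj a * z) ^ M)
       \<le> (K * (1 - cmod a) powr (1 - real (Suc M) * p) * omega_hat \<omega> (cmod a)) powr (1/p)"
    if a: "cmod a < 1" for a
  proof -
    define t where "t = 1 - cmod a"
    have t: "0 < t" "t \<le> 1" using a by (auto simp: t_def)
    define f where "f = (\<lambda>z. 1 / (1 - cnj a * z) ^ M)"
    have nz: "1 - cnj a * z \<noteq> 0" if "cmod z < 1" for z
      using one_minus_cnj_mult_nonzero[OF a that] by simp
    have hol: "f holomorphic_on disc"
      unfolding f_def disc_def using nz by (intro holomorphic_intros) auto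
    define Q where "Q = t powr (- \<kappa>) * omega_hat \<omega> (1 - t)"
    define J where "J = (\<integral>\<^sup>+r\<in>{0..<1}. ennreal (max t (1 - r) powr (- \<kappa>) * \<omega> r) \<partial>lborel)"
    have JQ: "J \<le> ennreal (2 * C * Q)"
      unfolding J_def Q_def
      using weight_kernel_bound[OF rw C D _ kC t] k by (simp add: mult.assoc)
    have wt: "0 < omega_hat \<omega> (1 - t)" using t by (intro omega_hat_pos[OF rw]) auto
    have Q0: "0 < Q" using t wt by (simp add: Q_def)
    \<comment> \<open>The maximum of t and 1 - r is at most 1, so its negative power is at least 1.
      Hence \<open>Q\<close> is bounded below, which lets it absorb the value at 0.\<close>
    have "ennreal (omega_hat \<omega> 0) \<le> J"
      unfolding J_def omega_hat_nn_integral[OF rw order_refl]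
    proof (intro nn_integral_mono)
      fix r :: real
      have "\<omega> r \<le> max t (1 - r) powr (- \<kappa>) * \<omega> r" if r: "0 \<le> r" "r < 1"
      proof -
        have "max t (1 - r) powr (- \<kappa>) \<ge> 1 powr (- \<kappa>)"
          using t k r by (intro powr_mono2') auto
        then show ?thesis using mult_right_mono[OF _ om[OF r], of 1] by simp
      qed
      then show "ennreal (\<omega> r) * indicator {0..<1} r \<le> ennreal (max t (1 - r) powr (- \<kappa>) * \<omega> r) * indicator {0..<1} r"
        by (simp add: ennreal_leI split: split_indicator)
    qed
    with JQ have "ennreal (omega_hat \<omega> 0) \<le> ennreal (2 * C * Q)" by (rule order_trans[rotated])
    then have w0Q: "omega_hat \<omega> 0 \<le> 2 * C * Q" using C Q0 by (simp add: ennreal_le_iff)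
    have df: "cmod (deriv f z) powr p \<le> real M powr p * cmod (1 - cnj a * z) powr (- \<kappa> - 1)" if z: "cmod z < 1" for z
    proof -
      define w where "w = cmod (1 - cnj a * z)"
      have w: "0 < w" using nz[OF z] by (simp add: w_def)
      have "deriv f z = of_nat M * cnj a / (1 - cnj a * z) ^ Suc M"
        unfolding f_def by (rule DERIV_imp_deriv[OF deriv_kernel_power[OF nz[OF z]]])
      then have "cmod (deriv f z) = real M * cmod a / w ^ Suc M"
        by (simp add: norm_mult norm_divide norm_power w_def)
      also have "\<dots> \<le> real M * 1 / w ^ Suc M"
        using a w by (intro divide_right_mono mult_left_mono) auto
      also have "\<dots> = real M * w powr (- real (Suc M))"
        using w by (simp add: powr_minus_divide powr_realpow del: of_nat_Suc power_Suc)
      finally have "cmod (deriv f z) powr p \<le> (real M * w powr (- real (Suc M))) powr p"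
        using p by (intro powr_mono2) auto
      also have "\<dots> = real M powr p * w powr (- real (Suc M) * p)"
        by (simp add: powr_mult powr_powr del: of_nat_Suc)
      also have "- real (Suc M) * p = - \<kappa> - 1" by (simp add: \<kappa>_def algebra_simps)
      finally show ?thesis by (simp add: w_def)
    qed
    have inner: "(\<integral>\<^sup>+x\<in>{0..<2*pi}. ennreal (cmod (deriv f (of_real r * cis x)) powr p) \<partial>lborel)
        \<le> ennreal (2 * pi * real M powr p * max t (1 - r) powr (- \<kappa>))" if r: "0 \<le> r" "r < 1" for r
    proof -
      have cz: "cmod (of_real r * cis x) = r" for x using r by (simp add: norm_mult)
      have [measurable]: "(\<lambda>x. cmod (1 - cnj a * (of_real r * cis x))) \<in> borel_measurable borel"
        by (intro borel_measurable_continuous_onI continuous_intros)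
      have "(\<integral>\<^sup>+x\<in>{0..<2*pi}. ennreal (cmod (deriv f (of_real r * cis x)) powr p) \<partial>lborel)
        \<le> (\<integral>\<^sup>+x. ennreal (real M powr p) * (ennreal (cmod (1 - cnj a * (of_real r * cis x)) powr (- \<kappa> - 1)) * indicator {0..<2*pi} x) \<partial>lborel)"
      proof (intro nn_integral_mono)
        fix x
        have "ennreal (cmod (deriv f (of_real r * cis x)) powr p)
            \<le> ennreal (real M powr p * cmod (1 - cnj a * (of_real r * cis x)) powr (- \<kappa> - 1))"
          by (intro ennreal_leI df) (use cz r in simp)
        also have "\<dots> = ennreal (real M powr p) * ennreal (cmod (1 - cnj a * (of_real r * cis x)) powr (- \<kappa> - 1))"
          by (rule ennreal_mult') simp
        finally show "ennreal (cmod (deriv f (of_real r * cis x)) powr p) * indicator {0..<2*pi} x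
          \<le> ennreal (real M powr p) * (ennreal (cmod (1 - cnj a * (of_real r * cis x)) powr (- \<kappa> - 1)) * indicator {0..<2*pi} x)"
          by (simp split: split_indicator)
      qed
      also have "\<dots> = ennreal (real M powr p) * (\<integral>\<^sup>+x\<in>{0..<2*pi}. ennreal (cmod (1 - cnj a * (of_real r * cis x)) powr (- \<kappa> - 1)) \<partial>lborel)"
        by (rule nn_integral_cmult) measurable
      also have "\<dots> \<le> ennreal (real M powr p) * ennreal (2 * pi * (1 - cmod a * r) powr (- \<kappa>))"
        by (intro mult_left_mono cauchy_kernel_circle_bound[OF a r k]) simp
      also have "\<dots> = ennreal (real M powr p * (2 * pi * (1 - cmod a * r) powr (- \<kappa>)))"
        by (rule ennreal_mult'[symmetric]) simp
      also have "\<dots> \<le> ennreal (2 * pi * real M powr p * max t (1 - r) powr (- \<kappa>))"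
      proof (rule ennreal_leI)
        have "cmod a * r \<le> cmod a * 1" "cmod a * r \<le> 1 * r"
          using a r by (intro mult_left_mono mult_right_mono; simp)+
        then have "max t (1 - r) \<le> 1 - cmod a * r" by (auto simp: t_def)
        then have "(1 - cmod a * r) powr (- \<kappa>) \<le> max t (1 - r) powr (- \<kappa>)"
          using t k by (intro powr_mono2') auto
        then have "(2 * pi * real M powr p) * (1 - cmod a * r) powr (- \<kappa>) \<le> (2 * pi * real M powr p) * max t (1 - r) powr (- \<kappa>)"
          by (intro mult_left_mono) auto
        then show "real M powr p * (2 * pi * (1 - cmod a * r) powr (- \<kappa>)) \<le> 2 * pi * real M powr p * max t (1 - r) powr (- \<kappa>)"
          by (simp add: mult_ac)
      qed
      finally show ?thesis .
    qed
    have "D_int p \<omega> f = (\<integral>\<^sup>+r\<in>{0..<1}. (\<integral>\<^sup>+x\<in>{0..<2*pi}. ennreal (cmod (deriv f (of_real r * cis x)) powr p) \<partial>lborel)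
      * ennreal (\<omega> r * r) \<partial>lborel) / ennreal pi"
      by (rule D_int_polar[OF hol p om mw])
    also have "\<dots> \<le> (ennreal (2 * pi * real M powr p) * J) / ennreal pi"
    proof (rule divide_right_mono_ennreal)
      have "(\<integral>\<^sup>+r\<in>{0..<1}. (\<integral>\<^sup>+x\<in>{0..<2*pi}. ennreal (cmod (deriv f (of_real r * cis x)) powr p) \<partial>lborel)
          * ennreal (\<omega> r * r) \<partial>lborel)
        \<le> (\<integral>\<^sup>+r. ennreal (2 * pi * real M powr p) * (ennreal (max t (1 - r) powr (- \<kappa>) * \<omega> r) * indicator {0..<1} r) \<partial>lborel)"
      proof (intro nn_integral_mono)
        fix r :: real
        show "(\<integral>\<^sup>+x\<in>{0..<2*pi}. ennreal (cmod (deriv f (of_real r * cis x)) powr p) \<partial>lborel) * ennreal (\<omega> r * r) * indicator {0..<1} r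
          \<le> ennreal (2 * pi * real M powr p) * (ennreal (max t (1 - r) powr (- \<kappa>) * \<omega> r) * indicator {0..<1} r)"
        proof (cases "0 \<le> r \<and> r < 1")
          case True
          have "(\<integral>\<^sup>+x\<in>{0..<2*pi}. ennreal (cmod (deriv f (of_real r * cis x)) powr p) \<partial>lborel) * ennreal (\<omega> r * r)
            \<le> ennreal (2 * pi * real M powr p * max t (1 - r) powr (- \<kappa>)) * ennreal (\<omega> r * 1)"
            using True om[of r] by (intro mult_mono inner ennreal_leI mult_left_mono) auto
          also have "\<dots> = ennreal (2 * pi * real M powr p) * ennreal (max t (1 - r) powr (- \<kappa>) * \<omega> r)"
            using om[of r] True by (simp add: ennreal_mult'[symmetric] mult.assoc)
          finally show ?thesis using True by simp
        qed simp
      qed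
      also have "\<dots> = ennreal (2 * pi * real M powr p) * J"
        unfolding J_def
      proof (rule nn_integral_cmult)
        have "(\<lambda>r. ennreal (max t (1 - r) powr (- \<kappa>) * (indicator {0..<1} r * \<omega> r))) \<in> borel_measurable borel"
          using mw by measurable
        then have "(\<lambda>r. ennreal (max t (1 - r) powr (- \<kappa>) * \<omega> r) * indicator {0..<1} r) \<in> borel_measurable borel"
          by (rule measurable_cong[THEN iffD1, rotated]) (auto split: split_indicator)
        then show "(\<lambda>r. ennreal (max t (1 - r) powr (- \<kappa>) * \<omega> r) * indicator {0..<1} r) \<in> borel_measurable lborel"
          by (simp only: measurable_lborel2)
      qed
      finally show "(\<integral>\<^sup>+r\<in>{0..<1}. (\<integral>\<^sup>+x\<in>{0..<2*pi}. ennreal (cmod (deriv f (of_real r * cis x)) powr p) \<partial>lborel)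
          * ennreal (\<omega> r * r) \<partial>lborel) \<le> ennreal (2 * pi * real M powr p) * J" .
    qed
    also have "\<dots> \<le> (ennreal (2 * pi * real M powr p) * ennreal (2 * C * Q)) / ennreal pi"
      by (intro divide_right_mono_ennreal mult_left_mono JQ) simp
    also have "\<dots> = ennreal (4 * real M powr p * C * Q)"
      using C Q0 by (simp add: ennreal_mult'[symmetric] divide_ennreal)
    finally have Di: "D_int p \<omega> f \<le> ennreal (4 * real M powr p * C * Q)" .
    then have fin: "D_int p \<omega> f < \<infinity>" by (simp add: le_less_trans)
    have "enn2real (D_int p \<omega> f) \<le> 4 * real M powr p * C * Q"
      using Di C Q0 by (intro enn2real_leI) auto
    moreover have "cmod (f 0) powr p \<le> 2 * C / omega_hat \<omega> 0 * Q"
      using w0Q w0 by (simp add: f_def field_simps)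
    ultimately have "enn2real (D_int p \<omega> f) + cmod (f 0) powr p \<le> K * Q"
      by (simp add: K_def distrib_right)
    then have "D_norm p \<omega> f \<le> (K * Q) powr (1/p)"
      unfolding D_norm_def using p by (intro powr_mono2) auto
    moreover have "K * Q = K * (1 - cmod a) powr (1 - real (Suc M) * p) * omega_hat \<omega> (cmod a)"
      by (simp add: Q_def t_def \<kappa>_def)
    ultimately show ?thesis
      using hol fin by (simp add: D_space_def f_def)
  qed
  show ?thesis using K main by blast
qed

section \<open>Lower bounds from evaluation at the centre of the kernel\<close>

text \<open>On the segment, \<open>cnj a\<close> times s a is the real number \<rho>^2 s. The factor
  \<open>cis x\<close> is the direction of the segment; it is what shifts the Fourier index from j
  for \<open>deriv g\<close> to j + 1 for \<open>g\<close>.\<close>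

lemma T_op_at_kernel_centre:
  assumes \<rho>: "0 \<le> \<rho>" "\<rho> < 1"
  shows "T_op g (\<lambda>z. 1 / (1 - cnj (of_real \<rho> * cis x) * z) ^ M) (of_real \<rho> * cis x)
     = integral {0..1} (\<lambda>s. of_real (\<rho> / (1 - \<rho>\<^sup>2 * s) ^ M) * (cis x * deriv g (of_real (s * \<rho>) * cis x)))"
proof -
  have eq: "cnj (of_real \<rho> * cis x) * (of_real (s * \<rho>) * cis x) = of_real (\<rho>\<^sup>2 * s)" for s
  proof -
    have "cnj (cis x) * cis x = 1" by (simp add: cis_cnj cis_mult)
    then have "cnj (of_real \<rho> * cis x) * (of_real (s * \<rho>) * cis x) = of_real \<rho> * of_real (s * \<rho>)"
      by (simp add: mult_ac)
    then show ?thesis by (simp add: power2_eq_square mult_ac)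
  qed
  have lp: "linepath 0 (of_real \<rho> * cis x) s = of_real (s * \<rho>) * cis x" for s
    by (simp add: linepath_def scaleR_conv_of_real mult.assoc)
  show ?thesis
    unfolding T_op_def contour_integral_integral vector_derivative_linepath_at lp eq
    by (intro integral_cong) (simp add: mult_ac)
qed

text \<open>After the average over x only a positive integral in s is left, so nothing cancels: its
  part over [1-t, 1], where the kernel is at least (3t)^(-M), already has order t^(1-M).\<close>

lemma ratio_bounded_if_nonconstant:
  assumes p: "0 < p" and rw: "radial_weight \<omega>" and Dh: "D_hat \<omega>"
    and g: "g \<in> T_Hinf p \<omega>" and nz: "(deriv ^^ j) (deriv g) 0 \<noteq> 0"
  shows "ratio_bounded p \<omega>"
proof -
  obtain C where holg: "g holomorphic_on disc"
    and C: "\<And>f z. f \<in> D_space p \<omega> \<Longrightarrow> z \<in> disc \<Longrightarrow> cmod (T_op g f z) \<le> C * D_norm p \<omega> f"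
    using g unfolding T_Hinf_def by blast
  obtain M K where K: "0 < K"
    and test: "\<And>a. cmod a < 1 \<Longrightarrow> (\<lambda>z. 1 / (1 - cnj a * z) ^ M) \<in> D_space p \<omega>"
      "\<And>a. cmod a < 1 \<Longrightarrow> D_norm p \<omega> (\<lambda>z. 1 / (1 - cnj a * z) ^ M)
       \<le> (K * (1 - cmod a) powr (1 - real (Suc M) * p) * omega_hat \<omega> (cmod a)) powr (1/p)"
    using test_function_norm_bound[OF p rw Dh] by blast
  have hold: "deriv g holomorphic_on ball 0 1"
    using holg by (intro holomorphic_deriv) (auto simp: disc_def)
  define c where "c = (deriv ^^ j) (deriv g) 0 / fact j"
  have c0: "c \<noteq> 0" using nz by (simp add: c_def)
  \<comment> \<open>Collects the losses of the lower bound: 1/2 from the factor \<rho> of the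
    kernel, (1/2)^j each from \<rho>^j and s^j, and 3^(-M) from (3t)^M.\<close>
  define A where "A = ((1/2) ^ Suc j * ((1/2) ^ j / 3 ^ M) :: real)"
  have A0: "0 < A" by (simp add: A_def)
  have main: "cmod c * A * (t / t ^ M) \<le> \<bar>C\<bar> * (K * t powr (1 - real (Suc M) * p) * omega_hat \<omega> (1 - t)) powr (1/p)"
    if t: "0 < t" "t \<le> 1/2" for t
  proof -
    define \<rho> where "\<rho> = 1 - t"
    have \<rho>: "0 < \<rho>" "\<rho> < 1" "1/2 \<le> \<rho>" using t by (auto simp: \<rho>_def)
    define B where "B = \<bar>C\<bar> * (K * t powr (1 - real (Suc M) * p) * omega_hat \<omega> (1 - t)) powr (1/p)"
    define k where "k = (\<lambda>s. \<rho> / (1 - \<rho>\<^sup>2 * s) ^ M)"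
    have den: "0 < 1 - \<rho>\<^sup>2 * s" if "0 \<le> s" "s \<le> 1" for s
    proof -
      have "\<rho>\<^sup>2 < 1" using \<rho> by (simp add: power_less_one_iff abs_square_less_1)
      moreover have "\<rho>\<^sup>2 * s \<le> \<rho>\<^sup>2 * 1" using that by (intro mult_left_mono) auto
      ultimately show ?thesis by simp
    qed
    have k0: "0 \<le> k s" if "0 \<le> s" "s \<le> 1" for s using den[OF that] \<rho> by (simp add: k_def)
    have contk: "continuous_on {0..1} k"
      unfolding k_def using den by (intro continuous_intros) force
    \<comment> \<open>The integrand of \<open>cis (- (real (Suc j) * x))\<close> times T_g f_a(a);
      one factor \<open>cis x\<close> of the segment has been merged, so the exponent is
      -jx.\<close>
    define \<Psi> where "\<Psi> = (\<lambda>x s. of_real (k s) * (cis (- (real j * x)) * deriv g (of_real (s * \<rho>) * cis x)))"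
    have cont\<Psi>: "continuous_on (cbox (0, 0) (2*pi, 1)) (\<lambda>(x, s). \<Psi> x s)"
    proof -
      have s\<rho>: "s * \<rho> < 1" if "0 \<le> s" "s \<le> 1" for s
      proof -
        have "s * \<rho> \<le> 1 * \<rho>" using that \<rho> by (intro mult_right_mono) auto
        then show ?thesis using \<rho> by linarith
      qed
      have 1: "continuous_on ({0..2*pi} \<times> {0..1}) (\<lambda>w. deriv g (of_real (snd w * \<rho>) * cis (fst w)))"
        by (rule continuous_on_compose2[OF holomorphic_on_imp_continuous_on[OF hold]])
           (use \<rho> s\<rho> in \<open>auto intro!: continuous_intros simp: norm_mult abs_mult\<close>)
      have 2: "continuous_on ({0..2*pi} \<times> {0..1}) (\<lambda>w::real \<times> real. k (snd w))"
        by (rule continuous_on_compose2[OF contk]) (auto intro!: continuous_intros)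
      have "continuous_on ({0..2*pi} \<times> {0..1}) (\<lambda>(x, s). \<Psi> x s)"
        unfolding \<Psi>_def case_prod_unfold by (intro continuous_intros 1 2)
      moreover have "cbox (0, 0) (2*pi, 1) = {0..2*pi} \<times> {0..1::real}"
        by (simp add: cbox_Pair_eq)
      ultimately show ?thesis by simp
    qed
    have bound: "cmod (integral {0..1} (\<Psi> x)) \<le> B" for x
    proof -
      define a where "a = of_real \<rho> * cis x"
      have a: "cmod a = \<rho>" using \<rho> by (simp add: a_def norm_mult)
      have "cis (- (real (Suc j) * x)) * cis x = cis (- (real j * x))"
        by (simp add: cis_mult algebra_simps)
      then have "\<Psi> x = (\<lambda>s. cis (- (real (Suc j) * x)) * (of_real (k s) * (cis x * deriv g (of_real (s * \<rho>) * cis x))))"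
        unfolding \<Psi>_def by (intro ext) (metis (no_types, opaque_lifting) mult.assoc mult.left_commute)
      then have "integral {0..1} (\<Psi> x) = cis (- (real (Suc j) * x)) *
          integral {0..1} (\<lambda>s. of_real (k s) * (cis x * deriv g (of_real (s * \<rho>) * cis x)))"
        by (simp only: integral_mult_right)
      then have "integral {0..1} (\<Psi> x) = cis (- (real (Suc j) * x)) * T_op g (\<lambda>z. 1 / (1 - cnj a * z) ^ M) a"
        using T_op_at_kernel_centre[of \<rho> g x M] \<rho> by (simp only: a_def k_def less_imp_le)
      then have "cmod (integral {0..1} (\<Psi> x)) = cmod (T_op g (\<lambda>z. 1 / (1 - cnj a * z) ^ M) a)"
        by (simp add: norm_mult)
      also have "\<dots> \<le> C * D_norm p \<omega> (\<lambda>z. 1 / (1 - cnj a * z) ^ M)"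
        using a \<rho> by (intro C test) (auto simp: disc_def)
      also have "\<dots> \<le> \<bar>C\<bar> * D_norm p \<omega> (\<lambda>z. 1 / (1 - cnj a * z) ^ M)"
        by (intro mult_right_mono) (auto simp: D_norm_def)
      also have "\<dots> \<le> B"
        unfolding B_def using test(2)[of a] a \<rho> by (intro mult_left_mono) (auto simp: \<rho>_def)
      finally show ?thesis .
    qed
    define I where "I = integral {0..1} (\<lambda>s. k s * s ^ j)"
    have swap: "integral {0..2*pi} (\<lambda>x. integral {0..1} (\<Psi> x)) = integral {0..1} (\<lambda>s. integral {0..2*pi} (\<lambda>x. \<Psi> x s))"
      using integral_swap_continuous[OF cont\<Psi>] by simp
    have "integral {0..1} (\<lambda>s. integral {0..2*pi} (\<lambda>x. \<Psi> x s))
        = integral {0..1} (\<lambda>s. of_real (k s * s ^ j) * (2 * of_real pi * of_real \<rho> ^ j * c))"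
    \<comment> \<open>The coefficient formula requires a positive radius, so the null set s = 0 is
      left out.\<close>
    proof (rule integral_spike[where S = "{0}"])
      fix s :: real assume s: "s \<in> {0..1} - {0}"
      have "s * \<rho> \<le> 1 * \<rho>" using s \<rho> by (intro mult_right_mono) auto
      then have "0 < s * \<rho>" "s * \<rho> < 1"
        using s \<rho> by (auto intro: le_less_trans[of _ \<rho>])
      from circle_integral_coefficient[OF hold this, of j]
      have "((\<lambda>x. \<Psi> x s) has_integral of_real (k s) * (2 * of_real pi * of_real (s * \<rho>) ^ j * c)) {0..2*pi}"
        unfolding \<Psi>_def c_def by (rule has_integral_mult_right)
      then show "of_real (k s * s ^ j) * (2 * of_real pi * of_real \<rho> ^ j * c) = integral {0..2*pi} (\<lambda>x. \<Psi> x s)"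
        by (simp add: integral_unique power_mult_distrib mult_ac)
    qed simp
    also have "\<dots> = of_real I * (2 * of_real pi * of_real \<rho> ^ j * c)"
    proof -
      have "(\<lambda>s. k s * s ^ j) integrable_on {0..1}"
        by (intro integrable_continuous_real continuous_intros contk)
      then have "((\<lambda>s. complex_of_real (k s * s ^ j)) has_integral of_real I) {0..1}"
        unfolding I_def by (intro has_integral_of_real integrable_integral)
      then show ?thesis by (intro integral_unique has_integral_mult_left)
    qed
    finally have val: "integral {0..2*pi} (\<lambda>x. integral {0..1} (\<Psi> x)) = of_real I * (2 * of_real pi * of_real \<rho> ^ j * c)"
      by (simp add: swap)
    have "cmod (integral {0..2*pi} (\<lambda>x. integral {0..1} (\<Psi> x))) \<le> integral {0..2*pi} (\<lambda>x. B)"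
    proof (rule Henstock_Kurzweil_Integration.integral_norm_bound_integral)
      have "continuous_on (cbox 0 (2*pi)) (\<lambda>x. integral (cbox 0 1) (\<Psi> x))"
        by (rule integral_continuous_on_param) (use cont\<Psi> in \<open>simp add: cbox_Pair_eq\<close>)
      then show "(\<lambda>x. integral {0..1} (\<Psi> x)) integrable_on {0..2*pi}"
        by (intro integrable_continuous_real) simp
    qed (use bound in auto)
    then have le1: "\<bar>I\<bar> * \<rho> ^ j * cmod c \<le> B"
      unfolding val using \<rho> by (simp add: norm_mult norm_power)
    have I: "t * ((1/2) * ((1/2) ^ j / (3 * t) ^ M)) \<le> I"
    proof -
      have "integral {1-t..1} (\<lambda>s. (1/2) * ((1/2) ^ j / (3 * t) ^ M)) \<le> integral {1-t..1} (\<lambda>s. k s * s ^ j)"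
      proof (rule integral_le)
        show "(\<lambda>s. k s * s ^ j) integrable_on {1-t..1}"
          using t by (intro integrable_continuous_real continuous_intros continuous_on_subset[OF contk]) auto
        fix s assume s: "s \<in> {1-t..1}"
        have s2: "1/2 \<le> s" "s \<le> 1" using s t by auto
        \<comment> \<open>On this range the left side is at most 1 - (1-t)^3, which is 3t minus a
          nonnegative term.\<close>
        have "1 - \<rho>\<^sup>2 * s \<le> 3 * t"
        proof -
          have "\<rho>\<^sup>2 * s \<ge> \<rho>\<^sup>2 * (1 - t)" using s by (intro mult_left_mono) auto
          moreover have "1 - \<rho>\<^sup>2 * (1 - t) = 3 * t - t\<^sup>2 * (3 - t)"
            by (simp add: \<rho>_def power2_eq_square algebra_simps)
          moreover have "0 \<le> t\<^sup>2 * (3 - t)" using t by auto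
          ultimately show ?thesis by linarith
        qed
        then have "(1 - \<rho>\<^sup>2 * s) ^ M \<le> (3 * t) ^ M"
          using den[of s] s2 by (intro power_mono) auto
        moreover have "0 < (1 - \<rho>\<^sup>2 * s) ^ M" using den[of s] s2 by simp
        ultimately have "(1/2) / (3 * t) ^ M \<le> k s"
          unfolding k_def using \<rho> by (intro frac_le) auto
        moreover have "(1/2) ^ j \<le> s ^ j" using s2 by (intro power_mono) auto
        ultimately have "((1/2) / (3 * t) ^ M) * (1/2) ^ j \<le> k s * s ^ j"
          using t k0[of s] s2 by (intro mult_mono) auto
        then show "(1/2) * ((1/2) ^ j / (3 * t) ^ M) \<le> k s * s ^ j" by simp
      qed auto
      also have "\<dots> \<le> I"
        unfolding I_def using t k0
        by (intro integral_subset_le integrable_continuous_real continuous_intros contk continuous_on_subset[OF contk]) auto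
      finally show ?thesis using t by simp
    qed
    have "t * ((1/2) * ((1/2) ^ j / (3 * t) ^ M)) * (1/2) ^ j * cmod c \<le> \<bar>I\<bar> * \<rho> ^ j * cmod c"
      using I \<rho> t by (intro mult_right_mono mult_mono power_mono) auto
    moreover have "t * ((1/2) * ((1/2) ^ j / (3 * t) ^ M)) * (1/2) ^ j * cmod c = cmod c * A * (t / t ^ M)"
      by (simp add: A_def power_mult_distrib mult_ac)
    ultimately show ?thesis using le1 by (simp add: B_def)
  qed
  define e where "e = 2 - 1/p"
  define L where "L = \<bar>C\<bar> * K powr (1/p) / (cmod c * A)"
  have far: "(1 - r) powr e / omega_hat \<omega> r powr (1/p) \<le> L" if r: "1/2 \<le> r" "r < 1" for r
  proof -
    define t where "t = 1 - r"
    have t: "0 < t" "t \<le> 1/2" using r by (auto simp: t_def)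
    have w: "0 < omega_hat \<omega> r" using r by (intro omega_hat_pos[OF rw]) auto
    define W where "W = omega_hat \<omega> r powr (1/p)"
    have W: "0 < W" using w by (simp add: W_def)
    have "(K * t powr (1 - real (Suc M) * p) * omega_hat \<omega> (1 - t)) powr (1/p)
        = K powr (1/p) * t powr (1/p - real (Suc M)) * W"
      using K w p by (simp add: powr_mult powr_powr W_def t_def diff_divide_distrib del: of_nat_Suc)
    then have 1: "cmod c * A * (t / t ^ M) \<le> \<bar>C\<bar> * (K powr (1/p) * t powr (1/p - real (Suc M)) * W)"
      using main[OF t] by simp
    \<comment> \<open>Here \<open>M\<close> drops out: (1/p - M - 1) + (2 - 1/p) = 1 - M.\<close>
    have 2: "t / t ^ M = t powr (1/p - real (Suc M)) * t powr e"
    proof -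
      have "t powr (1/p - real (Suc M)) * t powr e = t powr (1 - real M)"
        by (simp add: e_def flip: powr_add)
      also have "\<dots> = t / t ^ M" using t by (simp add: powr_diff powr_realpow)
      finally show ?thesis by simp
    qed
    have "t powr (1/p - real (Suc M)) * (cmod c * A * t powr e) \<le> t powr (1/p - real (Suc M)) * (\<bar>C\<bar> * K powr (1/p) * W)"
      using 1 unfolding 2 by (simp add: mult_ac del: of_nat_Suc)
    then have "cmod c * A * t powr e \<le> \<bar>C\<bar> * K powr (1/p) * W"
      using t by (subst (asm) mult_le_cancel_left_pos) auto
    then have "t powr e / W \<le> L"
      using W c0 A0 by (simp add: L_def field_simps)
    then show ?thesis by (simp add: t_def W_def)
  qed
  \<comment> \<open>Away from the boundary the ratio is bounded by monotonicity of the tail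
    alone.\<close>
  have near: "(1 - r) powr e / omega_hat \<omega> r powr (1/p) \<le> 2 powr \<bar>e\<bar> / omega_hat \<omega> (1/2) powr (1/p)"
    if r: "0 \<le> r" "r < 1/2" for r
  proof (rule frac_le)
    show "(1 - r) powr e \<le> 2 powr \<bar>e\<bar>"
      using powr_le_powr_abs[of "1 - r" 1 2 e] r by simp
    show "omega_hat \<omega> (1/2) powr (1/p) \<le> omega_hat \<omega> r powr (1/p)"
      using r p omega_hat_pos[OF rw, of "1/2"] by (intro powr_mono2 omega_hat_antimono[OF rw]) auto
    show "0 < omega_hat \<omega> (1/2) powr (1/p)" using omega_hat_pos[OF rw, of "1/2"] by simp
  qed auto
  show ?thesis
    unfolding ratio_bounded_def e_def[symmetric]
  proof (intro exI ballI)
    fix r :: real assume "r \<in> {0..<1}"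
    then show "(1 - r) powr e / omega_hat \<omega> r powr (1/p) \<le> max L (2 powr \<bar>e\<bar> / omega_hat \<omega> (1/2) powr (1/p))"
      using far[of r] near[of r] by (cases "1/2 \<le> r") auto
  qed
qed

lemma T_Hinf_constant_if_ratio_unbounded:
  assumes "0 < p" "radial_weight \<omega>" "D_hat \<omega>" "\<not> ratio_bounded p \<omega>"
  shows "T_Hinf p \<omega> \<subseteq> {g. \<exists>c. \<forall>z\<in>disc. g z = c}"
proof (intro subsetI CollectI exI ballI)
  fix g z assume g: "g \<in> T_Hinf p \<omega>" and z: "z \<in> disc"
  have "(deriv ^^ n) g 0 = 0" if "0 < n" for n
  proof -
    have "(deriv ^^ (n - 1)) (deriv g) 0 = 0"
      using ratio_bounded_if_nonconstant[OF assms(1-3) g] assms(4) by blast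
    moreover have "(deriv ^^ n) g = (deriv ^^ (n - 1)) (deriv g)"
      using that by (cases n) (simp_all add: funpow_swap1)
    ultimately show ?thesis by simp
  qed
  then show "g z = g 0"
    using g z by (intro holomorphic_fun_eq_const_on_connected[of g disc]) (auto simp: T_Hinf_def disc_def)
qed

section \<open>Embedded spaces have a bounded integration operator\<close>

text \<open>Layer cake: \<open>{s. l < m s}\<close> is an end segment of \<open>[0, 1)\<close>, so it suffices to compare the two
  weights on end segments.\<close>
lemma nn_integral_increasing_weight_le:
  fixes m :: "real \<Rightarrow> real" and u v :: "real \<Rightarrow> ennreal"
  assumes mono: "\<And>r s. 0 \<le> r \<Longrightarrow> r \<le> s \<Longrightarrow> s < 1 \<Longrightarrow> m r \<le> m s"
    and nonneg: "\<And>r. 0 \<le> r \<Longrightarrow> r < 1 \<Longrightarrow> 0 \<le> m r"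
    and mm: "(\<lambda>s. indicator {0..<1} s * m s) \<in> borel_measurable borel"
    and u: "(\<lambda>s. u s * indicator {0..<1} s) \<in> borel_measurable borel"
    and v: "(\<lambda>s. v s * indicator {0..<1} s) \<in> borel_measurable borel"
    and tails: "\<And>t. 0 \<le> t \<Longrightarrow> t < 1 \<Longrightarrow> (\<integral>\<^sup>+s\<in>{t..<1}. u s \<partial>lborel) \<le> K * (\<integral>\<^sup>+s\<in>{t..<1}. v s \<partial>lborel)"
  shows "(\<integral>\<^sup>+s\<in>{0..<1}. ennreal (m s) * u s \<partial>lborel) \<le> K * (\<integral>\<^sup>+s\<in>{0..<1}. ennreal (m s) * v s \<partial>lborel)"
proof -
  define m' where "m' = (\<lambda>s. indicator {0..<1} s * m s)"
  have [measurable]: "m' \<in> borel_measurable borel" using mm by (simp add: m'_def)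
  define U where "U = (\<lambda>l. {s \<in> {0..<1}. l < m s})"
  have layer: "(\<integral>\<^sup>+s\<in>{0..<1}. ennreal (m s) * w s \<partial>lborel)
      = (\<integral>\<^sup>+l. (\<integral>\<^sup>+s. w s * indicator {0..<1} s * indicator {q. 0 \<le> snd q \<and> snd q < m' (fst q)} (s, l) \<partial>lborel) \<partial>lborel)"
    if w[measurable]: "(\<lambda>s. w s * indicator {0..<1} s) \<in> borel_measurable borel" for w :: "real \<Rightarrow> ennreal"
  proof -
    have "(\<integral>\<^sup>+s\<in>{0..<1}. ennreal (m s) * w s \<partial>lborel)
       = (\<integral>\<^sup>+s. (\<integral>\<^sup>+l. w s * indicator {0..<1} s * indicator {q. 0 \<le> snd q \<and> snd q < m' (fst q)} (s, l) \<partial>lborel) \<partial>lborel)"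
    proof (intro nn_integral_cong)
      fix s :: real
      have "(\<integral>\<^sup>+l. w s * indicator {0..<1} s * indicator {q. 0 \<le> snd q \<and> snd q < m' (fst q)} (s, l) \<partial>lborel)
         = (\<integral>\<^sup>+l. w s * indicator {0..<1} s * indicator {0..<m' s} l \<partial>lborel)"
        by (intro nn_integral_cong) (auto split: split_indicator)
      also have "\<dots> = w s * indicator {0..<1} s * emeasure lborel {0..<m' s}"
        by (rule nn_integral_cmult_indicator) simp
      also have "\<dots> = ennreal (m s) * w s * indicator {0..<1} s"
        using nonneg[of s] by (auto simp: m'_def mult.commute split: split_indicator)
      finally show "ennreal (m s) * w s * indicator {0..<1} s
        = (\<integral>\<^sup>+l. w s * indicator {0..<1} s * indicator {q. 0 \<le> snd q \<and> snd q < m' (fst q)} (s, l) \<partial>lborel)" by simp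
    qed
    also have "\<dots> = (\<integral>\<^sup>+l. (\<integral>\<^sup>+s. w s * indicator {0..<1} s * indicator {q. 0 \<le> snd q \<and> snd q < m' (fst q)} (s, l) \<partial>lborel) \<partial>lborel)"
    proof (rule lborel_pair.Fubini'[symmetric])
      have "(\<lambda>q::real \<times> real. (w (fst q) * indicator {0..<1} (fst q)) * indicator {q. 0 \<le> snd q \<and> snd q < m' (fst q)} q) \<in> borel_measurable (borel \<Otimes>\<^sub>M borel)"
        by measurable
      then show "(\<lambda>(s, l). w s * indicator {0..<1} s * indicator {q. 0 \<le> snd q \<and> snd q < m' (fst q)} (s, l)) \<in> borel_measurable (lborel \<Otimes>\<^sub>M lborel)"
        by (simp add: lborel_prod borel_prod case_prod_unfold)
    qed
    finally show ?thesis .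
  qed
  have inner: "(\<integral>\<^sup>+s. u s * indicator {0..<1} s * indicator {q. 0 \<le> snd q \<and> snd q < m' (fst q)} (s, l) \<partial>lborel)
     \<le> K * (\<integral>\<^sup>+s. v s * indicator {0..<1} s * indicator {q. 0 \<le> snd q \<and> snd q < m' (fst q)} (s, l) \<partial>lborel)" for l
  proof (cases "0 \<le> l \<and> U l \<noteq> {}")
    case False
    then have "u s * indicator {0..<1} s * indicator {q. 0 \<le> snd q \<and> snd q < m' (fst q)} (s, l) = 0" for s
      by (auto simp: U_def m'_def split: split_indicator)
    then show ?thesis by (simp only: nn_integral_const mult_zero_left zero_le)
  next
    case True
    \<comment> \<open>Monotonicity of \<open>m\<close> makes the level set an end segment of [0,1)
      starting at \<open>t\<close>.\<close>
    define t where "t = Inf (U l)"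
    have bdd: "bdd_below (U l)" by (rule bdd_belowI[of _ 0]) (auto simp: U_def)
    obtain s0 where s0: "s0 \<in> U l" using True by auto
    have "t \<le> s0" unfolding t_def by (rule cInf_lower[OF s0 bdd])
    moreover have "s0 < 1" using s0 by (simp add: U_def)
    moreover have "0 \<le> t" unfolding t_def by (rule cInf_greatest) (use True in \<open>auto simp: U_def\<close>)
    ultimately have t: "0 \<le> t" "t < 1" by auto
    have inU: "s \<in> U l" if "t < s" "s < 1" for s
    proof -
      have "U l \<noteq> {}" "Inf (U l) < s" using True that(1) by (simp_all add: t_def)
      from cInf_lessD[OF this] obtain s1 where "s1 \<in> U l" "s1 < s" by (elim bexE)
      then show ?thesis using mono[of s1 s] that by (auto simp: U_def)
    qed
    have eq: "(\<integral>\<^sup>+s. w s * indicator {0..<1} s * indicator {q. 0 \<le> snd q \<and> snd q < m' (fst q)} (s, l) \<partial>lborel)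
       = (\<integral>\<^sup>+s\<in>{t..<1}. w s \<partial>lborel)" for w :: "real \<Rightarrow> ennreal"
      \<comment> \<open>Whether the infimum itself belongs to the level set is undecided, so
        \<open>t\<close> is discarded as a null set.\<close>
      using AE_lborel_singleton[of t]
    proof (intro nn_integral_cong_AE, eventually_elim)
      fix s :: real assume st: "s \<noteq> t"
      show "w s * indicator {0..<1} s * indicator {q. 0 \<le> snd q \<and> snd q < m' (fst q)} (s, l) = w s * indicator {t..<1} s"
      proof (cases "s \<in> {0..<1}")
        case s: True
        then have "m' s = m s" by (simp add: m'_def)
        moreover have "l < m s \<longleftrightarrow> t \<le> s"
        proof
          assume "l < m s"
          then have "s \<in> U l" using s by (simp add: U_def)
          then show "t \<le> s" unfolding t_def by (rule cInf_lower[OF _ bdd])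
        next
          assume "t \<le> s"
          then show "l < m s" using inU[of s] st s by (simp add: U_def)
        qed
        ultimately show ?thesis using s True by (simp add: indicator_def)
      next
        case False
        then show ?thesis using t by (auto simp: indicator_def)
      qed
    qed
    show ?thesis unfolding eq by (rule tails[OF t])
  qed
  have "(\<integral>\<^sup>+s\<in>{0..<1}. ennreal (m s) * u s \<partial>lborel)
     \<le> (\<integral>\<^sup>+l. K * (\<integral>\<^sup>+s. v s * indicator {0..<1} s * indicator {q. 0 \<le> snd q \<and> snd q < m' (fst q)} (s, l) \<partial>lborel) \<partial>lborel)"
    unfolding layer[OF u] by (intro nn_integral_mono inner)
  also have "\<dots> = K * (\<integral>\<^sup>+s\<in>{0..<1}. ennreal (m s) * v s \<partial>lborel)"
    unfolding layer[OF v]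
  proof (rule nn_integral_cmult)
    note v[measurable]
    have "(\<lambda>l. (\<integral>\<^sup>+s. (v s * indicator {0..<1} s) * indicator {q. 0 \<le> snd q \<and> snd q < m' (fst q)} (s, l) \<partial>lborel)) \<in> borel_measurable borel"
      by measurable
    then show "(\<lambda>l. (\<integral>\<^sup>+s. v s * indicator {0..<1} s * indicator {q. 0 \<le> snd q \<and> snd q < m' (fst q)} (s, l) \<partial>lborel)) \<in> borel_measurable lborel"
      by simp
  qed
  finally show ?thesis .
qed

section \<open>Dirichlet integrals in terms of circle means\<close>

definition circle_int :: "real \<Rightarrow> (complex \<Rightarrow> complex) \<Rightarrow> real \<Rightarrow> real" where
  "circle_int p F r = integral {0..2*pi} (\<lambda>x. cmod (F (of_real r * cis x)) powr p)"

lemma circle_int_nonneg: "0 \<le> circle_int p F r"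
  unfolding circle_int_def
  by (cases "(\<lambda>x. cmod (F (of_real r * cis x)) powr p) integrable_on {0..2*pi}")
     (auto intro: integral_nonneg simp: not_integrable_integral)

lemma nn_integral_circle_int:
  assumes "F holomorphic_on ball 0 R" "0 < p" "0 \<le> r" "r < R"
  shows "(\<integral>\<^sup>+x\<in>{0..<2*pi}. ennreal (cmod (F (of_real r * cis x)) powr p) \<partial>lborel) = ennreal (circle_int p F r)"
  unfolding circle_int_def
  by (rule nn_integral_continuous_eq_integral[OF continuous_on_circle_powr[OF assms]]) simp

lemma circle_int_mono:
  assumes "F holomorphic_on ball 0 R" "0 < p" "p \<le> 2" "0 \<le> r" "r \<le> s" "s < R"
  shows "circle_int p F r \<le> circle_int p F s"
  unfolding circle_int_def by (rule circle_mean_powr_mono[OF assms])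

lemma circle_int_measurable:
  assumes "F holomorphic_on ball 0 1" "0 < p"
  shows "(\<lambda>s. indicator {0..<1} s * circle_int p F s) \<in> borel_measurable borel"
proof -
  have "continuous_on {0..<1} (circle_int p F)"
    unfolding circle_int_def[abs_def] by (rule continuous_on_circle_mean[OF assms])
  then have "(\<lambda>s. indicator {0..<1} s *\<^sub>R circle_int p F s) \<in> borel_measurable borel"
    by (intro borel_measurable_continuous_on_indicator) auto
  then show ?thesis by simp
qed

lemma D_int_circle_int:
  assumes hol: "f holomorphic_on disc" and p: "0 < p"
    and nn: "\<And>s. 0 \<le> s \<Longrightarrow> s < 1 \<Longrightarrow> 0 \<le> \<omega> s"
    and meas: "(\<lambda>s. indicator {0..<1} s * \<omega> s) \<in> borel_measurable borel"
  shows "D_int p \<omega> f = (\<integral>\<^sup>+r\<in>{0..<1}. ennreal (circle_int p (deriv f) r) * ennreal (\<omega> r * r) \<partial>lborel) / ennreal pi"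
proof -
  have hold: "deriv f holomorphic_on ball 0 1"
    using hol by (intro holomorphic_deriv) (auto simp: disc_def)
  have "(\<integral>\<^sup>+r\<in>{0..<1}. (\<integral>\<^sup>+x\<in>{0..<2*pi}. ennreal (cmod (deriv f (of_real r * cis x)) powr p) \<partial>lborel) * ennreal (\<omega> r * r) \<partial>lborel)
     = (\<integral>\<^sup>+r\<in>{0..<1}. ennreal (circle_int p (deriv f) r) * ennreal (\<omega> r * r) \<partial>lborel)"
  proof (intro nn_integral_cong)
    fix r :: real
    show "(\<integral>\<^sup>+x\<in>{0..<2*pi}. ennreal (cmod (deriv f (of_real r * cis x)) powr p) \<partial>lborel) * ennreal (\<omega> r * r) * indicator {0..<1} r
       = ennreal (circle_int p (deriv f) r) * ennreal (\<omega> r * r) * indicator {0..<1} r"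
      by (cases "0 \<le> r \<and> r < 1") (simp_all add: nn_integral_circle_int[OF hold p])
  qed
  then show ?thesis by (simp add: D_int_polar[OF assms])
qed

lemma std_weight_0: "0 \<le> s \<Longrightarrow> s < 1 \<Longrightarrow> std_weight 0 s = 1"
  by (simp add: std_weight_def abs_square_less_1 power2_eq_1_iff)

lemma D_int_unweighted:
  assumes hol: "f holomorphic_on disc"
  shows "D_int 1 (std_weight 0) f = (\<integral>\<^sup>+r\<in>{0..<1}. ennreal (circle_int 1 (deriv f) r) * ennreal r \<partial>lborel) / ennreal pi"
proof -
  have eq: "(\<lambda>s. indicator {0..<1} s * std_weight 0 s) = indicator {0..<1}"
    by (auto simp: std_weight_0 split: split_indicator)
  have "D_int 1 (std_weight 0) f = (\<integral>\<^sup>+r\<in>{0..<1}. ennreal (circle_int 1 (deriv f) r) * ennreal (std_weight 0 r * r) \<partial>lborel) / ennreal pi"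
    by (rule D_int_circle_int[OF hol]) (auto simp: std_weight_0 eq)
  also have "(\<integral>\<^sup>+r\<in>{0..<1}. ennreal (circle_int 1 (deriv f) r) * ennreal (std_weight 0 r * r) \<partial>lborel)
     = (\<integral>\<^sup>+r\<in>{0..<1}. ennreal (circle_int 1 (deriv f) r) * ennreal r \<partial>lborel)"
    by (intro nn_integral_cong) (auto simp: std_weight_0 split: split_indicator)
  finally show ?thesis .
qed

text \<open>Means increase in r, so the vanishing of the Jacobian r at 0 costs only a factor 2: on
  an end segment, 1 - t is at most 1 - t^2, twice the integral of s.\<close>

lemma nn_integral_circle_int_le:
  assumes hol: "F holomorphic_on ball 0 1"
  shows "(\<integral>\<^sup>+r\<in>{0..<1}. ennreal (circle_int 1 F r) \<partial>lborel)
     \<le> 2 * (\<integral>\<^sup>+r\<in>{0..<1}. ennreal (circle_int 1 F r) * ennreal r \<partial>lborel)"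
proof -
  have "(\<integral>\<^sup>+r\<in>{0..<1}. ennreal (circle_int 1 F r) * 1 \<partial>lborel)
     \<le> 2 * (\<integral>\<^sup>+r\<in>{0..<1}. ennreal (circle_int 1 F r) * ennreal r \<partial>lborel)"
  proof (rule nn_integral_increasing_weight_le)
    fix t :: real assume t: "0 \<le> t" "t < 1"
    have 1: "(\<integral>\<^sup>+s\<in>{t..<1}. 1 \<partial>lborel) = ennreal (1 - t)" using t by simp
    have "(\<integral>\<^sup>+s\<in>{t..<1}. ennreal s \<partial>lborel) = ennreal (integral {t..1} (\<lambda>s. s))"
      using t by (intro nn_integral_continuous_eq_integral) auto
    also have "integral {t..1} (\<lambda>s. s) = (1 - t\<^sup>2) / 2"
      using t ident_has_integral[of t 1] by (simp add: integral_unique)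
    finally have 2: "(\<integral>\<^sup>+s\<in>{t..<1}. ennreal s \<partial>lborel) = ennreal ((1 - t\<^sup>2) / 2)" .
    have "ennreal (1 - t) \<le> ennreal (2 * ((1 - t\<^sup>2) / 2))"
      using t by (intro ennreal_leI) (simp add: power2_eq_square mult_left_le)
    also have "\<dots> = 2 * ennreal ((1 - t\<^sup>2) / 2)"
      by (simp only: ennreal_mult'[of 2] ennreal_numeral zero_le_numeral)
    finally show "(\<integral>\<^sup>+s\<in>{t..<1}. 1 \<partial>lborel) \<le> 2 * (\<integral>\<^sup>+s\<in>{t..<1}. ennreal s \<partial>lborel)"
      unfolding 1 2 .
  qed (use circle_int_mono[OF hol] circle_int_nonneg circle_int_measurable[OF hol] in auto)
  then show ?thesis by simp
qed

text \<open>Two points of the circle with arguments in [0, 2 pi] are joined by an arc in that range,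
  so the values of h there differ by at most the integral of |h'|, the arc length factor r being at
  most 1. Averaging over the second point replaces its value by h(0).\<close>

lemma primitive_le_circle_integral:
  assumes hol: "h holomorphic_on ball 0 1" and z: "cmod z < 1"
  shows "cmod (h z - h 0) \<le> integral {0..2*pi} (\<lambda>x. cmod (deriv h (of_real (cmod z) * cis x)))"
proof -
  define r where "r = cmod z"
  have r: "0 \<le> r" "r < 1" using z by (auto simp: r_def)
  have cz: "of_real r * cis x \<in> ball 0 1" for x using r by (simp add: norm_mult)
  define \<alpha> where "\<alpha> = Arg2pi z"
  have \<alpha>: "0 \<le> \<alpha>" "\<alpha> \<le> 2*pi" using Arg2pi_ge_0[of z] Arg2pi_lt_2pi[of z] by (auto simp: \<alpha>_def)
  have zeq: "z = of_real r * cis \<alpha>"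
    using Arg2pi_eq[of z] by (simp add: \<alpha>_def r_def cis_conv_exp)
  have hold: "deriv h holomorphic_on ball 0 1" using hol by (intro holomorphic_deriv) auto
  have contd: "continuous_on A (\<lambda>x. deriv h (of_real r * cis x))" for A
    by (rule continuous_on_compose2[OF holomorphic_on_imp_continuous_on[OF hold]])
       (use cz in \<open>auto intro!: continuous_intros\<close>)
  define S where "S = integral {0..2*pi} (\<lambda>x. cmod (deriv h (of_real r * cis x)))"
  have arc: "cmod (h (of_real r * cis b) - h (of_real r * cis a)) \<le> S" if ab: "0 \<le> a" "a \<le> b" "b \<le> 2*pi" for a b
  proof -
    have "((\<lambda>x. deriv h (of_real r * cis x) * (of_real r * (\<i> * cis x))) has_integral
        (h (of_real r * cis b) - h (of_real r * cis a))) {a..b}"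
    proof (rule fundamental_theorem_of_calculus[OF ab(2)])
      fix x assume "x \<in> {a..b}"
      have d1: "((\<lambda>x. of_real r * cis x) has_vector_derivative of_real r * (\<i> * cis x)) (at x within {a..b})"
      proof -
        have 1: "((\<lambda>x. complex_of_real x) has_vector_derivative 1) (at x within {a..b})"
          by (auto intro!: derivative_eq_intros)
        have 2: "((\<lambda>w. of_real r * exp (\<i> * w)) has_field_derivative of_real r * (\<i> * exp (\<i> * of_real x)))
            (at (complex_of_real x) within range of_real)"
          by (auto intro!: derivative_eq_intros)
        have "((\<lambda>w. of_real r * exp (\<i> * w)) \<circ> complex_of_real has_vector_derivative 1 * (of_real r * (\<i> * exp (\<i> * of_real x)))) (at x within {a..b})"
          by (rule field_vector_diff_chain_within[OF 1 DERIV_subset[OF 2]]) auto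
        then show ?thesis by (simp add: o_def cis_conv_exp)
      qed
      have "(h has_field_derivative deriv h (of_real r * cis x)) (at (of_real r * cis x))"
        by (rule holomorphic_derivI[OF hol _ cz]) auto
      from field_vector_diff_chain_within[OF d1 DERIV_subset[OF this subset_UNIV]]
      show "((\<lambda>x. h (of_real r * cis x)) has_vector_derivative deriv h (of_real r * cis x) * (of_real r * (\<i> * cis x))) (at x within {a..b})"
        by (simp add: o_def mult_ac)
    qed
    then have "cmod (h (of_real r * cis b) - h (of_real r * cis a))
       = cmod (integral {a..b} (\<lambda>x. deriv h (of_real r * cis x) * (of_real r * (\<i> * cis x))))"
      by (simp add: integral_unique)
    also have "\<dots> \<le> integral {a..b} (\<lambda>x. cmod (deriv h (of_real r * cis x)))"
    proof (rule Henstock_Kurzweil_Integration.integral_norm_bound_integral)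
      show "cmod (deriv h (of_real r * cis x) * (of_real r * (\<i> * cis x))) \<le> cmod (deriv h (of_real r * cis x))" for x
        using r by (simp add: norm_mult mult_left_le)
    qed (intro integrable_continuous_real continuous_intros contd)+
    also have "\<dots> \<le> S"
      unfolding S_def using ab
      by (intro integral_subset_le integrable_continuous_real continuous_intros contd) auto
    finally show ?thesis .
  qed
  have osc: "cmod (h z - h (of_real r * cis x)) \<le> S" if "0 \<le> x" "x \<le> 2*pi" for x
    using arc[of x \<alpha>] arc[of \<alpha> x] that \<alpha> unfolding zeq by (cases "x \<le> \<alpha>") (auto simp: norm_minus_commute)
  have "((\<lambda>x. h z - h (of_real r * cis x)) has_integral (2*pi) *\<^sub>R h z - 2 * of_real pi * h 0) {0..2*pi}"
    using has_integral_diff[OF has_integral_const_real[of "h z" 0 "2*pi"] circle_mean_value[OF hol r]] by simp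
  then have "cmod ((2*pi) *\<^sub>R h z - 2 * of_real pi * h 0) \<le> S * measure lborel {0..2*pi}"
    \<comment> \<open>The degenerate arc \<open>arc[of 0 0]\<close> supplies 0 <= S.\<close>
    by (rule has_integral_bound_real[rotated 2, where S = "{}"]) (use osc arc[of 0 0] in auto)
  then have "cmod ((2*pi) *\<^sub>R h z - 2 * of_real pi * h 0) \<le> S * (2*pi)" by simp
  moreover have "(2*pi) *\<^sub>R h z - 2 * of_real pi * h 0 = of_real (2*pi) * (h z - h 0)"
    by (simp add: scaleR_conv_of_real algebra_simps)
  ultimately have "cmod (of_real (2*pi) * (h z - h 0)) \<le> S * (2*pi)" by (simp only:)
  then have "cmod (h z - h 0) * (2*pi) \<le> S * (2*pi)"
    unfolding norm_mult norm_of_real by simp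
  then have "cmod (h z - h 0) \<le> S" by (rule mult_right_le_imp_le) simp
  then show ?thesis by (simp add: S_def r_def)
qed

text \<open>Integrate f' along each radius and exchange the two integrals. No Jacobian s appears on
  the right, which is why the comparison of means with and without the factor s precedes it. Values
  in \<open>ennreal\<close> allow the right side to be infinite.\<close>

lemma circle_integral_le_circle_int_deriv:
  assumes hol: "f holomorphic_on ball 0 1" and r: "0 \<le> r" "r < 1"
  shows "ennreal (integral {0..2*pi} (\<lambda>x. cmod (f (of_real r * cis x))))
     \<le> ennreal (2*pi * cmod (f 0)) + (\<integral>\<^sup>+s\<in>{0..<1}. ennreal (circle_int 1 (deriv f) s) \<partial>lborel)"
proof -
  have hold: "deriv f holomorphic_on ball 0 1" using hol by (intro holomorphic_deriv) auto
  have in1: "of_real s * cis x \<in> ball 0 1" if "0 \<le> s" "s \<le> r" for s x using that r by (simp add: norm_mult)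
  have contf: "continuous_on A (\<lambda>x. f (of_real r * cis x))" for A
    by (rule continuous_on_compose2[OF holomorphic_on_imp_continuous_on[OF hol]])
       (use in1 r in \<open>auto intro!: continuous_intros\<close>)
  have cont2: "continuous_on ({0..2*pi} \<times> {0..r}) (\<lambda>w. deriv f (of_real (snd w) * cis (fst w)))"
    by (rule continuous_on_compose2[OF holomorphic_on_imp_continuous_on[OF hold]])
       (use in1 in \<open>auto intro!: continuous_intros\<close>)
  have cont\<Phi>: "continuous_on (cbox (0, 0) (2*pi, r)) (\<lambda>(x, s). cmod (deriv f (of_real s * cis x)))"
    unfolding cbox_Pair_eq case_prod_unfold using cont2 by (auto intro!: continuous_intros)
  have contx: "continuous_on {0..r} (\<lambda>s. deriv f (of_real s * cis x))" for x
    by (rule continuous_on_compose2[OF holomorphic_on_imp_continuous_on[OF hold]])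
       (use in1 in \<open>auto intro!: continuous_intros\<close>)
  have rad: "cmod (f (of_real r * cis x)) \<le> cmod (f 0) + integral {0..r} (\<lambda>s. cmod (deriv f (of_real s * cis x)))" for x
  proof -
    have "((\<lambda>s. deriv f (of_real s * cis x) * cis x) has_integral (f (of_real r * cis x) - f (of_real 0 * cis x))) {0..r}"
    proof (rule fundamental_theorem_of_calculus[OF r(1)])
      fix s assume s: "s \<in> {0..r}"
      have d1: "((\<lambda>s. of_real s * cis x) has_vector_derivative cis x) (at s within {0..r})"
        by (auto intro!: derivative_eq_intros)
      have "(f has_field_derivative deriv f (of_real s * cis x)) (at (of_real s * cis x))"
        by (rule holomorphic_derivI[OF hol]) (use in1 s in auto)
      from field_vector_diff_chain_within[OF d1 DERIV_subset[OF this subset_UNIV]]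
      show "((\<lambda>s. f (of_real s * cis x)) has_vector_derivative deriv f (of_real s * cis x) * cis x) (at s within {0..r})"
        by (simp add: o_def mult_ac)
    qed
    from integral_unique[OF this]
    have "cmod (f (of_real r * cis x) - f 0) = cmod (integral {0..r} (\<lambda>s. deriv f (of_real s * cis x) * cis x))"
      by (simp only: of_real_0 mult_zero_left)
    also have "\<dots> \<le> integral {0..r} (\<lambda>s. cmod (deriv f (of_real s * cis x)))"
      by (rule Henstock_Kurzweil_Integration.integral_norm_bound_integral)
         (auto intro!: integrable_continuous_real continuous_intros contx simp: norm_mult)
    finally show ?thesis using norm_triangle_ineq2[of "f (of_real r * cis x)" "f 0"] by linarith
  qed
  have contI: "continuous_on {0..2*pi} (\<lambda>x. integral {0..r} (\<lambda>s. cmod (deriv f (of_real s * cis x))))"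
    using integral_continuous_on_param[of "cbox 0 (2*pi)" 0 r "\<lambda>x s. cmod (deriv f (of_real s * cis x))"] cont\<Phi>
    by (simp add: cbox_Pair_eq)
  have "integral {0..2*pi} (\<lambda>x. cmod (f (of_real r * cis x)))
     \<le> integral {0..2*pi} (\<lambda>x. cmod (f 0) + integral {0..r} (\<lambda>s. cmod (deriv f (of_real s * cis x))))"
    by (intro integral_le rad integrable_continuous_real continuous_intros contf contI)
  also have "\<dots> = 2*pi * cmod (f 0) + integral {0..2*pi} (\<lambda>x. integral {0..r} (\<lambda>s. cmod (deriv f (of_real s * cis x))))"
    by (subst integral_add) (auto intro!: integrable_continuous_real contI)
  also have "integral {0..2*pi} (\<lambda>x. integral {0..r} (\<lambda>s. cmod (deriv f (of_real s * cis x))))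
     = integral {0..r} (circle_int 1 (deriv f))"
    using integral_swap_continuous[OF cont\<Phi>] by (simp add: circle_int_def[abs_def])
  finally have "ennreal (integral {0..2*pi} (\<lambda>x. cmod (f (of_real r * cis x))))
     \<le> ennreal (2*pi * cmod (f 0) + integral {0..r} (circle_int 1 (deriv f)))"
    by (rule ennreal_leI)
  also have contm: "continuous_on {0..r} (circle_int 1 (deriv f))"
    unfolding circle_int_def[abs_def]
    by (rule continuous_on_subset[OF continuous_on_circle_mean[OF hold]]) (use r in auto)
  have "ennreal (2*pi * cmod (f 0) + integral {0..r} (circle_int 1 (deriv f)))
     = ennreal (2*pi * cmod (f 0)) + ennreal (integral {0..r} (circle_int 1 (deriv f)))"
    using contm by (intro ennreal_plus integral_nonneg integrable_continuous_real) (auto simp: circle_int_nonneg)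
  also have "ennreal (integral {0..r} (circle_int 1 (deriv f))) = (\<integral>\<^sup>+s\<in>{0..<r}. ennreal (circle_int 1 (deriv f) s) \<partial>lborel)"
    by (rule nn_integral_continuous_eq_integral[symmetric]) (auto simp: circle_int_nonneg contm)
  also have "\<dots> \<le> (\<integral>\<^sup>+s\<in>{0..<1}. ennreal (circle_int 1 (deriv f) s) \<partial>lborel)"
    using r by (intro nn_integral_mono) (auto split: split_indicator)
  finally show ?thesis by (simp add: add_left_mono)
qed

lemma identity_in_T_Hinf_if_id_bounded:
  assumes "id_bounded_into_D10 p \<omega>"
  shows "(\<lambda>z. z) \<in> T_Hinf p \<omega>"
proof -
  obtain C where C: "\<And>f. f \<in> D_space p \<omega> \<Longrightarrow> f \<in> D_space 1 (std_weight 0)"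
      "\<And>f. f \<in> D_space p \<omega> \<Longrightarrow> D_norm 1 (std_weight 0) f \<le> C * D_norm p \<omega> f"
    using assms unfolding id_bounded_into_D10_def by blast
  have "cmod (T_op (\<lambda>z. z) f z) \<le> (2 * pi * C) * D_norm p \<omega> f" if f: "f \<in> D_space p \<omega>" and z: "z \<in> disc" for f z
  proof -
    have hol: "f holomorphic_on ball 0 1" using f by (simp add: D_space_def disc_def)
    have hold: "deriv f holomorphic_on ball 0 1" using hol by (intro holomorphic_deriv) auto
    obtain h where h: "\<And>x. x \<in> ball 0 1 \<Longrightarrow> (h has_field_derivative f x) (at x)"
      using holomorphic_convex_primitive'[OF convex_ball open_ball hol] by (auto simp: at_within_open[of _ "ball 0 1"])
    have z1: "cmod z < 1" using z by (simp add: disc_def)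
    have seg: "closed_segment 0 z \<subseteq> ball 0 1"
      using z1 by (intro closed_segment_subset) auto
    have holh: "h holomorphic_on ball 0 1"
      unfolding holomorphic_on_open[OF open_ball] using h by blast
    have dh: "deriv h x = f x" if "x \<in> ball 0 1" for x by (rule DERIV_imp_deriv[OF h[OF that]])
    have "(f has_contour_integral (h (pathfinish (linepath 0 z)) - h (pathstart (linepath 0 z)))) (linepath 0 z)"
    proof (rule contour_integral_primitive[where S = "ball 0 1"])
      show "(h has_field_derivative f x) (at x within ball 0 1)" if "x \<in> ball 0 1" for x
        using h[OF that] by (rule has_field_derivative_at_within)
      show "path_image (linepath 0 z) \<subseteq> ball 0 1"
        using seg by (simp only: path_image_linepath)
    qed (rule valid_path_linepath)
    from contour_integral_unique[OF this] have "T_op (\<lambda>z. z) f z = h z - h 0"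
      unfolding T_op_def by (simp only: deriv_ident mult_1_right pathstart_linepath pathfinish_linepath)
    then have "cmod (T_op (\<lambda>z. z) f z) \<le> integral {0..2*pi} (\<lambda>x. cmod (deriv h (of_real (cmod z) * cis x)))"
      using primitive_le_circle_integral[OF holh z1] by simp
    also have "\<dots> = integral {0..2*pi} (\<lambda>x. cmod (f (of_real (cmod z) * cis x)))"
      using z1 by (intro integral_cong) (simp add: dh norm_mult)
    finally have "ennreal (cmod (T_op (\<lambda>z. z) f z)) \<le> ennreal (integral {0..2*pi} (\<lambda>x. cmod (f (of_real (cmod z) * cis x))))"
      by (rule ennreal_leI)
    also have "\<dots> \<le> ennreal (2*pi * cmod (f 0)) + (\<integral>\<^sup>+s\<in>{0..<1}. ennreal (circle_int 1 (deriv f) s) \<partial>lborel)"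
      by (rule circle_integral_le_circle_int_deriv[OF hol _ z1]) simp
    also have "\<dots> \<le> ennreal (2*pi * cmod (f 0)) + 2 * (\<integral>\<^sup>+s\<in>{0..<1}. ennreal (circle_int 1 (deriv f) s) * ennreal s \<partial>lborel)"
      by (intro add_left_mono nn_integral_circle_int_le[OF hold])
    also have "(\<integral>\<^sup>+s\<in>{0..<1}. ennreal (circle_int 1 (deriv f) s) * ennreal s \<partial>lborel) = ennreal pi * D_int 1 (std_weight 0) f"
      using hol by (simp add: D_int_unweighted disc_def ennreal_times_divide ennreal_mult_divide_eq mult.commute[of "ennreal pi"])
    also have "D_int 1 (std_weight 0) f = ennreal (enn2real (D_int 1 (std_weight 0) f))"
      using C(1)[OF f] by (simp add: D_space_def less_top)
    \<comment> \<open>The 2 from dropping the Jacobian and the pi from normalising area combine to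
      the same 2 pi that stands before |f(0)|, so the D^1_0 norm appears exactly.\<close>
    also have "ennreal (2*pi * cmod (f 0)) + 2 * (ennreal pi * ennreal (enn2real (D_int 1 (std_weight 0) f)))
       = ennreal (2 * pi * (cmod (f 0) + enn2real (D_int 1 (std_weight 0) f)))"
    proof -
      have "2 * (ennreal pi * ennreal (enn2real (D_int 1 (std_weight 0) f))) = ennreal (2 * (pi * enn2real (D_int 1 (std_weight 0) f)))"
        by (simp add: ennreal_mult')
      then show ?thesis by (simp add: ennreal_plus[symmetric] distrib_left mult.assoc del: ennreal_plus)
    qed
    also have "cmod (f 0) + enn2real (D_int 1 (std_weight 0) f) = D_norm 1 (std_weight 0) f"
      by (simp add: D_norm_def add_nonneg_nonneg add.commute)
    finally have "cmod (T_op (\<lambda>z. z) f z) \<le> 2 * pi * D_norm 1 (std_weight 0) f"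
      by (simp add: ennreal_le_iff D_norm_def)
    also have "\<dots> \<le> 2 * pi * (C * D_norm p \<omega> f)"
      using C(2)[OF f] by (intro mult_left_mono) auto
    finally show ?thesis by (simp add: mult.assoc)
  qed
  then show ?thesis unfolding T_Hinf_def by (auto intro!: holomorphic_intros)
qed

lemma not_T_Hinf_constant_if_id_bounded:
  assumes "id_bounded_into_D10 p \<omega>"
  shows "\<not> T_Hinf p \<omega> \<subseteq> {g. \<exists>c. \<forall>z\<in>disc. g z = c}"
proof
  assume "T_Hinf p \<omega> \<subseteq> {g. \<exists>c. \<forall>z\<in>disc. g z = c}"
  then obtain c where c: "\<forall>z\<in>disc. z = c"
    using identity_in_T_Hinf_if_id_bounded[OF assms] by blast
  have "(0::complex) \<in> disc" "(1/2::complex) \<in> disc" by (auto simp: disc_def)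
  then have "0 = c" "1/2 = c" using c by blast+
  then show False by simp
qed

section \<open>The embedding\<close>

text \<open>After translation to the centre, the circle mean at radius 0 is at most that at every
  radius s; integrating this against s ds gives the area form.\<close>

lemma nn_integral_ball_ge_submean:
  assumes hol: "F holomorphic_on ball z R" and p: "0 < p" "p \<le> 2" and d: "0 < d" "d < R"
  shows "ennreal (pi * d\<^sup>2 * cmod (F z) powr p) \<le> (\<integral>\<^sup>+w\<in>ball z d. ennreal (cmod (F w) powr p) \<partial>lborel)"
proof -
  define G where "G = (\<lambda>w. F (z + w))"
  have "(+) z ` ball 0 R = ball z R" by simp
  then have holG: "G holomorphic_on ball 0 R"
    unfolding G_def
    by (intro holomorphic_on_compose_gen[OF _ hol, unfolded o_def] holomorphic_intros) auto
  define H where "H = (\<lambda>w. ennreal (indicator (ball 0 d) w *\<^sub>R (cmod (G w) powr p)))"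
  have contG: "continuous_on (ball 0 d) G"
    by (rule continuous_on_subset[OF holomorphic_on_imp_continuous_on[OF holG]]) (use d in auto)
  have [measurable]: "(\<lambda>w. indicator (ball 0 d) w *\<^sub>R (cmod (G w) powr p)) \<in> borel_measurable borel"
    using p contG by (intro borel_measurable_continuous_on_indicator continuous_on_powr' continuous_intros) auto
  have [measurable]: "H \<in> borel_measurable borel" unfolding H_def by measurable
  have "(\<integral>\<^sup>+s\<in>{0..d}. ennreal (2 * pi * cmod (F z) powr p * s) \<partial>lborel)
      = ennreal (pi * cmod (F z) powr p * d\<^sup>2 - pi * cmod (F z) powr p * 0\<^sup>2)"
    using d by (intro nn_integral_FTC_Icc) (auto intro!: derivative_eq_intros)
  then have "ennreal (pi * d\<^sup>2 * cmod (F z) powr p) = (\<integral>\<^sup>+s\<in>{0..d}. ennreal (2 * pi * cmod (F z) powr p * s) \<partial>lborel)"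
    by (simp add: mult_ac)
  also have "\<dots> = (\<integral>\<^sup>+s\<in>{0..<d}. ennreal (2 * pi * cmod (F z) powr p * s) \<partial>lborel)"
    using AE_lborel_singleton[of d]
    by (intro nn_integral_cong_AE, eventually_elim) (auto split: split_indicator)
  also have "\<dots> \<le> (\<integral>\<^sup>+s\<in>{0..}. (\<integral>\<^sup>+x\<in>{0..<2*pi}. H (of_real s * cis x) \<partial>lborel) * ennreal s \<partial>lborel)"
  proof (intro nn_integral_mono)
    fix s :: real
    show "ennreal (2 * pi * cmod (F z) powr p * s) * indicator {0..<d} s
       \<le> (\<integral>\<^sup>+x\<in>{0..<2*pi}. H (of_real s * cis x) \<partial>lborel) * ennreal s * indicator {0..} s"
    proof (cases "0 \<le> s \<and> s < d")
      case True
      have "2 * pi * cmod (F z) powr p = circle_int p G 0"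
        by (simp add: circle_int_def G_def)
      also have "\<dots> \<le> circle_int p G s"
        using True d by (intro circle_int_mono[OF holG p]) auto
      finally have "ennreal (2 * pi * cmod (F z) powr p) * ennreal s \<le> ennreal (circle_int p G s) * ennreal s"
        by (intro mult_right_mono ennreal_leI) auto
      also have "ennreal (circle_int p G s) = (\<integral>\<^sup>+x\<in>{0..<2*pi}. ennreal (cmod (G (of_real s * cis x)) powr p) \<partial>lborel)"
        using True d by (intro nn_integral_circle_int[OF holG p(1), symmetric]) auto
      also have "\<dots> = (\<integral>\<^sup>+x\<in>{0..<2*pi}. H (of_real s * cis x) \<partial>lborel)"
        using True by (intro nn_integral_cong) (simp add: H_def norm_mult)
      finally show ?thesis using True by (simp add: ennreal_mult')
    qed simp
  qed
  also have "\<dots> = (\<integral>\<^sup>+w. H w \<partial>lborel)"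
    by (rule nn_integral_lborel_polar[symmetric]) measurable
  also have "\<dots> = (\<integral>\<^sup>+w. H (w - z) \<partial>lborel)"
  proof -
    have "(\<integral>\<^sup>+w. H (w - z) \<partial>lborel) = (\<integral>\<^sup>+w. H (w - z) \<partial>distr lborel borel ((+) z))"
      by (simp only: lborel_distr_plus)
    also have "\<dots> = (\<integral>\<^sup>+w. H w \<partial>lborel)"
      by (subst nn_integral_distr) auto
    finally show ?thesis by simp
  qed
  also have "\<dots> = (\<integral>\<^sup>+w\<in>ball z d. ennreal (cmod (F w) powr p) \<partial>lborel)"
    by (intro nn_integral_cong) (auto simp: H_def G_def dist_norm norm_minus_commute split: split_indicator)
  finally show ?thesis .
qed

text \<open>Every circle of the annulus has a mean at most that at \<open>b\<close>, and the
  Jacobian is at most 1. The gain is the thickness b - a.\<close>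

lemma nn_integral_annulus_le:
  assumes hol: "F holomorphic_on ball 0 R" and p: "0 < p" "p \<le> 2" and ab: "0 \<le> a" "a \<le> b" "b < R" "b \<le> 1"
  shows "(\<integral>\<^sup>+w\<in>{w. a \<le> cmod w \<and> cmod w < b}. ennreal (cmod (F w) powr p) \<partial>lborel)
     \<le> ennreal ((b - a) * circle_int p F b)"
proof -
  define S where "S = {w. a \<le> cmod w \<and> cmod w < b}"
  have [measurable]: "S \<in> sets borel" unfolding S_def by measurable
  define H where "H = (\<lambda>w. ennreal (indicator S w *\<^sub>R (cmod (F w) powr p)))"
  have contF: "continuous_on S F"
    by (rule continuous_on_subset[OF holomorphic_on_imp_continuous_on[OF hol]]) (use ab in \<open>auto simp: S_def\<close>)
  have [measurable]: "(\<lambda>w. indicator S w *\<^sub>R (cmod (F w) powr p)) \<in> borel_measurable borel"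
    using p contF by (intro borel_measurable_continuous_on_indicator continuous_on_powr' continuous_intros) auto
  have [measurable]: "H \<in> borel_measurable borel" unfolding H_def by measurable
  have "(\<integral>\<^sup>+w\<in>S. ennreal (cmod (F w) powr p) \<partial>lborel) = (\<integral>\<^sup>+w. H w \<partial>lborel)"
    by (intro nn_integral_cong) (auto simp: H_def split: split_indicator)
  also have "\<dots> = (\<integral>\<^sup>+s\<in>{0..}. (\<integral>\<^sup>+x\<in>{0..<2*pi}. H (of_real s * cis x) \<partial>lborel) * ennreal s \<partial>lborel)"
    by (rule nn_integral_lborel_polar) measurable
  also have "\<dots> \<le> (\<integral>\<^sup>+s. ennreal (circle_int p F b) * indicator {a..b} s \<partial>lborel)"
  proof (intro nn_integral_mono)
    fix s :: real
    show "(\<integral>\<^sup>+x\<in>{0..<2*pi}. H (of_real s * cis x) \<partial>lborel) * ennreal s * indicator {0..} s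
       \<le> ennreal (circle_int p F b) * indicator {a..b} s"
    proof (cases "a \<le> s \<and> s < b")
      case True
      then have s: "0 \<le> s" "s < R" "s \<le> 1" using ab by auto
      have "(\<integral>\<^sup>+x\<in>{0..<2*pi}. H (of_real s * cis x) \<partial>lborel) = (\<integral>\<^sup>+x\<in>{0..<2*pi}. ennreal (cmod (F (of_real s * cis x)) powr p) \<partial>lborel)"
        using True s by (intro nn_integral_cong) (simp add: H_def S_def norm_mult)
      also have "\<dots> = ennreal (circle_int p F s)"
        by (rule nn_integral_circle_int[OF hol p(1) s(1,2)])
      also have "ennreal (circle_int p F s) * ennreal s \<le> ennreal (circle_int p F b) * ennreal 1"
        using True s ab by (intro mult_mono ennreal_leI circle_int_mono[OF hol p]) auto
      finally show ?thesis using True s by simp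
    next
      case False
      have "H (of_real s * cis x) * indicator {0..<2*pi} x = 0" if "0 \<le> s" for x
        using False that by (auto simp: H_def S_def norm_mult)
      then have "(\<integral>\<^sup>+x\<in>{0..<2*pi}. H (of_real s * cis x) \<partial>lborel) = (\<integral>\<^sup>+(x::real). 0 \<partial>lborel)" if "0 \<le> s"
        using that by (intro nn_integral_cong) blast
      then show ?thesis by (simp split: split_indicator)
    qed
  qed
  also have "\<dots> = ennreal (circle_int p F b) * ennreal (b - a)"
    using ab by (simp add: nn_integral_cmult_indicator)
  also have "\<dots> = ennreal ((b - a) * circle_int p F b)"
    using ab by (simp add: ennreal_mult' mult.commute)
  finally show ?thesis by (simp add: S_def)
qed

text \<open>The ball of radius d = (1-|z|)/2 about z is enlarged to the annulus of thickness at most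
  2d that contains it. Dividing 2d by the area pi d^2 loses only one power of 1 - |z|, with constant
  2/(pi d) = 4/(pi (1-|z|)).\<close>

lemma pointwise_le_circle_int:
  assumes hol: "F holomorphic_on ball 0 1" and p: "0 < p" "p \<le> 2" and z: "cmod z < 1"
  shows "cmod (F z) powr p \<le> 4 / (pi * (1 - cmod z)) * circle_int p F ((1 + cmod z) / 2)"
proof -
  define r where "r = cmod z"
  define d where "d = (1 - r) / 2"
  have r: "0 \<le> r" "r < 1" using z by (auto simp: r_def)
  have d: "0 < d" "r + d = (1 + r) / 2" "r + d < 1" using r by (auto simp: d_def field_simps)
  have sub: "ball z (1 - r) \<subseteq> ball 0 1"
  proof
    fix w assume "w \<in> ball z (1 - r)"
    then show "w \<in> ball 0 1" using norm_triangle_ineq2[of w z] by (simp add: r_def dist_norm norm_minus_commute)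
  qed
  have "ennreal (pi * d\<^sup>2 * cmod (F z) powr p) \<le> (\<integral>\<^sup>+w\<in>ball z d. ennreal (cmod (F w) powr p) \<partial>lborel)"
    by (rule nn_integral_ball_ge_submean[OF holomorphic_on_subset[OF hol sub] p d(1)]) (use r in \<open>simp add: d_def\<close>)
  also have "\<dots> \<le> (\<integral>\<^sup>+w\<in>{w. max 0 (r - d) \<le> cmod w \<and> cmod w < r + d}. ennreal (cmod (F w) powr p) \<partial>lborel)"
  proof (intro nn_integral_mono mult_left_mono)
    fix w
    have "max 0 (r - d) \<le> cmod w \<and> cmod w < r + d" if "w \<in> ball z d"
      using that norm_triangle_ineq2[of w z] norm_triangle_ineq2[of z w]
      by (auto simp: r_def dist_norm norm_minus_commute)
    then show "indicator (ball z d) w \<le> (indicator {w. max 0 (r - d) \<le> cmod w \<and> cmod w < r + d} w :: ennreal)"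
      by (auto simp: indicator_def)
  qed simp
  also have "\<dots> \<le> ennreal ((r + d - max 0 (r - d)) * circle_int p F (r + d))"
    using r d by (intro nn_integral_annulus_le[OF hol p]) auto
  also have "\<dots> \<le> ennreal (2 * d * circle_int p F (r + d))"
    using d r by (intro ennreal_leI mult_right_mono circle_int_nonneg) auto
  finally have "pi * d\<^sup>2 * cmod (F z) powr p \<le> 2 * d * circle_int p F (r + d)"
    using d(1) circle_int_nonneg[of p F "r + d"] by (simp add: ennreal_le_iff)
  then have "d * (pi * d * cmod (F z) powr p) \<le> d * (2 * circle_int p F (r + d))"
    by (simp add: power2_eq_square mult_ac)
  then have "pi * d * cmod (F z) powr p \<le> 2 * circle_int p F (r + d)"
    using d(1) by (simp only: mult_le_cancel_left_pos)
  then have "cmod (F z) powr p \<le> 2 * circle_int p F (r + d) / (pi * d)"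
    using d(1) by (simp add: pos_le_divide_eq mult_ac)
  also have "2 * circle_int p F (r + d) / (pi * d) = 4 / (pi * (1 - r)) * circle_int p F ((1 + r) / 2)"
    unfolding d(2) by (simp add: d_def)
  finally show ?thesis by (simp add: r_def)
qed

section \<open>Consequences of a bounded ratio\<close>

text \<open>Continuity from above of the finite measure with density \<omega>, along end segments
  shrinking to the empty set. This is what forces p > 1/2 below.\<close>

lemma omega_hat_tendsto_0:
  assumes rw: "radial_weight \<omega>" and e: "0 < e"
  shows "\<exists>r\<in>{0..<1}. omega_hat \<omega> r < e"
proof -
  define N where "N = density lborel (\<lambda>s. ennreal (indicator {0..<1} s * \<omega> s))"
  have m[measurable]: "(\<lambda>s. indicator {0..<1} s * \<omega> s) \<in> borel_measurable borel"
    using rw by (auto simp: radial_weight_def set_integrable_def)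
  define A where "A = (\<lambda>n. {1 - 1 / real (Suc n)..<1})"
  have in01: "0 \<le> 1 - 1 / real (Suc n)" "1 - 1 / real (Suc n) < 1" for n by (auto simp: field_simps)
  have A01: "0 \<le> s \<and> s < 1" if "s \<in> A n" for s n
    using that in01(1)[of n] unfolding A_def by (meson atLeastLessThan_iff order_trans)
  have em: "emeasure N (A n) = ennreal (omega_hat \<omega> (1 - 1 / real (Suc n)))" for n
  proof -
    have "emeasure N (A n) = (\<integral>\<^sup>+s. ennreal (indicator {0..<1} s * \<omega> s) * indicator (A n) s \<partial>lborel)"
      unfolding N_def by (rule emeasure_density) (auto simp: A_def)
    also have "\<dots> = (\<integral>\<^sup>+s\<in>A n. ennreal (\<omega> s) \<partial>lborel)"
      by (intro nn_integral_cong) (use A01 in \<open>auto split: split_indicator\<close>)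
    finally show ?thesis unfolding A_def using omega_hat_nn_integral[OF rw in01(1)[of n]] by simp
  qed
  have dec: "decseq A"
    unfolding decseq_def A_def
  proof (intro allI impI)
    fix i j :: nat assume "i \<le> j"
    then have "1 / real (Suc j) \<le> 1 / real (Suc i)" by (intro divide_left_mono) auto
    then show "{1 - 1 / real (Suc j)..<1} \<subseteq> {1 - 1 / real (Suc i)..<1}" by auto
  qed
  have INT: "(\<Inter>n. A n) = {}"
  proof (rule ccontr)
    assume "(\<Inter>n. A n) \<noteq> {}"
    then obtain s where s: "\<And>n. s \<in> A n" by auto
    then have "0 < 1 - s" using s[of 0] by (simp add: A_def)
    then obtain n where "inverse (real (Suc n)) < 1 - s" using reals_Archimedean by blast
    then show False using s[of n] by (simp add: A_def inverse_eq_divide)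
  qed
  have "range A \<subseteq> sets N" by (auto simp: A_def N_def)
  from Lim_emeasure_decseq[OF this dec] have "(\<lambda>n. emeasure N (A n)) \<longlonglongrightarrow> 0"
    by (simp add: em INT)
  then have "eventually (\<lambda>n. emeasure N (A n) < ennreal e) sequentially"
    using e by (intro order_tendstoD(2)) auto
  then obtain n where "emeasure N (A n) < ennreal e" by (auto simp: eventually_sequentially)
  then have "omega_hat \<omega> (1 - 1 / real (Suc n)) < e"
    using omega_hat_pos[OF rw in01[of n]] by (simp add: em ennreal_less_iff)
  then show ?thesis using in01[of n] by (intro bexI[of _ "1 - 1 / real (Suc n)"]) auto
qed

text \<open>The p-th power of the ratio bound has exponent p (2 - 1/p) = 2p - 1. Were this not
  positive, the left side would stay at least 1 while the tail tends to 0.\<close>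

lemma ratio_bounded_imp_lower_bound:
  assumes p: "0 < p" and rw: "radial_weight \<omega>" and rb: "ratio_bounded p \<omega>"
  obtains L where "0 < L" "\<And>r. 0 \<le> r \<Longrightarrow> r < 1 \<Longrightarrow> (1 - r) powr (2 * p - 1) \<le> L * omega_hat \<omega> r"
    and "1/2 < p"
proof -
  obtain M where M: "\<forall>r\<in>{0..<1}. (1 - r) powr (2 - 1/p) / omega_hat \<omega> r powr (1/p) \<le> M"
    using rb unfolding ratio_bounded_def by blast
  define L where "L = (max M 1) powr p"
  have L: "0 < L" by (simp add: L_def)
  have bd: "(1 - r) powr (2 * p - 1) \<le> L * omega_hat \<omega> r" if r: "0 \<le> r" "r < 1" for r
  proof -
    have w: "0 < omega_hat \<omega> r" by (rule omega_hat_pos[OF rw r])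
    have "(1 - r) powr (2 - 1/p) / omega_hat \<omega> r powr (1/p) \<le> max M 1"
      using M r by (simp add: le_max_iff_disj)
    then have "(1 - r) powr (2 - 1/p) \<le> max M 1 * omega_hat \<omega> r powr (1/p)"
      using w by (simp add: pos_divide_le_eq)
    then have "((1 - r) powr (2 - 1/p)) powr p \<le> (max M 1 * omega_hat \<omega> r powr (1/p)) powr p"
      using p by (intro powr_mono2) auto
    then show ?thesis
      using p w by (simp add: powr_powr powr_mult L_def left_diff_distrib)
  qed
  have "1/2 < p"
  proof (rule ccontr)
    assume np: "\<not> 1/2 < p"
    obtain r where r: "0 \<le> r" "r < 1" "omega_hat \<omega> r < 1 / L"
      using omega_hat_tendsto_0[OF rw, of "1 / L"] L by auto
    have "1 powr (2 * p - 1) \<le> (1 - r) powr (2 * p - 1)"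
      using np r by (intro powr_mono2') auto
    also have "\<dots> \<le> L * omega_hat \<omega> r" by (rule bd[OF r(1,2)])
    also have "\<dots> < 1" using r(3) L by (simp add: field_simps)
    finally show False by simp
  qed
  with L bd show thesis by (rule that)
qed

lemma nn_integral_one_minus_powr:
  assumes a: "-1 < a" and t: "t < 1"
  shows "(\<integral>\<^sup>+s\<in>{t..<1}. ennreal ((1 - s) powr a) \<partial>lborel) = ennreal ((1 - t) powr (a + 1) / (a + 1))"
proof -
  have "(\<integral>\<^sup>+s\<in>{t..<1}. ennreal ((1 - s) powr a) \<partial>lborel) = (\<integral>\<^sup>+x. ennreal ((1 - (1 + (-1) * x)) powr a) * indicator {t..<1} (1 + (-1) * x) \<partial>lborel)"
    using nn_integral_real_affine[of "\<lambda>s. ennreal ((1 - s) powr a) * indicator {t..<1} s" "-1" 1] by simp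
  also have "\<dots> = (\<integral>\<^sup>+x. ennreal (indicator {0..1 - t} x * x powr a) \<partial>lborel)"
    using AE_lborel_singleton[of 0]
    by (intro nn_integral_cong_AE, eventually_elim) (auto split: split_indicator)
  also have "\<dots> = ennreal ((1 - t) powr (a + 1) / (a + 1))"
  proof (rule nn_integral_has_integral_lborel)
    have "(\<lambda>x. indicator {0..1 - t} x * x powr a) = (\<lambda>x. if x \<in> {0..1 - t} then x powr a else 0)"
      by (auto simp: indicator_def)
    then show "((\<lambda>x. indicator {0..1 - t} x * x powr a) has_integral (1 - t) powr (a + 1) / (a + 1)) UNIV"
      using has_integral_powr_from_0[OF a, of "1 - t"] t by (simp only: has_integral_restrict_UNIV)
  qed auto
  finally show ?thesis .
qed

lemma id_bounded_if_ratio_bounded: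
  assumes p: "0 < p" "p < 1" and rw: "radial_weight \<omega>" and rb: "ratio_bounded p \<omega>"
  shows "id_bounded_into_D10 p \<omega>"
proof -
  obtain L where L: "0 < L" "\<And>r. 0 \<le> r \<Longrightarrow> r < 1 \<Longrightarrow> (1 - r) powr (2 * p - 1) \<le> L * omega_hat \<omega> r" and p2: "1/2 < p"
    using ratio_bounded_imp_lower_bound[OF p(1) rw rb] by blast
  have om: "0 \<le> \<omega> s" if "0 \<le> s" "s < 1" for s using rw that by (auto simp: radial_weight_def)
  have mw[measurable]: "(\<lambda>s. indicator {0..<1} s * \<omega> s) \<in> borel_measurable borel"
    using rw by (auto simp: radial_weight_def set_integrable_def)
  have w0: "0 < omega_hat \<omega> 0" "0 < omega_hat \<omega> (1/2)" by (auto intro: omega_hat_pos[OF rw])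
  \<comment> \<open>In polar coordinates the weight carries the Jacobian s, which is at least 1/2
    here.\<close>
  have half: "ennreal (omega_hat \<omega> t / 2) \<le> (\<integral>\<^sup>+s\<in>{t..<1}. ennreal (\<omega> s * s) \<partial>lborel)" if t: "1/2 \<le> t" "t < 1" for t
  proof -
    define h :: real where "h = 1/2"
    have h0: "0 \<le> h" by (simp add: h_def)
    have "ennreal (omega_hat \<omega> t / 2) = ennreal (h * omega_hat \<omega> t)" by (simp add: h_def)
    also have "\<dots> = ennreal h * ennreal (omega_hat \<omega> t)" using h0 by (rule ennreal_mult')
    also have "\<dots> = ennreal h * (\<integral>\<^sup>+s\<in>{t..<1}. ennreal (\<omega> s) \<partial>lborel)"
      using t by (simp add: omega_hat_nn_integral[OF rw])
    also have "\<dots> = (\<integral>\<^sup>+s. ennreal h * (ennreal (\<omega> s) * indicator {t..<1} s) \<partial>lborel)"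
    proof (rule nn_integral_cmult[symmetric])
      have "(\<lambda>s. ennreal (indicator {0..<1} s * \<omega> s) * indicator {t..<1} s) \<in> borel_measurable lborel" by measurable
      then show "(\<lambda>s. ennreal (\<omega> s) * indicator {t..<1} s) \<in> borel_measurable lborel"
        by (rule measurable_cong[THEN iffD1, rotated]) (use t in \<open>auto split: split_indicator\<close>)
    qed
    also have "\<dots> \<le> (\<integral>\<^sup>+s\<in>{t..<1}. ennreal (\<omega> s * s) \<partial>lborel)"
    proof (intro nn_integral_mono)
      fix s :: real
      have "ennreal h * ennreal (\<omega> s) \<le> ennreal (\<omega> s * s)" if "t \<le> s" "s < 1"
      proof -
        have "\<omega> s * h \<le> \<omega> s * s" using om[of s] that t by (intro mult_left_mono) (auto simp: h_def)
        then show ?thesis using h0 by (simp add: ennreal_mult'[symmetric] ennreal_leI mult.commute)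
      qed
      then show "ennreal h * (ennreal (\<omega> s) * indicator {t..<1} s) \<le> ennreal (\<omega> s * s) * indicator {t..<1} s"
        by (auto simp: mult.assoc[symmetric] split: split_indicator)
    qed
    finally show ?thesis .
  qed
  \<comment> \<open>Extends the comparison to t < 1/2: there the tail is at most
    \<open>omega_hat \<omega> 0\<close>, while the weighted tail is at least half of
    \<open>omega_hat \<omega> (1/2)\<close>.\<close>
  define c where "c = omega_hat \<omega> (1/2) / (2 * omega_hat \<omega> 0)"
  have c: "0 < c" "c \<le> 1/2"
    using w0 omega_hat_antimono[OF rw, of 0 "1/2"] by (auto simp: c_def field_simps)
  have tailw: "ennreal (c * omega_hat \<omega> t) \<le> (\<integral>\<^sup>+s\<in>{t..<1}. ennreal (\<omega> s * s) \<partial>lborel)" if t: "0 \<le> t" "t < 1" for t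
  proof (cases "1/2 \<le> t")
    case True
    have "c * omega_hat \<omega> t \<le> 1/2 * omega_hat \<omega> t"
      using c omega_hat_pos[OF rw t] by (intro mult_right_mono) auto
    then have "ennreal (c * omega_hat \<omega> t) \<le> ennreal (omega_hat \<omega> t / 2)" by (intro ennreal_leI) simp
    then show ?thesis using half[OF True t(2)] by (rule order_trans)
  next
    case False
    have "c * omega_hat \<omega> t \<le> c * omega_hat \<omega> 0"
      using c t by (intro mult_left_mono omega_hat_antimono[OF rw]) auto
    also have "\<dots> = omega_hat \<omega> (1/2) / 2" using w0 by (simp add: c_def)
    finally have "ennreal (c * omega_hat \<omega> t) \<le> ennreal (omega_hat \<omega> (1/2) / 2)" by (rule ennreal_leI)
    also have "\<dots> \<le> (\<integral>\<^sup>+s\<in>{1/2..<1}. ennreal (\<omega> s * s) \<partial>lborel)" by (rule half) auto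
    also have "\<dots> \<le> (\<integral>\<^sup>+s\<in>{t..<1}. ennreal (\<omega> s * s) \<partial>lborel)"
      using False by (intro nn_integral_mono) (auto split: split_indicator)
    finally show ?thesis .
  qed
  define v where "v = (\<lambda>s::real. (1 - s) powr (2 * p - 2))"
  define K where "K = L / ((2 * p - 1) * c)"
  have K: "0 < K" using L c p2 by (simp add: K_def)
  have tails: "(\<integral>\<^sup>+s\<in>{t..<1}. ennreal (v s) \<partial>lborel) \<le> ennreal K * (\<integral>\<^sup>+s\<in>{t..<1}. ennreal (\<omega> s * s) \<partial>lborel)"
    if t: "0 \<le> t" "t < 1" for t
  proof -
    have "(\<integral>\<^sup>+s\<in>{t..<1}. ennreal (v s) \<partial>lborel) = ennreal ((1 - t) powr (2 * p - 1) / (2 * p - 1))"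
      using nn_integral_one_minus_powr[of "2 * p - 2" t] p2 t by (simp add: v_def)
    also have "\<dots> \<le> ennreal (K * (c * omega_hat \<omega> t))"
      using L(2)[OF t] p2 c by (intro ennreal_leI) (simp add: K_def divide_right_mono)
    also have "\<dots> = ennreal K * ennreal (c * omega_hat \<omega> t)"
      using K by (simp add: ennreal_mult')
    also have "\<dots> \<le> ennreal K * (\<integral>\<^sup>+s\<in>{t..<1}. ennreal (\<omega> s * s) \<partial>lborel)"
      by (intro mult_left_mono tailw t) simp
    finally show ?thesis .
  qed
  \<comment> \<open>4/pi from the pointwise bound, 2 pi from \<open>growth\<close>, \<open>L\<close>
    from the tail bound, and 2^(2p-1) because 1 - s is half of 1 - |z|.\<close>
  define C1 where "C1 = 8 * L * 2 powr (2 * p - 1)"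
  have C1: "0 < C1" using L by (simp add: C1_def)
  \<comment> \<open>Then p e = 1 - p, so |F| is |F|^p times the e-th power of |F|^p, and
    (1-|z|)^(-2p) raised to \<open>e\<close> is the weight \<open>v\<close>.\<close>
  define e where "e = (1 - p) / p"
  have e: "0 < e" using p by (simp add: e_def)
  define C2 where "C2 = C1 powr e * K"
  have C2: "0 < C2" using C1 K by (simp add: C2_def)
  have main: "D_int 1 (std_weight 0) f \<le> ennreal (C2 * enn2real (D_int p \<omega> f) powr (1/p))" if f: "f \<in> D_space p \<omega>" for f
  proof -
    have hol: "f holomorphic_on disc" and fin: "D_int p \<omega> f < \<infinity>" using f by (auto simp: D_space_def)
    define F where "F = deriv f"
    have holF: "F holomorphic_on ball 0 1" using hol unfolding F_def by (intro holomorphic_deriv) (auto simp: disc_def)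
    define m where "m = circle_int p F"
    have m0: "0 \<le> m r" for r by (simp add: m_def circle_int_nonneg)
    have mono: "m r \<le> m s" if "0 \<le> r" "r \<le> s" "s < 1" for r s
      unfolding m_def using that p by (intro circle_int_mono[OF holF]) auto
    have mm: "(\<lambda>s. indicator {0..<1} s * m s) \<in> borel_measurable borel"
      unfolding m_def by (rule circle_int_measurable[OF holF p(1)])
    define X where "X = enn2real (D_int p \<omega> f)"
    have X0: "0 \<le> X" by (simp add: X_def)
    define Y where "Y = (\<integral>\<^sup>+s\<in>{0..<1}. ennreal (m s) * ennreal (\<omega> s * s) \<partial>lborel)"
    have "D_int p \<omega> f = Y / ennreal pi"
      unfolding Y_def m_def F_def by (rule D_int_circle_int[OF hol p(1) om mw])
    then have "Y = D_int p \<omega> f * ennreal pi"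
      by (simp add: ennreal_divide_times ennreal_mult_divide_eq)
    also have "D_int p \<omega> f = ennreal X" using fin by (simp add: X_def less_top)
    finally have Y: "Y = ennreal (X * pi)" by (simp add: ennreal_mult'')
    \<comment> \<open>A Chebyshev argument: \<open>m\<close> is at least \<open>m r\<close> on [r,
      1). It will be used at the radius (1+|z|)/2, which always satisfies the restriction r >=
      1/2.\<close>
    have growth: "m r * omega_hat \<omega> r \<le> 2 * pi * X" if r: "1/2 \<le> r" "r < 1" for r
    proof -
      have "ennreal (m r * (omega_hat \<omega> r / 2)) = ennreal (m r) * ennreal (omega_hat \<omega> r / 2)"
        by (rule ennreal_mult'[OF m0])
      also have "\<dots> \<le> ennreal (m r) * (\<integral>\<^sup>+s\<in>{r..<1}. ennreal (\<omega> s * s) \<partial>lborel)"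
        by (intro mult_left_mono half r) simp
      also have "\<dots> = (\<integral>\<^sup>+s. ennreal (m r) * (ennreal (\<omega> s * s) * indicator {r..<1} s) \<partial>lborel)"
      proof (rule nn_integral_cmult[symmetric])
        have "(\<lambda>s. ennreal ((indicator {0..<1} s * \<omega> s) * s) * indicator {r..<1} s) \<in> borel_measurable lborel" by measurable
        then show "(\<lambda>s. ennreal (\<omega> s * s) * indicator {r..<1} s) \<in> borel_measurable lborel"
          by (rule measurable_cong[THEN iffD1, rotated]) (use r in \<open>auto split: split_indicator\<close>)
      qed
      also have "\<dots> \<le> Y"
        unfolding Y_def
      proof (intro nn_integral_mono)
        fix s :: real
        have "ennreal (m r) * ennreal (\<omega> s * s) \<le> ennreal (m s) * ennreal (\<omega> s * s)" if "r \<le> s" "s < 1"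
          using that r by (intro mult_right_mono ennreal_leI mono) auto
        then show "ennreal (m r) * (ennreal (\<omega> s * s) * indicator {r..<1} s) \<le> ennreal (m s) * ennreal (\<omega> s * s) * indicator {0..<1} s"
          using r by (auto split: split_indicator)
      qed
      finally have "m r * (omega_hat \<omega> r / 2) \<le> X * pi" unfolding Y using X0 by (simp add: ennreal_le_iff)
      then show ?thesis by (simp add: mult_ac)
    qed
    have Fp: "cmod (F z) powr p \<le> C1 * X * (1 - cmod z) powr (- 2 * p)" if z: "cmod z < 1" for z
    proof -
      define r where "r = cmod z"
      define s where "s = (1 + r) / 2"
      have r: "0 \<le> r" "r < 1" using z by (auto simp: r_def)
      have s: "1/2 \<le> s" "s < 1" "1 - s = (1 - r) / 2" using r by (auto simp: s_def field_simps)
      have "m s * (1 - s) powr (2 * p - 1) \<le> m s * (L * omega_hat \<omega> s)"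
        using s m0 by (intro mult_left_mono L(2)) auto
      also have "\<dots> = L * (m s * omega_hat \<omega> s)" by simp
      also have "\<dots> \<le> L * (2 * pi * X)"
        using L s by (intro mult_left_mono growth) auto
      finally have "m s * (1 - s) powr (2 * p - 1) \<le> 2 * pi * L * X" by (simp add: mult_ac)
      moreover have "(1 - s) powr (2 * p - 1) = (1 - r) powr (2 * p - 1) / 2 powr (2 * p - 1)"
        using r by (simp add: s(3) powr_divide)
      ultimately have "m s * (1 - r) powr (2 * p - 1) \<le> 2 * pi * L * X * 2 powr (2 * p - 1)"
        by (simp add: pos_divide_le_eq)
      then have ms: "m s \<le> 2 * pi * L * X * 2 powr (2 * p - 1) / (1 - r) powr (2 * p - 1)"
        using r by (simp add: pos_le_divide_eq)
      have "cmod (F z) powr p \<le> 4 / (pi * (1 - r)) * m s"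
        using pointwise_le_circle_int[OF holF p(1) _ z] p by (simp add: r_def s_def m_def)
      also have "\<dots> \<le> 4 / (pi * (1 - r)) * (2 * pi * L * X * 2 powr (2 * p - 1) / (1 - r) powr (2 * p - 1))"
        using ms r by (intro mult_left_mono) auto
      also have "\<dots> = C1 * X * (1 / ((1 - r) powr 1 * (1 - r) powr (2 * p - 1)))"
        using r by (simp add: C1_def)
      also have "(1 - r) powr 1 * (1 - r) powr (2 * p - 1) = (1 - r) powr (2 * p)"
        by (simp only: powr_add[symmetric]) simp
      also have "1 / (1 - r) powr (2 * p) = (1 - r) powr (- 2 * p)"
        by (simp add: powr_minus_divide)
      finally show ?thesis by (simp add: r_def)
    qed
    have F1: "cmod (F z) \<le> ((C1 * X) powr e * v (cmod z)) * cmod (F z) powr p" if z: "cmod z < 1" for z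
    proof -
      have ep: "p * e = 1 - p" using p by (simp add: e_def)
      have "cmod (F z) = cmod (F z) powr (p * e) * cmod (F z) powr p"
        unfolding ep by (simp flip: powr_add)
      also have "cmod (F z) powr (p * e) = (cmod (F z) powr p) powr e" by (simp add: powr_powr)
      also have "\<dots> \<le> (C1 * X * (1 - cmod z) powr (- 2 * p)) powr e"
        using Fp[OF z] e by (intro powr_mono2) auto
      also have "\<dots> = (C1 * X) powr e * (1 - cmod z) powr (- 2 * (p * e))"
        using C1 X0 by (simp add: powr_mult powr_powr mult.assoc)
      also have "(1 - cmod z) powr (- 2 * (p * e)) = v (cmod z)"
        unfolding ep v_def by (simp add: algebra_simps)
      finally show ?thesis by (simp add: mult_right_mono)
    qed
    have m1: "circle_int 1 F r \<le> ((C1 * X) powr e * v r) * m r" if r: "0 \<le> r" "r < 1" for r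
    proof -
      have "circle_int 1 F r \<le> integral {0..2*pi} (\<lambda>x. ((C1 * X) powr e * v r) * cmod (F (of_real r * cis x)) powr p)"
        unfolding circle_int_def
      proof (rule integral_le)
        show "(\<lambda>x. cmod (F (of_real r * cis x)) powr 1) integrable_on {0..2*pi}"
          by (rule integrable_on_circle_powr[OF holF]) (use r in auto)
        show "(\<lambda>x. ((C1 * X) powr e * v r) * cmod (F (of_real r * cis x)) powr p) integrable_on {0..2*pi}"
          by (intro integrable_on_mult_right integrable_on_circle_powr[OF holF]) (use r p in auto)
        fix x
        show "cmod (F (of_real r * cis x)) powr 1 \<le> ((C1 * X) powr e * v r) * cmod (F (of_real r * cis x)) powr p"
          using F1[of "of_real r * cis x"] r by (simp add: norm_mult)
      qed
      then show ?thesis by (simp add: m_def circle_int_def)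
    qed
    \<comment> \<open>Since \<open>m\<close> increases, the tail comparison \<open>tails\<close> is
      enough to exchange \<open>v\<close> for \<omega>(s) s, although no pointwise comparison of the
      two weights is available.\<close>
    have mv: "(\<integral>\<^sup>+s\<in>{0..<1}. ennreal (m s) * ennreal (v s) \<partial>lborel) \<le> ennreal K * Y"
      unfolding Y_def
    proof (rule nn_integral_increasing_weight_le)
      show "(\<lambda>s. ennreal (v s) * indicator {0..<1} s) \<in> borel_measurable borel"
        unfolding v_def by measurable
      have "(\<lambda>s. ennreal ((indicator {0..<1} s * \<omega> s) * s) * indicator {0..<1} s) \<in> borel_measurable borel" by measurable
      then show "(\<lambda>s. ennreal (\<omega> s * s) * indicator {0..<1} s) \<in> borel_measurable borel"
        by (rule measurable_cong[THEN iffD1, rotated]) (auto split: split_indicator)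
    qed (use mono m0 mm tails in auto)
    define Z where "Z = (C1 * X) powr e"
    have Z: "0 \<le> Z" by (simp add: Z_def)
    have "(\<integral>\<^sup>+r\<in>{0..<1}. ennreal (circle_int 1 F r) * ennreal r \<partial>lborel)
       \<le> (\<integral>\<^sup>+r. ennreal Z * (ennreal (m r) * ennreal (v r) * indicator {0..<1} r) \<partial>lborel)"
    proof (intro nn_integral_mono)
      fix r :: real
      have "ennreal (circle_int 1 F r) * ennreal r \<le> ennreal Z * (ennreal (m r) * ennreal (v r))" if r: "0 \<le> r" "r < 1"
      proof -
        have "ennreal (circle_int 1 F r) * ennreal r \<le> ennreal (Z * v r * m r) * ennreal 1"
          using m1[OF r] r unfolding Z_def by (intro mult_mono ennreal_leI) auto
        also have "\<dots> = ennreal Z * (ennreal (m r) * ennreal (v r))"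
          using Z m0 by (simp add: ennreal_mult'[symmetric] v_def mult_ac)
        finally show ?thesis .
      qed
      then show "ennreal (circle_int 1 F r) * ennreal r * indicator {0..<1} r
        \<le> ennreal Z * (ennreal (m r) * ennreal (v r) * indicator {0..<1} r)"
        by (auto split: split_indicator)
    qed
    also have "\<dots> = ennreal Z * (\<integral>\<^sup>+s\<in>{0..<1}. ennreal (m s) * ennreal (v s) \<partial>lborel)"
    proof (rule nn_integral_cmult)
      have "(\<lambda>s. ennreal (indicator {0..<1} s * m s) * (ennreal (v s) * indicator {0..<1} s)) \<in> borel_measurable lborel"
        using mm unfolding v_def by measurable
      then show "(\<lambda>s. ennreal (m s) * ennreal (v s) * indicator {0..<1} s) \<in> borel_measurable lborel"
        by (rule measurable_cong[THEN iffD1, rotated]) (auto split: split_indicator)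
    qed
    also have "\<dots> \<le> ennreal Z * (ennreal K * Y)" by (intro mult_left_mono mv) simp
    finally have "(\<integral>\<^sup>+r\<in>{0..<1}. ennreal (circle_int 1 F r) * ennreal r \<partial>lborel) \<le> ennreal (Z * (K * (X * pi)))"
      using Z K X0 by (simp add: Y ennreal_mult'[symmetric])
    then have "D_int 1 (std_weight 0) f \<le> ennreal (Z * (K * (X * pi))) / ennreal pi"
      unfolding D_int_unweighted[OF hol] F_def by (rule divide_right_mono_ennreal)
    also have "\<dots> = ennreal (Z * K * X)"
      using Z K X0 by (simp add: divide_ennreal)
    \<comment> \<open>Homogeneity: e + 1 = 1/p, so the bound is a multiple of the first power of the
      quasi-norm.\<close>
    also have "Z * K * X = C2 * X powr (1/p)"
    proof -
      have "X powr e * X = X powr (1/p)"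
      proof (cases "X = 0")
        case False
        then have "X powr e * X = X powr e * X powr 1" using X0 by simp
        also have "\<dots> = X powr (e + 1)" by (simp only: powr_add)
        also have "e + 1 = 1/p" using p by (simp add: e_def field_simps)
        finally show ?thesis .
      qed simp
      then show ?thesis using C1 X0 by (simp add: Z_def C2_def powr_mult mult_ac)
    qed
    finally show ?thesis by (simp add: X_def)
  qed
  have "f \<in> D_space 1 (std_weight 0) \<and> D_norm 1 (std_weight 0) f \<le> (C2 + 1) * D_norm p \<omega> f" if f: "f \<in> D_space p \<omega>" for f
  proof
    define X where "X = enn2real (D_int p \<omega> f)"
    have X0: "0 \<le> X" by (simp add: X_def)
    have bd: "D_int 1 (std_weight 0) f \<le> ennreal (C2 * X powr (1/p))" using main[OF f] by (simp add: X_def)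
    then have "D_int 1 (std_weight 0) f < \<infinity>" by (simp add: le_less_trans)
    then show "f \<in> D_space 1 (std_weight 0)" using f by (simp add: D_space_def)
    have N: "D_norm p \<omega> f = (X + cmod (f 0) powr p) powr (1/p)" by (simp add: D_norm_def X_def)
    have 1: "enn2real (D_int 1 (std_weight 0) f) \<le> C2 * X powr (1/p)"
      using bd C2 by (intro enn2real_leI) auto
    have "X powr (1/p) \<le> D_norm p \<omega> f" unfolding N using X0 p by (intro powr_mono2) auto
    with C2 have 2: "C2 * X powr (1/p) \<le> C2 * D_norm p \<omega> f" by (intro mult_left_mono) auto
    have "cmod (f 0) = (cmod (f 0) powr p) powr (1/p)" using p by (simp add: powr_powr)
    also have "\<dots> \<le> D_norm p \<omega> f" unfolding N using X0 p by (intro powr_mono2) auto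
    finally have 3: "cmod (f 0) \<le> D_norm p \<omega> f" .
    have "D_norm 1 (std_weight 0) f = enn2real (D_int 1 (std_weight 0) f) + cmod (f 0)"
      by (simp add: D_norm_def add_nonneg_nonneg)
    also have "\<dots> \<le> (C2 + 1) * D_norm p \<omega> f" using 1 2 3 by (simp add: algebra_simps)
    finally show "D_norm 1 (std_weight 0) f \<le> (C2 + 1) * D_norm p \<omega> f" .
  qed
  then show ?thesis unfolding id_bounded_into_D10_def by blast
qed

theorem mainTheorem1:
  fixes p :: real and \<omega> :: "real \<Rightarrow> real"
  assumes "0 < p" "p < 1" "radial_weight \<omega>" "D_hat \<omega>"
  shows "((T_Hinf p \<omega> \<subseteq> {g. \<exists>c. \<forall>z\<in>disc. g z = c})
           \<longleftrightarrow> (SUP r\<in>{0..<1}. ennreal ((1 - r) powr (2 - 1/p) / omega_hat \<omega> r powr (1/p))) = \<infinity>)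
    \<and> ((T_Hinf p \<omega> \<subseteq> {g. \<exists>c. \<forall>z\<in>disc. g z = c})
           \<longleftrightarrow> (SUP r\<in>{0..<1}. ennreal (1 - r) *
                 (\<Sum>k. ennreal (r ^ (2 * k) /
                    (omega_hat \<omega> (1 - 1 / real (Suc k)) powr (1/p) * real (Suc k) powr (2 - 1/p))))) = \<infinity>)
    \<and> ((T_Hinf p \<omega> \<subseteq> {g. \<exists>c. \<forall>z\<in>disc. g z = c})
           \<longleftrightarrow> \<not> id_bounded_into_D10 p \<omega>)"
proof -
  let ?const = "T_Hinf p \<omega> \<subseteq> {g. \<exists>c. \<forall>z\<in>disc. g z = c}"
  \<comment> \<open>The implications form a cycle through the negation of
    \<open>ratio_bounded\<close>, to which both supremum conditions have been reduced.\<close>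
  have "?const \<Longrightarrow> \<not> id_bounded_into_D10 p \<omega>"
    using not_T_Hinf_constant_if_id_bounded by blast
  moreover have "\<not> id_bounded_into_D10 p \<omega> \<Longrightarrow> \<not> ratio_bounded p \<omega>"
    using id_bounded_if_ratio_bounded[OF assms(1-3)] by blast
  moreover have "\<not> ratio_bounded p \<omega> \<Longrightarrow> ?const"
    by (rule T_Hinf_constant_if_ratio_unbounded[OF assms(1,3,4)])
  ultimately show ?thesis
    unfolding SUP_ratio_eq_top_iff SUP_series_eq_top_iff[OF assms(3,1)] by blast
qed

end
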